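(* Let $n\in\mathbb{N}$, $\alpha>-1$, and $a\in L^\infty([0,1))$. Then $T^{(\alpha)}_{n,\widetilde{a}}\in\mathcal{R}_n^{(\alpha)}$ and $\Phi_n^{(\alpha)}(T^{(\alpha)}_{n,\widetilde{a}})=\gamma^{(\alpha)}_n(a)$.
   Context: $\mathbb{N}=\{1,2,\dots\}$, $\mathbb{N}_0=\{0,1,2,\dots\}$, $\mathbb{D}$ is the open unit disk, $\mathbb{T}$ the unit circle, and $\mathrm{d}\mu_\alpha(z)=\frac{\alpha+1}{\pi}(1-|z|^2)^\alpha\,\mathrm{d}\mu(z)$ on $\mathbb{D}$, where $\mu$ is Lebesgue plane measure; $\langle\cdot,\cdot\rangle$ is the inner product of $L^2(\mathbb{D},\mu_\alpha)$. A function $f$ is $n$-analytic if it is smooth and $(\partial/\partial\overline{z})^n f=0$. $\mathcal{A}_n^2(\mathbb{D},\mu_\alpha)$ is the closed subspace of $L^2(\mathbb{D},\mu_\alpha)$ of $n$-analytic square-integrable functions on $\mathbb{D}$. $\mathcal{R}_n^{(\alpha)}$ is the von Neumann algebra of all bounded operators on $\mathcal{A}_n^2(\mathbb{D},\mu_\alpha)$ commuting with all rotations $f\mapsto f(\tau^{-1}\,\cdot)$, $\tau\in\mathbb{T}$. For $g\in L^\infty(\mathbb{D})$, $T^{(\alpha)}_{n,g}f=P(gf)$ on $\mathcal{A}_n^2(\mathbb{D},\mu_\alpha)$, where $P$ is the orthogonal projection of $L^2(\mathbb{D},\mu_\alpha)$ onto $\mathcal{A}_n^2(\mathbb{D},\mu_\alpha)$.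 For $a\in L^\infty([0,1))$, $\widetilde{a}(z)=a(|z|)$, $z\in\mathbb{D}$. For $p,q\in\mathbb{N}_0$ the normalized disk polynomial is $$b^{(\alpha)}_{p,q}(z)=(-1)^{p+q}\,\widetilde{c}^{(\alpha)}_{p,q}\,(1-z\overline{z})^{-\alpha}\,\frac{\partial^q}{\partial z^q}\frac{\partial^p}{\partial\overline{z}^p}\Bigl((1-z\overline{z})^{p+q+\alpha}\Bigr),\qquad \widetilde{c}^{(\alpha)}_{p,q}=\sqrt{\frac{(\alpha+p+q+1)\Gamma(\alpha+p+1)\Gamma(\alpha+q+1)}{(\alpha+1)\,p!\,q!\,\Gamma(\alpha+p+q+1)^2}}.$$ $\mathfrak{M}_n$ is the W*-algebra of all bounded sequences $(A_\xi)_{\xi=-n+1}^\infty$ of complex square matrices $A_\xi$ of order $\min\{n,n+\xi\}$. The isomorphism $\Phi_n^{(\alpha)}:\mathcal{R}_n^{(\alpha)}\to\mathfrak{M}_n$ is $$\Phi_n^{(\alpha)}(S)=\Bigl(\bigl[\langle S\,b^{(\alpha)}_{\xi+k,k},b^{(\alpha)}_{\xi+j,j}\rangle\bigr]_{j,k=\max\{0,-\xi\}}^{n-1}\Bigr)_{\xi=-n+1}^\infty.$$ For $m\in\mathbb{N}_0$ and $\beta>-1$, $Q_m^{(\alpha,\beta)}(t)=\frac{(-1)^m}{m!}(1-t)^{-\alpha}t^{-\beta}\frac{\mathrm{d}^m}{\mathrm{d}t^m}\bigl((1-t)^{m+\alpha}t^{m+\beta}\bigr)$ is the shifted Jacobi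 polynomial, and for $t\in(0,1)$ $$\mathcal{J}_m^{(\alpha,\beta)}(t)=\sqrt{\frac{(2m+\alpha+\beta+1)\Gamma(m+\alpha+\beta+1)\,m!}{\Gamma(m+\alpha+1)\Gamma(m+\beta+1)}}\,(1-t)^{\alpha/2}t^{\beta/2}Q_m^{(\alpha,\beta)}(t).$$ Define $$\beta_{a,\alpha,\xi,j,k}=\int_0^1 a(\sqrt{t})\,\mathcal{J}^{(\alpha,|\xi|)}_{\min\{j,j+\xi\}}(t)\,\mathcal{J}^{(\alpha,|\xi|)}_{\min\{k,k+\xi\}}(t)\,\mathrm{d}t,$$ and let $\gamma_n^{(\alpha)}(a)=(\gamma_n^{(\alpha)}(a)_\xi)_{\xi=-n+1}^\infty$ be the matrix sequence with $\gamma_n^{(\alpha)}(a)_\xi=[\beta_{a,\alpha,\xi,j,k}]_{j,k=\max\{0,-\xi\}}^{n-1}$. *)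

theory Defs
  imports "HOL-Analysis.Analysis" "Jordan_Normal_Form.Matrix"
begin

abbreviation unit_disk :: "complex set" where
  "unit_disk \<equiv> ball 0 1"

definition disk_measure :: "real \<Rightarrow> complex measure" where
  "disk_measure \<alpha> =
     density (lebesgue_on unit_disk) (\<lambda>z. ennreal ((\<alpha> + 1) / pi * (1 - (cmod z)\<^sup>2) powr \<alpha>))"

definition Linfty :: "'a measure \<Rightarrow> ('a \<Rightarrow> complex) set" where
  "Linfty M = {f \<in> borel_measurable M. \<exists>C. AE x in M. cmod (f x) \<le> C}"

definition Ltwo :: "'a measure \<Rightarrow> ('a \<Rightarrow> complex) set" where
  "Ltwo M = {f \<in> borel_measurable M. integrable M (\<lambda>x. (cmod (f x))\<^sup>2)}"

definition Ltwo_inner :: "'a measure \<Rightarrow> ('a \<Rightarrow> complex) \<Rightarrow> ('a \<Rightarrow> complex) \<Rightarrow> complex" where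
  "Ltwo_inner M f g = (LINT x|M. f x * cnj (g x))"

definition Ltwo_norm :: "'a measure \<Rightarrow> ('a \<Rightarrow> complex) \<Rightarrow> real" where
  "Ltwo_norm M f = sqrt (LINT x|M. (cmod (f x))\<^sup>2)"


(* Real differentiability of order k on an open set, in the sense of iterated directional
   derivatives that are again differentiable (continuous, for the last one). *)
primrec Ck_on :: "nat \<Rightarrow> ('a::real_normed_vector \<Rightarrow> 'b::real_normed_vector) \<Rightarrow> 'a set \<Rightarrow> bool" where
  "Ck_on 0 f S \<longleftrightarrow> continuous_on S f"
| "Ck_on (Suc k) f S \<longleftrightarrow>
     (\<forall>x\<in>S. f differentiable (at x)) \<and> (\<forall>v. Ck_on k (\<lambda>x. frechet_derivative f (at x) v) S)"

definition smooth_on :: "'a::real_normed_vector set \<Rightarrow> ('a \<Rightarrow> 'b::real_normed_vector) \<Rightarrow> bool" where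
  "smooth_on S f \<longleftrightarrow> (\<forall>k. Ck_on k f S)"

definition wirtinger_z :: "(complex \<Rightarrow> complex) \<Rightarrow> complex \<Rightarrow> complex" where
  "wirtinger_z f z =
     (frechet_derivative f (at z) 1 - \<i> * frechet_derivative f (at z) \<i>) / 2"

definition wirtinger_zbar :: "(complex \<Rightarrow> complex) \<Rightarrow> complex \<Rightarrow> complex" where
  "wirtinger_zbar f z =
     (frechet_derivative f (at z) 1 + \<i> * frechet_derivative f (at z) \<i>) / 2"

definition n_analytic_on :: "nat \<Rightarrow> complex set \<Rightarrow> (complex \<Rightarrow> complex) \<Rightarrow> bool" where
  "n_analytic_on n S f \<longleftrightarrow> smooth_on S f \<and> (\<forall>z\<in>S. (wirtinger_zbar ^^ n) f z = 0)"

(* An L2-class contains at most one n-analytic function on the disk. The space is represented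
   by these functions, extended by 0 outside the disk, so that equality of elements
   is equality of functions. *)
definition poly_bergman :: "nat \<Rightarrow> real \<Rightarrow> (complex \<Rightarrow> complex) set" where
  "poly_bergman n \<alpha> =
     {f \<in> Ltwo (disk_measure \<alpha>). n_analytic_on n unit_disk f \<and> (\<forall>z. z \<notin> unit_disk \<longrightarrow> f z = 0)}"

definition poly_bergman_proj :: "nat \<Rightarrow> real \<Rightarrow> (complex \<Rightarrow> complex) \<Rightarrow> complex \<Rightarrow> complex" where
  "poly_bergman_proj n \<alpha> f =
     (THE h. h \<in> poly_bergman n \<alpha> \<and>
        (\<forall>u\<in>poly_bergman n \<alpha>. Ltwo_inner (disk_measure \<alpha>) (\<lambda>z. f z - h z) u = 0))"

(* Operators on the space are extensional functions: undefined outside the space. *)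
definition bounded_operators ::
    "nat \<Rightarrow> real \<Rightarrow> ((complex \<Rightarrow> complex) \<Rightarrow> complex \<Rightarrow> complex) set" where
  "bounded_operators n \<alpha> =
     {S \<in> poly_bergman n \<alpha> \<rightarrow>\<^sub>E poly_bergman n \<alpha>.
        (\<forall>f\<in>poly_bergman n \<alpha>. \<forall>g\<in>poly_bergman n \<alpha>. S (\<lambda>z. f z + g z) = (\<lambda>z. S f z + S g z)) \<and>
        (\<forall>c. \<forall>f\<in>poly_bergman n \<alpha>. S (\<lambda>z. c * f z) = (\<lambda>z. c * S f z)) \<and>
        (\<exists>C. \<forall>f\<in>poly_bergman n \<alpha>.
           Ltwo_norm (disk_measure \<alpha>) (S f) \<le> C * Ltwo_norm (disk_measure \<alpha>) f)}"

definition rotation :: "complex \<Rightarrow> (complex \<Rightarrow> complex) \<Rightarrow> complex \<Rightarrow> complex" where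
  "rotation \<tau> f = (\<lambda>z. f (inverse \<tau> * z))"

definition radial_operators ::
    "nat \<Rightarrow> real \<Rightarrow> ((complex \<Rightarrow> complex) \<Rightarrow> complex \<Rightarrow> complex) set" where
  "radial_operators n \<alpha> =
     {S \<in> bounded_operators n \<alpha>.
        \<forall>\<tau>\<in>sphere 0 1. \<forall>f\<in>poly_bergman n \<alpha>. S (rotation \<tau> f) = rotation \<tau> (S f)}"

definition toeplitz ::
    "nat \<Rightarrow> real \<Rightarrow> (complex \<Rightarrow> complex) \<Rightarrow> (complex \<Rightarrow> complex) \<Rightarrow> complex \<Rightarrow> complex" where
  "toeplitz n \<alpha> g = (\<lambda>f\<in>poly_bergman n \<alpha>. poly_bergman_proj n \<alpha> (\<lambda>z. g z * f z))"

definition radial_symbol :: "(real \<Rightarrow> complex) \<Rightarrow> complex \<Rightarrow> complex" where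
  "radial_symbol a z = a (cmod z)"

definition disk_poly_const :: "real \<Rightarrow> nat \<Rightarrow> nat \<Rightarrow> real" where
  "disk_poly_const \<alpha> p q =
     sqrt ((\<alpha> + real p + real q + 1) * Gamma (\<alpha> + real p + 1) * Gamma (\<alpha> + real q + 1) /
           ((\<alpha> + 1) * fact p * fact q * (Gamma (\<alpha> + real p + real q + 1))\<^sup>2))"

definition disk_poly :: "real \<Rightarrow> nat \<Rightarrow> nat \<Rightarrow> complex \<Rightarrow> complex" where
  "disk_poly \<alpha> p q z =
     (if z \<in> unit_disk
      then (-1) ^ (p + q) * of_real (disk_poly_const \<alpha> p q)
             * of_real ((1 - (cmod z)\<^sup>2) powr (- \<alpha>))
             * (wirtinger_z ^^ q) ((wirtinger_zbar ^^ p)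
                 (\<lambda>w. of_real ((1 - (cmod w)\<^sup>2) powr (real p + real q + \<alpha>)))) z
      else 0)"

(* The block of frequency \<xi> has rows and columns max 0 (- \<xi>), ..., n - 1;
   JNF matrices are indexed from 0, hence the shift. *)
definition frequency_block :: "nat \<Rightarrow> int \<Rightarrow> (nat \<Rightarrow> nat \<Rightarrow> complex) \<Rightarrow> complex mat" where
  "frequency_block n \<xi> A =
     (let d = nat (min (int n) (int n + \<xi>)); s = nat (max 0 (- \<xi>))
      in mat d d (\<lambda>(j, k). A (s + j) (s + k)))"

(* Matrix sequences are indexed by the integers \<xi> \<ge> 1 - n and undefined elsewhere. *)
definition Phi ::
    "nat \<Rightarrow> real \<Rightarrow> ((complex \<Rightarrow> complex) \<Rightarrow> complex \<Rightarrow> complex) \<Rightarrow> int \<Rightarrow> complex mat" where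
  "Phi n \<alpha> = (\<lambda>S\<in>radial_operators n \<alpha>. \<lambda>\<xi>\<in>{1 - int n..}.
     frequency_block n \<xi> (\<lambda>j k. Ltwo_inner (disk_measure \<alpha>)
       (S (disk_poly \<alpha> (nat (\<xi> + int k)) k)) (disk_poly \<alpha> (nat (\<xi> + int j)) j)))"

definition shifted_jacobi :: "nat \<Rightarrow> real \<Rightarrow> real \<Rightarrow> real \<Rightarrow> real" where
  "shifted_jacobi m \<alpha> \<beta> t =
     (-1) ^ m / fact m * (1 - t) powr (- \<alpha>) * t powr (- \<beta>)
       * (deriv ^^ m) (\<lambda>s. (1 - s) powr (real m + \<alpha>) * s powr (real m + \<beta>)) t"

definition jacobi_function :: "nat \<Rightarrow> real \<Rightarrow> real \<Rightarrow> real \<Rightarrow> real" where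
  "jacobi_function m \<alpha> \<beta> t =
     sqrt ((2 * real m + \<alpha> + \<beta> + 1) * Gamma (real m + \<alpha> + \<beta> + 1) * fact m /
           (Gamma (real m + \<alpha> + 1) * Gamma (real m + \<beta> + 1)))
       * (1 - t) powr (\<alpha> / 2) * t powr (\<beta> / 2) * shifted_jacobi m \<alpha> \<beta> t"

definition beta_coeff :: "(real \<Rightarrow> complex) \<Rightarrow> real \<Rightarrow> int \<Rightarrow> nat \<Rightarrow> nat \<Rightarrow> complex" where
  "beta_coeff a \<alpha> \<xi> j k =
     (LINT t:{0<..<1}|lebesgue. a (sqrt t)
        * of_real (jacobi_function (nat (min (int j) (int j + \<xi>))) \<alpha> (of_int \<bar>\<xi>\<bar>) t)
        * of_real (jacobi_function (nat (min (int k) (int k + \<xi>))) \<alpha> (of_int \<bar>\<xi>\<bar>) t))"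

definition gamma_seq :: "nat \<Rightarrow> real \<Rightarrow> (real \<Rightarrow> complex) \<Rightarrow> int \<Rightarrow> complex mat" where
  "gamma_seq n \<alpha> a = (\<lambda>\<xi>\<in>{1 - int n..}. frequency_block n \<xi> (beta_coeff a \<alpha> \<xi>))"

end

(*
  An n-analytic function on the disk is a sum of cnj z ^ k * g k z over k < n with g k holomorphic,
  and the g k are bounded on compact sets by the L2 norm of the function. Hence the n-analytic
  L2 functions form a complete space, and the orthogonal projection onto it exists by the
  parallelogram argument. A radial symbol commutes with rotations of the disk, rotations preserve
  the measure and the space, and so the Toeplitz operator commutes with them by uniqueness of the
  projection. Since the disk polynomials lie in the space, the projection disappears from the
  matrix entries <T b, b'> = <a b, b'>. The two Rodrigues formulas, expanded by Leibniz' rule,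
  show that b_{p,q}(z) is a radial factor times a power of z or cnj z, the radial factor being
  a normalised Jacobi polynomial in t = |z|^2. In the entries of one frequency the angular parts
  cancel, and the substitution t = |z|^2 turns the integral over the disk into the one over (0,1).
*)

theory Submission
  imports Defs "HOL-Complex_Analysis.Complex_Analysis"
begin

section \<open>Polyanalytic functions\<close>

text \<open>An element of the space is a function and the projection is a definite description over
  functions, so uniqueness must hold at every point and not only almost everywhere. This is why the
  holomorphic coefficients \<open>g k\<close> are estimated rather than the function itself: the
  bounds give uniqueness everywhere, and locally uniform limits of the coefficients are holomorphic
  by Weierstrass, so that a limit is again smooth and n-analytic. Near the unit circle the weight
  vanishes or blows up according to the sign of \<alpha>; pointwise estimates therefore live on a
  disk of radius R < 1, where the weight has a positive minimum. Symbols are only Lebesgue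
  measurable, so each substitution has to respect the null sets of the completed measure. The
  variable |z|^2 is the natural one because it pushes area forward to pi times length. This pi
  cancels the one in the weight, and the remaining \<alpha> + 1 is shared by the two Jacobi
  functions of an entry, one factor \<open>sqrt (\<alpha> + 1)\<close> each.\<close>

lemma has_derivative_cong_open:
  assumes "open S" "x \<in> S" "\<And>y. y \<in> S \<Longrightarrow> f y = g y"
  shows "(f has_derivative D) (at x) \<longleftrightarrow> (g has_derivative D) (at x)"
  using has_derivative_transform_within_open[OF _ assms(1,2), of f D UNIV g]
    has_derivative_transform_within_open[OF _ assms(1,2), of g D UNIV f] assms(3) by auto

lemma frechet_derivative_cong_open:
  assumes "open S" "x \<in> S" "\<And>y. y \<in> S \<Longrightarrow> f y = g y"
  shows "frechet_derivative f (at x) = frechet_derivative g (at x)"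
  using has_derivative_cong_open[OF assms] by (simp add: frechet_derivative_def)

lemma frechet_derivative_add:
  assumes "f differentiable at x" "g differentiable at x"
  shows "frechet_derivative (\<lambda>x. f x + g x) (at x) v =
    frechet_derivative f (at x) v + frechet_derivative g (at x) v"
proof -
  have "((\<lambda>x. f x + g x) has_derivative
      (\<lambda>v. frechet_derivative f (at x) v + frechet_derivative g (at x) v)) (at x)"
    using assms by (intro has_derivative_add) (simp_all flip: frechet_derivative_works)
  from frechet_derivative_at[OF this, symmetric] show ?thesis by simp
qed

text \<open>The rules for the derivative of a sum or product hold only at points of S, so inductions
  on the order must replace a derivative by its formula there. Openness makes this legitimate, since
  derivatives at a point are local.\<close>

lemma Ck_on_cong:
  assumes "open S" "\<And>x. x \<in> S \<Longrightarrow> f x = g x"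
  shows "Ck_on k f S \<longleftrightarrow> Ck_on k g S"
  using assms
proof (induction k arbitrary: f g)
  case 0
  then show ?case by (auto intro: continuous_on_cong[THEN iffD1])
next
  case (Suc k)
  have "f differentiable (at x) \<longleftrightarrow> g differentiable (at x)" if "x \<in> S" for x
    unfolding differentiable_def using has_derivative_cong_open[of S x f g] Suc.prems that by simp
  moreover have "Ck_on k (\<lambda>x. frechet_derivative f (at x) v) S \<longleftrightarrow>
      Ck_on k (\<lambda>x. frechet_derivative g (at x) v) S" for v
    using frechet_derivative_cong_open[of S _ f g] Suc.prems by (intro Suc.IH) auto
  ultimately show ?case by simp
qed

text \<open>Continuity is demanded only at the last order; at the lower ones it has to come from
  differentiability.\<close>

lemma Ck_on_SucD: "Ck_on (Suc k) f S \<Longrightarrow> Ck_on k f S"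
proof (induction k arbitrary: f)
  case 0
  then show ?case
    by (auto intro!: continuous_at_imp_continuous_on differentiable_imp_continuous_within)
next
  case (Suc k)
  have "Ck_on k (\<lambda>x. frechet_derivative f (at x) v) S" for v
    using Suc.prems unfolding Ck_on.simps(2)[of "Suc k"] by (intro Suc.IH) blast
  then show ?case
    using Suc.prems by simp
qed

lemma Ck_on_const: "Ck_on k (\<lambda>x. c) S"
  by (induction k arbitrary: c) auto

lemma Ck_on_add:
  assumes "open S" "Ck_on k f S" "Ck_on k g S"
  shows "Ck_on k (\<lambda>x. f x + g x) S"
  using assms
proof (induction k arbitrary: f g)
  case 0
  then show ?case by (auto intro: continuous_intros)
next
  case (Suc k)
  have "Ck_on k (\<lambda>x. frechet_derivative (\<lambda>x. f x + g x) (at x) v) S" for v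
    using Suc.prems Suc.IH
    by (subst Ck_on_cong[OF \<open>open S\<close>,
          where g = "\<lambda>x. frechet_derivative f (at x) v + frechet_derivative g (at x) v"])
      (auto simp: frechet_derivative_add)
  then show ?case using Suc.prems by auto
qed

lemma Ck_on_mult:
  fixes f g :: "'a::real_normed_vector \<Rightarrow> 'b::real_normed_algebra"
  assumes "open S" "Ck_on k f S" "Ck_on k g S"
  shows "Ck_on k (\<lambda>x. f x * g x) S"
  using assms
proof (induction k arbitrary: f g)
  case 0
  then show ?case by (auto intro: continuous_intros)
next
  case (Suc k)
  have der: "((\<lambda>x. f x * g x) has_derivative
      (\<lambda>v. f x * frechet_derivative g (at x) v + frechet_derivative f (at x) v * g x)) (at x)"
    if "x \<in> S" for x
    using Suc.prems that by (auto intro!: has_derivative_mult simp flip: frechet_derivative_works)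
  \<comment> \<open>In each term of the product rule one factor stays undifferentiated and has order
    \<open>Suc k\<close>; \<open>Ck_on_SucD\<close> lowers it to k for the induction
    hypothesis.\<close>
  have "Ck_on k (\<lambda>x. frechet_derivative (\<lambda>x. f x * g x) (at x) v) S" for v
    using Suc.prems Suc.IH Ck_on_SucD[of k f S] Ck_on_SucD[of k g S]
    by (subst Ck_on_cong[OF \<open>open S\<close>, where
          g = "\<lambda>x. f x * frechet_derivative g (at x) v + frechet_derivative f (at x) v * g x"])
      (auto intro!: Ck_on_add simp: frechet_derivative_at[OF der, symmetric])
  then show ?case using differentiableI[OF der] by simp
qed

lemma Ck_on_holomorphic:
  assumes "open S" "f holomorphic_on S"
  shows "Ck_on k f S"
  using assms
proof (induction k arbitrary: f)
  case 0
  then show ?case by (simp add: holomorphic_on_imp_continuous_on)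
next
  case (Suc k)
  have der: "(f has_derivative (\<lambda>v. deriv f x * v)) (at x)" if "x \<in> S" for x
    using Suc.prems that holomorphic_derivI has_field_derivative_def by blast
  have "Ck_on k (\<lambda>x. frechet_derivative f (at x) v) S" for v
    using Suc
    by (subst Ck_on_cong[OF \<open>open S\<close>, where g = "\<lambda>x. deriv f x * v"])
      (auto intro!: Ck_on_mult Ck_on_const holomorphic_deriv
        simp: frechet_derivative_at[OF der, symmetric])
  then show ?case using differentiableI[OF der] by simp
qed

lemma Ck_on_cnj: "Ck_on k cnj S"
proof (cases k)
  case (Suc m)
  have der: "(cnj has_derivative cnj) (at x)" for x
    by (rule bounded_linear.has_derivative[OF bounded_linear_cnj has_derivative_ident])
  have "Ck_on m (\<lambda>x. frechet_derivative cnj (at x) v) S" for v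
    by (simp add: frechet_derivative_at[OF der, symmetric] Ck_on_const)
  then show ?thesis using Suc differentiableI[OF der] by simp
qed (auto intro: continuous_intros)

lemma smooth_onD: "smooth_on S f \<Longrightarrow> x \<in> S \<Longrightarrow> f differentiable (at x)"
  unfolding smooth_on_def using Ck_on.simps(2)[of 0 f S] by blast

lemma smooth_on_cong:
  "open S \<Longrightarrow> (\<And>x. x \<in> S \<Longrightarrow> f x = g x) \<Longrightarrow> smooth_on S f \<longleftrightarrow> smooth_on S g"
  by (simp add: smooth_on_def Ck_on_cong[of S f g])

lemma smooth_on_add: "open S \<Longrightarrow> smooth_on S f \<Longrightarrow> smooth_on S g \<Longrightarrow> smooth_on S (\<lambda>x. f x + g x)"
  by (simp add: smooth_on_def Ck_on_add)

lemma smooth_on_mult: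
  fixes f g :: "'a::real_normed_vector \<Rightarrow> 'b::real_normed_algebra"
  shows "open S \<Longrightarrow> smooth_on S f \<Longrightarrow> smooth_on S g \<Longrightarrow> smooth_on S (\<lambda>x. f x * g x)"
  by (simp add: smooth_on_def Ck_on_mult)

lemma smooth_on_const: "smooth_on S (\<lambda>x. c)"
  by (simp add: smooth_on_def Ck_on_const)

lemma smooth_on_power:
  fixes f :: "'a::real_normed_vector \<Rightarrow> 'b::real_normed_algebra_1"
  shows "open S \<Longrightarrow> smooth_on S f \<Longrightarrow> smooth_on S (\<lambda>x. f x ^ m)"
  by (induction m) (auto intro: smooth_on_mult smooth_on_const)

lemma smooth_on_sum:
  "open S \<Longrightarrow> (\<And>i. i \<in> I \<Longrightarrow> smooth_on S (f i)) \<Longrightarrow> smooth_on S (\<lambda>x. \<Sum>i\<in>I. f i x)"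
  by (induction I rule: infinite_finite_induct) (auto intro: smooth_on_add smooth_on_const)

lemma smooth_on_holomorphic: "open S \<Longrightarrow> f holomorphic_on S \<Longrightarrow> smooth_on S f"
  by (simp add: smooth_on_def Ck_on_holomorphic)

lemma smooth_on_cnj: "smooth_on S cnj"
  by (simp add: smooth_on_def Ck_on_cnj)

lemma smooth_on_frechet: "smooth_on S f \<Longrightarrow> smooth_on S (\<lambda>x. frechet_derivative f (at x) v)"
  unfolding smooth_on_def using Ck_on.simps(2)[of _ f S] by blast

lemma smooth_on_wirtinger_zbar: 
  assumes "open S" "smooth_on S f" shows "smooth_on S (wirtinger_zbar f)"
proof -
  have "smooth_on S (\<lambda>z. frechet_derivative f (at z) 1 * (1/2) +
      frechet_derivative f (at z) \<i> * (\<i>/2))"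
    by (intro smooth_on_add smooth_on_mult smooth_on_frechet smooth_on_const assms)
  moreover have "wirtinger_zbar f = (\<lambda>z. frechet_derivative f (at z) 1 * (1/2) +
      frechet_derivative f (at z) \<i> * (\<i>/2))"
    by (auto simp: wirtinger_zbar_def field_simps)
  ultimately show ?thesis by simp
qed

section \<open>Wirtinger derivatives and the Cauchy-Riemann equation\<close>

lemma wirtinger_zbar_cong_open:
  "open S \<Longrightarrow> x \<in> S \<Longrightarrow> (\<And>y. y \<in> S \<Longrightarrow> f y = g y) \<Longrightarrow> wirtinger_zbar f x = wirtinger_zbar g x"
  unfolding wirtinger_zbar_def by (subst (1 2) frechet_derivative_cong_open[of S x f g]) auto

lemma wirtinger_z_cong_open:
  "open S \<Longrightarrow> x \<in> S \<Longrightarrow> (\<And>y. y \<in> S \<Longrightarrow> f y = g y) \<Longrightarrow> wirtinger_z f x = wirtinger_z g x"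
  unfolding wirtinger_z_def by (subst (1 2) frechet_derivative_cong_open[of S x f g]) auto

lemma wirtinger_zbar_funpow_cong_open:
  "open S \<Longrightarrow> x \<in> S \<Longrightarrow> (\<And>y. y \<in> S \<Longrightarrow> f y = g y) \<Longrightarrow>
    (wirtinger_zbar ^^ m) f x = (wirtinger_zbar ^^ m) g x"
proof (induction m arbitrary: x)
  case (Suc m)
  then show ?case by (auto intro!: wirtinger_zbar_cong_open[of S])
qed auto

lemma wirtinger_zbar_has_derivative:
  "(f has_derivative D) (at z) \<Longrightarrow> wirtinger_zbar f z = (D 1 + \<i> * D \<i>) / 2"
  by (simp add: wirtinger_zbar_def frechet_derivative_at[symmetric])

lemma wirtinger_z_has_derivative:
  "(f has_derivative D) (at z) \<Longrightarrow> wirtinger_z f z = (D 1 - \<i> * D \<i>) / 2"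
  by (simp add: wirtinger_z_def frechet_derivative_at[symmetric])

lemma wirtinger_zbar_add:
  assumes "f differentiable at z" "g differentiable at z"
  shows "wirtinger_zbar (\<lambda>z. f z + g z) z = wirtinger_zbar f z + wirtinger_zbar g z"
  using assms by (simp add: wirtinger_zbar_def frechet_derivative_add algebra_simps add_divide_distrib)

lemma wirtinger_zbar_sum:
  assumes "finite I" "\<And>i. i \<in> I \<Longrightarrow> f i differentiable at z"
  shows "wirtinger_zbar (\<lambda>z. \<Sum>i\<in>I. f i z) z = (\<Sum>i\<in>I. wirtinger_zbar (f i) z)"
  using assms
proof (induction I)
  case empty
  then show ?case by (simp add: wirtinger_zbar_def)
next
  case (insert i I)
  then have "(\<lambda>z. \<Sum>i\<in>I. f i z) differentiable at z"
    by (auto intro: differentiable_sum)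
  with insert show ?case by (simp add: wirtinger_zbar_add)
qed

text \<open>A holomorphic factor behaves as a constant under this operator. At k = 0 the truncated
  exponent k - 1 is harmless, because the factor k vanishes.\<close>

lemma wirtinger_zbar_cnj_power_mult:
  assumes "g field_differentiable at z"
  shows "wirtinger_zbar (\<lambda>z. cnj z ^ k * g z) z = of_nat k * cnj z ^ (k - 1) * g z"
proof -
  obtain g' where "(g has_derivative (\<lambda>v. g' * v)) (at z)"
    using assms by (auto simp: field_differentiable_def has_field_derivative_def)
  moreover have "(cnj has_derivative cnj) (at z)"
    by (rule bounded_linear.has_derivative[OF bounded_linear_cnj has_derivative_ident])
  ultimately have "((\<lambda>z. cnj z ^ k * g z) has_derivative
     (\<lambda>v. cnj z ^ k * (g' * v) + of_nat k * cnj v * cnj z ^ (k - 1) * g z)) (at z)"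
    by (intro has_derivative_mult has_derivative_power)
  then show ?thesis
    by (subst wirtinger_zbar_has_derivative) (auto simp: algebra_simps)
qed

text \<open>The equation says D \<i> = \<i> * D 1, which makes the real-linear derivative
  complex-linear.\<close>

lemma cauchy_riemann_imp_field_differentiable:
  assumes "f differentiable at z" "wirtinger_zbar f z = 0"
  shows "f field_differentiable at z"
proof -
  define D where "D = frechet_derivative f (at z)"
  have D: "(f has_derivative D) (at z)"
    using assms(1) by (simp add: D_def flip: frechet_derivative_works)
  then interpret D: linear D by (rule has_derivative_linear)
  have "D 1 + \<i> * D \<i> = 0"
    using assms(2) wirtinger_zbar_has_derivative[OF D] by simp
  then have "D \<i> = \<i> * D 1"
    by (metis (no_types, opaque_lifting) add.commute add_eq_0_iff i_times_eq_iff minus_minus mult_minus_right)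
  have "D v = D 1 * v" for v
  proof -
    have "D v = D (Re v *\<^sub>R 1 + Im v *\<^sub>R \<i>)"
      by (simp add: scaleR_conv_of_real complex_eq[symmetric] mult.commute)
    also have "\<dots> = Re v *\<^sub>R D 1 + Im v *\<^sub>R (\<i> * D 1)"
      by (simp only: D.add D.scaleR \<open>D \<i> = \<i> * D 1\<close>)
    also have "\<dots> = D 1 * v"
      by (subst (3) complex_eq) (simp add: scaleR_conv_of_real algebra_simps)
    finally show ?thesis .
  qed
  then have "D = (\<lambda>v. D 1 * v)" by blast
  with D show ?thesis
    unfolding field_differentiable_def has_field_derivative_def by metis
qed

section \<open>Polyanalytic functions as polynomials in \<open>cnj z\<close> with holomorphic
  coefficients\<close>

lemma smooth_on_polyanalytic_sum:
  assumes "open S" "\<And>k. k < n \<Longrightarrow> g k holomorphic_on S"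
  shows "smooth_on S (\<lambda>z. \<Sum>k<n. cnj z ^ k * g k z)"
  using assms
  by (intro smooth_on_sum smooth_on_mult smooth_on_power smooth_on_cnj smooth_on_holomorphic) auto

lemma wirtinger_zbar_polyanalytic_sum:
  assumes "open S" "\<And>k. k \<le> n \<Longrightarrow> g k holomorphic_on S" "z \<in> S"
  shows "wirtinger_zbar (\<lambda>z. \<Sum>k<Suc n. cnj z ^ k * g k z) z =
    (\<Sum>k<n. cnj z ^ k * (of_nat (Suc k) * g (Suc k) z))"
proof -
  have "(\<lambda>z. cnj z ^ k * g k z) differentiable at z" if "k < Suc n" for k
    using assms that
    by (intro smooth_onD[of S] smooth_on_mult smooth_on_power smooth_on_cnj smooth_on_holomorphic) auto
  then have "wirtinger_zbar (\<lambda>z. \<Sum>k<Suc n. cnj z ^ k * g k z) z =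
      (\<Sum>k<Suc n. wirtinger_zbar (\<lambda>z. cnj z ^ k * g k z) z)"
    by (intro wirtinger_zbar_sum) auto
  also have "\<dots> = (\<Sum>k<Suc n. of_nat k * cnj z ^ (k - 1) * g k z)"
    using assms by (intro sum.cong wirtinger_zbar_cnj_power_mult refl)
      (auto intro: holomorphic_on_imp_differentiable_at[of _ S])
  also have "\<dots> = (\<Sum>k<n. cnj z ^ k * (of_nat (Suc k) * g (Suc k) z))"
    by (subst sum.lessThan_Suc_shift) (auto simp: algebra_simps)
  finally show ?thesis .
qed

lemma n_analytic_on_polyanalytic_sum:
  assumes "open S" "\<And>k. k < n \<Longrightarrow> g k holomorphic_on S"
  shows "n_analytic_on n S (\<lambda>z. \<Sum>k<n. cnj z ^ k * g k z)"
proof -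
  have "(wirtinger_zbar ^^ n) (\<lambda>z. \<Sum>k<n. cnj z ^ k * g k z) z = 0" if "z \<in> S" for z
    using assms(2) that
  proof (induction n arbitrary: g z)
    case (Suc n)
    have "(wirtinger_zbar ^^ Suc n) (\<lambda>z. \<Sum>k<Suc n. cnj z ^ k * g k z) z =
        (wirtinger_zbar ^^ n) (wirtinger_zbar (\<lambda>z. \<Sum>k<Suc n. cnj z ^ k * g k z)) z"
      by (simp add: funpow_Suc_right del: funpow.simps)
    also have "\<dots> = (wirtinger_zbar ^^ n) (\<lambda>z. \<Sum>k<n. cnj z ^ k * (of_nat (Suc k) * g (Suc k) z)) z"
      using Suc.prems assms(1)
      by (intro wirtinger_zbar_funpow_cong_open[of S] wirtinger_zbar_polyanalytic_sum) auto
    also have "\<dots> = 0"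
      using Suc.prems by (intro Suc.IH holomorphic_on_mult) auto
    finally show ?case .
  qed auto
  then show ?thesis
    using smooth_on_polyanalytic_sum[of S n g] assms by (auto simp: n_analytic_on_def)
qed

text \<open>Induction on n: one derivative in the conjugate variable lowers the order, the
  decomposition obtained for it is integrated termwise in powers of \<open>cnj z\<close>, and the
  integration constant is a holomorphic function.\<close>

theorem n_analytic_on_decompose:
  assumes "open S" "n_analytic_on n S f"
  shows "\<exists>g. (\<forall>k<n. g k holomorphic_on S) \<and> (\<forall>z\<in>S. f z = (\<Sum>k<n. cnj z ^ k * g k z))"
  using assms(2)
proof (induction n arbitrary: f)
  case 0
  then show ?case by (auto simp: n_analytic_on_def)
next
  case (Suc n)
  have f: "smooth_on S f" "\<And>z. z \<in> S \<Longrightarrow> (wirtinger_zbar ^^ n) (wirtinger_zbar f) z = 0"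
    using Suc.prems by (auto simp: n_analytic_on_def funpow_Suc_right simp del: funpow.simps)
  then have "n_analytic_on n S (wirtinger_zbar f)"
    by (simp add: n_analytic_on_def smooth_on_wirtinger_zbar assms(1))
  then obtain g where g: "\<forall>k<n. g k holomorphic_on S"
      "\<forall>z\<in>S. wirtinger_zbar f z = (\<Sum>k<n. cnj z ^ k * g k z)"
    using Suc.IH by blast
  \<comment> \<open>F below is minus an antiderivative of \<open>wirtinger_zbar f\<close> in the
    conjugate variable: dividing by \<open>Suc k\<close> compensates the factor from differentiating
    the power \<open>Suc k\<close>. Hence f + F satisfies the Cauchy-Riemann equation.\<close>
  define h where "h = (\<lambda>k z. case k of 0 \<Rightarrow> 0 | Suc k \<Rightarrow> - g k z / of_nat (Suc k))"
  have h: "h k holomorphic_on S" if "k \<le> n" for k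
    using g(1) that unfolding h_def by (cases k) (auto intro!: holomorphic_intros simp del: of_nat_Suc)
  define F where "F = (\<lambda>z. \<Sum>k<Suc n. cnj z ^ k * h k z)"
  have F: "smooth_on S F"
    unfolding F_def using h by (intro smooth_on_polyanalytic_sum assms(1)) auto
  have "wirtinger_zbar (\<lambda>z. f z + F z) z = 0" if z: "z \<in> S" for z
  proof -
    have "wirtinger_zbar F z = (\<Sum>k<n. cnj z ^ k * (of_nat (Suc k) * h (Suc k) z))"
      unfolding F_def using h z by (intro wirtinger_zbar_polyanalytic_sum[OF assms(1)]) auto
    also have "\<dots> = - wirtinger_zbar f z"
      using g(2) z by (simp add: h_def sum_negf del: of_nat_Suc)
    finally show ?thesis
      using smooth_onD[OF f(1) z] smooth_onD[OF F z] by (simp add: wirtinger_zbar_add)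
  qed
  then have "(\<lambda>z. f z + F z) field_differentiable at z" if "z \<in> S" for z
    using that smooth_onD[OF f(1)] smooth_onD[OF F]
    by (intro cauchy_riemann_imp_field_differentiable) auto
  then have hol: "(\<lambda>z. f z + F z) holomorphic_on S"
    by (auto simp: holomorphic_on_def intro: field_differentiable_at_within)
  \<comment> \<open>Read off from f = (f + F) - F. As h 0 = 0, the sum F has no term of order 0 that
    could collide with the holomorphic part f + F.\<close>
  define G where "G = (\<lambda>k z. case k of 0 \<Rightarrow> f z + F z | Suc _ \<Rightarrow> - h k z)"
  have "G k holomorphic_on S" if "k < Suc n" for k
    using that hol h unfolding G_def by (cases k) (auto intro!: holomorphic_intros)
  moreover have "f z = (\<Sum>k<Suc n. cnj z ^ k * G k z)" for z
  proof -
    have "F z = (\<Sum>k<n. cnj z ^ Suc k * h (Suc k) z)"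
      unfolding F_def by (subst sum.lessThan_Suc_shift) (simp add: h_def)
    then show ?thesis
      by (subst sum.lessThan_Suc_shift) (simp add: G_def sum_negf)
  qed
  ultimately show ?case by blast
qed

section \<open>Rotations and radial functions in the plane\<close>

text \<open>Bridge from \<open>real^2\<close>, where orthogonal maps preserve volume, to the complex
  plane. Two translation-compatible measures need only be compared on boxes, and boxes correspond
  coordinatewise.\<close>

lemma lborel_distr_complex_of_vec:
  "distr lborel borel (\<lambda>v::real^2. Complex (v $ 1) (v $ 2)) = lborel"
proof (rule lborel_eqI[symmetric])
  have meas [measurable]: "(\<lambda>v::real^2. Complex (v $ 1) (v $ 2)) \<in> borel_measurable borel"
    unfolding complex_eq by (intro borel_measurable_continuous_onI continuous_intros)
  fix l u :: complex
  assume le: "\<And>b. b \<in> Basis \<Longrightarrow> l \<bullet> b \<le> u \<bullet> b"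
  define l' u' :: "real^2" where "l' = vector [Re l, Im l]" and "u' = vector [Re u, Im u]"
  have "(\<lambda>v::real^2. Complex (v $ 1) (v $ 2)) -` box l u = box l' u'"
    by (auto simp: mem_box_cart forall_2 in_box_complex_iff l'_def u'_def)
  moreover have "l' $ i \<le> u' $ i" for i
    using le[of 1] le[of \<i>] exhaust_2[of i] by (auto simp: l'_def u'_def Basis_complex_def)
  then have "\<And>b. b \<in> Basis \<Longrightarrow> l' \<bullet> b \<le> u' \<bullet> b"
    by (auto simp: Basis_vec_def cart_eq_inner_axis[symmetric])
  moreover have "(\<Prod>b\<in>Basis. (u' - l') \<bullet> b) = (\<Prod>b\<in>Basis. (u - l) \<bullet> b)"
    by (simp add: Basis_complex_def prod.UNION_disjoint Basis_vec_def UNION_singleton_eq_range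
        cart_eq_inner_axis[symmetric] l'_def u'_def prod.reindex inj_on_def axis_eq_axis UNIV_2)
  ultimately show "emeasure (distr lborel borel (\<lambda>v::real^2. Complex (v $ 1) (v $ 2))) (box l u) =
      ennreal (\<Prod>b\<in>Basis. (u - l) \<bullet> b)"
    by (simp add: emeasure_distr emeasure_lborel_box)
qed simp

text \<open>The preimage of a box under f is its image under the inverse g, so that invariance of
  volume under orthogonal images, applied to g, evaluates the pushforward under f.\<close>

lemma lborel_distr_orthogonal:
  fixes f g :: "real^'n::{finite,wellorder} \<Rightarrow> real^'n::_"
  assumes f: "orthogonal_transformation f" and g: "orthogonal_transformation g"
    and fg: "\<And>x. f (g x) = x" "\<And>x. g (f x) = x"
  shows "distr lborel borel f = lborel"
proof (rule lborel_eqI[symmetric])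
  have [measurable]: "f \<in> borel_measurable borel"
    using f by (intro borel_measurable_continuous_onI linear_continuous_on)
      (simp add: orthogonal_transformation_linear linear_conv_bounded_linear[symmetric])
  fix l u :: "(real, 'n) Finite_Cartesian_Product.vec"
  assume le: "\<And>b. b \<in> Basis \<Longrightarrow> l \<bullet> b \<le> u \<bullet> b"
  have eq: "f -` box l u = g ` box l u"
  proof (intro Set.set_eqI iffI)
    fix x assume "x \<in> f -` box l u"
    then show "x \<in> g ` box l u"
      by (intro image_eqI[of _ _ "f x"]) (simp_all add: fg(2))
  qed (use fg(1) in fastforce)
  have "f -` box l u \<in> sets lborel"
    by (simp add: measurable_sets_borel[of f borel])
  then have "emeasure (distr lborel borel f) (box l u) = emeasure lebesgue (g ` box l u)"
    by (simp add: emeasure_distr eq)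
  also have "\<dots> = measure lebesgue (g ` box l u)"
    using measurable_orthogonal_image[OF g lmeasurable_box, of l u]
    by (simp add: emeasure_eq_measure2)
  also have "\<dots> = measure lebesgue (box l u)"
    by (simp add: measure_orthogonal_image[OF g])
  also have "\<dots> = (\<Prod>b\<in>Basis. (u - l) \<bullet> b)"
    using le by (simp add: measure_lborel_box_eq)
  finally show "emeasure (distr lborel borel f) (box l u) = (\<Prod>b\<in>Basis. (u - l) \<bullet> b)" .
qed simp

lemma lborel_distr_unimodular_mult:
  fixes \<tau> :: complex
  assumes "cmod \<tau> = 1"
  shows "distr lborel borel ((*) \<tau>) = lborel"
proof -
  define C where "C = (\<lambda>v::real^2. Complex (v $ 1) (v $ 2))"
  \<comment> \<open>R c is multiplication by c written in the coordinates of C. For unimodular c it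
    is orthogonal, with inverse \<open>R (cnj c)\<close>.\<close>
  define R :: "complex \<Rightarrow> real^2 \<Rightarrow> real^2" where
    "R = (\<lambda>c v. vector [Re (c * C v), Im (c * C v)])"
  have C [measurable]: "C \<in> borel_measurable borel"
    unfolding C_def complex_eq by (intro borel_measurable_continuous_onI continuous_intros)
  have CR: "C (R c v) = c * C v" for c v
    by (simp add: C_def R_def complex_eq_iff)
  have inv: "R c (R d v) = v" if "c * d = 1" for c d v
  proof -
    have "c * C (R d v) = C v"
      using that by (simp add: CR mult.assoc[symmetric])
    then have "C (R c (R d v)) = C v"
      by (simp only: CR)
    then show ?thesis
      by (simp add: C_def Finite_Cartesian_Product.vec_eq_iff forall_2)
  qed
  have orth: "orthogonal_transformation (R c)" if "cmod c = 1" for c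
  proof -
    have c: "(Re c)\<^sup>2 + (Im c)\<^sup>2 = 1"
      using that by (simp add: cmod_def)
    have "linear (R c)"
      by (auto intro!: linearI simp: R_def C_def Finite_Cartesian_Product.vec_eq_iff forall_2 algebra_simps)
    moreover have "norm (R c v) = norm v" for v
    proof -
      have "norm (R c v) = cmod (C (R c v))"
        by (simp add: norm_vec_def L2_set_def C_def cmod_def UNIV_2)
      also have "\<dots> = cmod (C v)"
        by (simp add: CR norm_mult that)
      also have "\<dots> = norm v"
        by (simp add: norm_vec_def L2_set_def C_def cmod_def UNIV_2)
      finally show ?thesis .
    qed
    ultimately show ?thesis
      by (simp add: orthogonal_transformation)
  qed
  have "\<tau> * cnj \<tau> = 1"
    using assms by (simp add: complex_norm_square[symmetric])
  then have dR: "distr lborel borel (R \<tau>) = lborel"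
    using assms by (intro lborel_distr_orthogonal[of _ "R (cnj \<tau>)"] orth inv) (auto simp: mult.commute)
  have [measurable]: "R \<tau> \<in> borel_measurable borel"
    using orth[OF assms] by (intro borel_measurable_continuous_onI linear_continuous_on)
      (simp add: orthogonal_transformation_linear linear_conv_bounded_linear[symmetric])
  have "distr lborel borel ((*) \<tau>) = distr (distr lborel borel C) borel ((*) \<tau>)"
    unfolding C_def by (subst lborel_distr_complex_of_vec) simp
  also have "\<dots> = distr (distr lborel borel (R \<tau>)) borel C"
    by (subst (1 2) distr_distr) (auto simp: comp_def CR)
  also have "\<dots> = lborel"
    unfolding dR unfolding C_def by (rule lborel_distr_complex_of_vec)
  finally show ?thesis .
qed

text \<open>Measurability for the completion requires that null sets pull back to null sets; the
  invariance of \<open>lborel\<close> supplies this, and the completed measures then agree as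
  well.\<close>

lemma
  fixes \<tau> :: complex
  assumes "cmod \<tau> = 1"
  shows measurable_unimodular_mult: "(*) \<tau> \<in> lebesgue \<rightarrow>\<^sub>M lebesgue"
    and lebesgue_distr_unimodular_mult: "distr lebesgue lebesgue ((*) \<tau>) = lebesgue"
proof -
  have m: "(*) \<tau> \<in> lebesgue \<rightarrow>\<^sub>M lborel"
    by (intro measurable_completion) simp
  have d: "distr lebesgue lborel ((*) \<tau>) = lborel"
  proof (rule measure_eqI)
    fix A assume "A \<in> sets (distr lebesgue lborel ((*) \<tau>))"
    then have A: "A \<in> sets borel" by simp
    have v: "(*) \<tau> -` A \<in> sets borel"
      by (rule measurable_sets_borel[OF _ A]) simp
    have "emeasure (distr lebesgue lborel ((*) \<tau>)) A = emeasure lborel ((*) \<tau> -` A)"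
      using A m v by (subst emeasure_distr) auto
    also have "\<dots> = emeasure (distr lborel borel ((*) \<tau>)) A"
      using A v by (subst emeasure_distr) auto
    finally show "emeasure (distr lebesgue lborel ((*) \<tau>)) A = emeasure lborel A"
      by (simp add: lborel_distr_unimodular_mult[OF assms])
  qed simp
  show "(*) \<tau> \<in> lebesgue \<rightarrow>\<^sub>M lebesgue"
    using completion.measurable_completion2[OF m] by (simp add: d)
  show "distr lebesgue lebesgue ((*) \<tau>) = lebesgue"
    using completion.completion_distr_eq[OF m] by (simp add: d)
qed

text \<open>The disk |z|^2 \<le> x has area pi * x, so the squared modulus, unlike the modulus, has
  constant density. Half lines generate the Borel sets and are stable under intersection, which
  makes this computation sufficient.\<close>

lemma lborel_distr_cmod_square:
  "distr lborel borel (\<lambda>z::complex. (cmod z)\<^sup>2) = density lborel (\<lambda>t. ennreal pi * indicator {0..} t)"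
    (is "?M = ?N")
proof (rule measure_eqI_generator_eq[where E = "range atMost" and \<Omega> = UNIV and A = "\<lambda>i. {..real i}"])
  show "Int_stable (range (atMost :: real \<Rightarrow> real set))"
    by (auto simp: Int_stable_def)
  have M: "emeasure ?M {..x} = (if x < 0 then 0 else ennreal (pi * x))" for x
  proof -
    have "(\<lambda>z::complex. (cmod z)\<^sup>2) -` {..x} = (if x < 0 then {} else cball 0 (sqrt x))"
    proof (cases "x < 0")
      case True
      then have "\<not> (cmod z)\<^sup>2 \<le> x" for z
        using zero_le_power2[of "cmod z"] by linarith
      with True show ?thesis by auto
    next
      case False
      then have "(cmod z)\<^sup>2 \<le> x \<longleftrightarrow> cmod z \<le> sqrt x" for z
        using real_sqrt_le_iff[of "(cmod z)\<^sup>2" x] by simp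
      with False show ?thesis by auto
    qed
    then have "emeasure ?M {..x} = emeasure lborel (if x < 0 then {} else cball (0::complex) (sqrt x))"
      by (simp add: emeasure_distr)
    then show ?thesis
      by (simp add: emeasure_cball unit_ball_vol_2)
  qed
  show "emeasure ?M X = emeasure ?N X" if X: "X \<in> range atMost" for X
  proof -
    obtain x where x: "X = {..x}" using X by auto
    have "emeasure ?N {..x} = (\<integral>\<^sup>+t. ennreal pi * indicator {0..x} t \<partial>lborel)"
      by (auto simp: emeasure_density intro!: nn_integral_cong split: split_indicator)
    also have "\<dots> = (if x < 0 then 0 else ennreal (pi * x))"
      by (auto simp: nn_integral_cmult_indicator ennreal_mult)
    finally show ?thesis by (simp add: x M)
  qed
  show "emeasure ?M {..real i} \<noteq> \<infinity>" for i by (simp add: M)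
  show "(\<Union>i. {..real i}) = UNIV" by (auto intro: real_arch_simple)
qed (auto simp: borel_eq_atMost sets_measure_of_conv)

text \<open>A null set of values has a null preimage because the pushforward of area has a
  density.\<close>

lemma measurable_cmod_square_lebesgue:
  "(\<lambda>z::complex. (cmod z)\<^sup>2) \<in> lebesgue \<rightarrow>\<^sub>M lebesgue"
proof (rule completion.measurable_completion2)
  show m: "(\<lambda>z::complex. (cmod z)\<^sup>2) \<in> lebesgue \<rightarrow>\<^sub>M lborel"
    by (intro measurable_completion) simp
  show "null_sets lborel \<subseteq> null_sets (distr lebesgue lborel (\<lambda>z::complex. (cmod z)\<^sup>2))"
  proof
    fix N :: "real set" assume N: "N \<in> null_sets lborel"
    then have b: "N \<in> sets borel" by auto
    have v: "(\<lambda>z::complex. (cmod z)\<^sup>2) -` N \<in> sets borel"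
      by (rule measurable_sets_borel[OF _ b]) simp
    have "emeasure lborel ((\<lambda>z::complex. (cmod z)\<^sup>2) -` N) =
        emeasure (distr lborel borel (\<lambda>z::complex. (cmod z)\<^sup>2)) N"
      using b v by (simp add: emeasure_distr)
    also have "\<dots> = (\<integral>\<^sup>+t. ennreal pi * indicator {0..} t * indicator N t \<partial>lborel)"
      using b by (simp add: lborel_distr_cmod_square emeasure_density)
    also have "\<dots> = 0"
      using AE_not_in[OF N] b by (subst nn_integral_0_iff_AE) (auto simp: indicator_def)
    finally show "N \<in> null_sets (distr lebesgue lborel (\<lambda>z::complex. (cmod z)\<^sup>2))"
      using b v m by (auto simp: null_sets_def emeasure_distr)
  qed
qed

text \<open>A Lebesgue set is a Borel set joined with part of a Borel null set. Both measures vanish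
  on that null set, so the Borel case decides.\<close>

lemma lebesgue_distr_cmod_square:
  "distr lebesgue lebesgue (\<lambda>z::complex. (cmod z)\<^sup>2) =
    density lebesgue (\<lambda>t. ennreal pi * indicator {0..} t)"
    (is "?M = ?N")
proof (rule measure_eqI)
  fix A assume "A \<in> sets ?M"
  then have "A \<in> sets lebesgue" by simp
  then obtain S N N' where A: "A = S \<union> N" "N \<subseteq> N'" "N' \<in> null_sets lborel" "S \<in> sets borel"
    by (auto elim: sets_completionE)
  have N: "N' \<in> null_sets lebesgue"
    using A(3) by (rule null_sets_completionI)
  have [measurable]: "{0::real..} \<in> sets lebesgue"
    by simp
  have borel: "emeasure ?M B = emeasure ?N B" if B: "B \<in> sets borel" for B
  proof -
    have v: "(\<lambda>z::complex. (cmod z)\<^sup>2) -` B \<in> sets borel"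
      by (rule measurable_sets_borel[OF _ B]) simp
    have "emeasure ?M B = emeasure (distr lborel borel (\<lambda>z::complex. (cmod z)\<^sup>2)) B"
      using B v measurable_cmod_square_lebesgue by (simp add: emeasure_distr)
    also have "\<dots> = (\<integral>\<^sup>+t. ennreal pi * indicator {0..} t * indicator B t \<partial>lborel)"
      using B by (simp add: lborel_distr_cmod_square emeasure_density)
    also have "\<dots> = emeasure ?N B"
      using B by (subst emeasure_density) (auto simp: nn_integral_completion)
    finally show ?thesis .
  qed
  have "N' \<in> sets borel" using A(3) by auto
  have N'N: "emeasure ?N N' = 0"
    using AE_not_in[OF A(3)] \<open>N' \<in> sets borel\<close>
    by (subst emeasure_density)
      (auto simp: nn_integral_completion nn_integral_0_iff_AE indicator_def)
  then have "N' \<in> null_sets ?N" "N' \<in> null_sets ?M"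
    using N borel[OF \<open>N' \<in> sets borel\<close>] by (auto simp: null_sets_def)
  moreover have "N \<in> sets lebesgue"
    using A(2,3) by (rule null_sets_completion[rotated])
  ultimately have "N \<in> null_sets ?N" "N \<in> null_sets ?M"
    using A(2) by (auto intro: null_sets_subset)
  then show "emeasure ?M A = emeasure ?N A"
    using A borel[of S] by (simp add: emeasure_Un_null_set)
qed simp

lemma measurable_cmod_square_unit_disk:
  "(\<lambda>z::complex. (cmod z)\<^sup>2) \<in> lebesgue_on unit_disk \<rightarrow>\<^sub>M lebesgue_on {0..<1}"
  by (rule measurable_restrict_space3[OF measurable_cmod_square_lebesgue])
    (auto simp: power_less_one_iff)

lemma
  fixes \<phi> :: "real \<Rightarrow> 'b::{banach, second_countable_topology}"
  assumes \<phi>: "\<phi> \<in> borel_measurable (lebesgue_on {0..<1})"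
  shows integrable_radial_unit_disk: "integrable (lebesgue_on unit_disk) (\<lambda>z. \<phi> ((cmod z)\<^sup>2)) \<longleftrightarrow>
      integrable (lebesgue_on {0..<1}) \<phi>"
    and integral_radial_unit_disk: "(LINT z|lebesgue_on unit_disk. \<phi> ((cmod z)\<^sup>2)) =
      pi *\<^sub>R (LINT t|lebesgue_on {0..<1}. \<phi> t)"
proof -
  define \<psi> where "\<psi> = (\<lambda>t. indicator {0..<1} t *\<^sub>R \<phi> t)"
  have \<psi>: "\<psi> \<in> borel_measurable lebesgue"
    using \<phi> unfolding \<psi>_def by (subst (asm) borel_measurable_restrict_space_iff) auto
  have eq: "indicator unit_disk z *\<^sub>R \<phi> ((cmod z)\<^sup>2) = \<psi> ((cmod z)\<^sup>2)" for z
    by (auto simp: \<psi>_def indicator_def power_less_one_iff)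
  have d: "density lebesgue (\<lambda>t::real. ennreal pi * indicator {0..} t) =
      density lebesgue (\<lambda>t::real. ennreal (pi * indicator {0..} t))"
    by (intro arg_cong2[where f = density]) (auto split: split_indicator)
  have m: "(\<lambda>t::real. pi * indicator {0..} t) \<in> borel_measurable lebesgue"
    by (intro borel_measurable_times borel_measurable_indicator) auto
  have e: "(pi * indicator {0..} t) *\<^sub>R \<psi> t = pi *\<^sub>R \<psi> t" for t
    by (auto simp: \<psi>_def split: split_indicator)
  have "integrable (lebesgue_on unit_disk) (\<lambda>z. \<phi> ((cmod z)\<^sup>2)) \<longleftrightarrow>
      integrable lebesgue (\<lambda>z::complex. \<psi> ((cmod z)\<^sup>2))"
    by (subst integrable_restrict_space) (auto simp: eq)
  also have "\<dots> \<longleftrightarrow> integrable (density lebesgue (\<lambda>t. ennreal pi * indicator {0..} t)) \<psi>"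
    unfolding lebesgue_distr_cmod_square[symmetric]
    using \<psi> by (subst integrable_distr_eq[OF measurable_cmod_square_lebesgue]) auto
  also have "\<dots> \<longleftrightarrow> integrable lebesgue (\<lambda>t. pi *\<^sub>R \<psi> t)"
    unfolding d using \<psi> m by (subst integrable_density) (auto simp: e)
  also have "\<dots> \<longleftrightarrow> integrable lebesgue \<psi>"
    using integrable_scaleR_right[of "1 / pi" lebesgue "\<lambda>t. pi *\<^sub>R \<psi> t"]
      integrable_scaleR_right[of pi lebesgue \<psi>] by auto
  also have "\<dots> \<longleftrightarrow> integrable (lebesgue_on {0..<1}) \<phi>"
    by (subst integrable_restrict_space) (auto simp: \<psi>_def)
  finally show "integrable (lebesgue_on unit_disk) (\<lambda>z. \<phi> ((cmod z)\<^sup>2)) \<longleftrightarrow>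
      integrable (lebesgue_on {0..<1}) \<phi>" .
  have "(LINT z|lebesgue_on unit_disk. \<phi> ((cmod z)\<^sup>2)) = (LINT z::complex|lebesgue. \<psi> ((cmod z)\<^sup>2))"
    by (subst integral_restrict_space) (auto simp: eq)
  also have "\<dots> = (LINT t|density lebesgue (\<lambda>t. ennreal pi * indicator {0..} t). \<psi> t)"
    unfolding lebesgue_distr_cmod_square[symmetric]
    using \<psi> by (subst integral_distr[OF measurable_cmod_square_lebesgue]) auto
  also have "\<dots> = (LINT t|lebesgue. pi *\<^sub>R \<psi> t)"
    unfolding d using \<psi> m by (subst integral_density) (auto simp: e)
  also have "\<dots> = pi *\<^sub>R (LINT t|lebesgue_on {0..<1}. \<phi> t)"
    by (subst integral_restrict_space) (simp_all add: \<psi>_def[symmetric] del: scaleR_scaleR)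
  finally show "(LINT z|lebesgue_on unit_disk. \<phi> ((cmod z)\<^sup>2)) =
      pi *\<^sub>R (LINT t|lebesgue_on {0..<1}. \<phi> t)" .
qed

section \<open>Orthogonal projection in $L^2$\<close>

lemma cmod_diff_square: "(cmod (a - b))\<^sup>2 = (cmod a)\<^sup>2 - 2 * Re (a * cnj b) + (cmod b)\<^sup>2"
  unfolding cmod_power2 by (simp add: power2_eq_square algebra_simps)

lemma cmod_add_square_le: "(cmod (a + b))\<^sup>2 \<le> 2 * (cmod a)\<^sup>2 + 2 * (cmod b)\<^sup>2"
proof -
  have "(cmod (a + b))\<^sup>2 \<le> (cmod a + cmod b)\<^sup>2"
    by (intro power_mono norm_triangle_ineq) auto
  also have "\<dots> \<le> 2 * (cmod a)\<^sup>2 + 2 * (cmod b)\<^sup>2"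
    using zero_le_power2[of "cmod a - cmod b"] by (simp add: power2_eq_square algebra_simps)
  finally show ?thesis .
qed

text \<open>Young's inequality for the cross term. With e near 0 the coefficient of the first
  summand is near 1, so that a minimal distance survives the passage to a limit without
  loss.\<close>

lemma cmod_add_square_le_weighted:
  assumes "0 < e"
  shows "(cmod (a + b))\<^sup>2 \<le> (1 + e) * (cmod a)\<^sup>2 + (1 + 1 / e) * (cmod b)\<^sup>2"
proof -
  have "(cmod (a + b))\<^sup>2 \<le> (cmod a + cmod b)\<^sup>2"
    by (intro power_mono norm_triangle_ineq) auto
  also have "\<dots> = (cmod a)\<^sup>2 + 2 * cmod a * cmod b + (cmod b)\<^sup>2"
    by (simp add: power2_sum)
  also have "2 * cmod a * cmod b \<le> e * (cmod a)\<^sup>2 + 1 / e * (cmod b)\<^sup>2"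
  proof -
    have "0 \<le> (e * cmod a - cmod b)\<^sup>2 / e"
      using assms by simp
    also have "\<dots> = e * (cmod a)\<^sup>2 + 1 / e * (cmod b)\<^sup>2 - 2 * cmod a * cmod b"
      using assms by (simp add: power2_eq_square field_simps)
    finally show ?thesis by simp
  qed
  finally show ?thesis by (simp add: algebra_simps)
qed

section \<open>Square-integrable functions and their inner product\<close>

lemma Ltwo_measurable: "f \<in> Ltwo M \<Longrightarrow> f \<in> borel_measurable M"
  by (simp add: Ltwo_def)

lemma Ltwo_integrable: "f \<in> Ltwo M \<Longrightarrow> integrable M (\<lambda>x. (cmod (f x))\<^sup>2)"
  by (simp add: Ltwo_def)

lemma Ltwo_add:
  assumes "f \<in> Ltwo M" "g \<in> Ltwo M"
  shows "(\<lambda>x. f x + g x) \<in> Ltwo M"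
proof -
  note [measurable] = assms[THEN Ltwo_measurable]
  have "integrable M (\<lambda>x. (cmod (f x + g x))\<^sup>2)"
  proof (rule Bochner_Integration.integrable_bound)
    show "integrable M (\<lambda>x. 2 * (cmod (f x))\<^sup>2 + 2 * (cmod (g x))\<^sup>2)"
      using assms[THEN Ltwo_integrable] by simp
  qed (auto simp: cmod_add_square_le)
  then show ?thesis by (simp add: Ltwo_def)
qed

lemma Ltwo_scale: "f \<in> Ltwo M \<Longrightarrow> (\<lambda>x. c * f x) \<in> Ltwo M"
  by (auto simp: Ltwo_def norm_mult power_mult_distrib)

lemma Ltwo_diff:
  assumes "f \<in> Ltwo M" "g \<in> Ltwo M"
  shows "(\<lambda>x. f x - g x) \<in> Ltwo M"
  using Ltwo_add[OF assms(1) Ltwo_scale[OF assms(2), of "-1"]] by simp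

lemma Ltwo_integrable_mult_cnj:
  assumes "f \<in> Ltwo M" "g \<in> Ltwo M"
  shows "integrable M (\<lambda>x. f x * cnj (g x))"
proof (rule Bochner_Integration.integrable_bound)
  note [measurable] = assms[THEN Ltwo_measurable]
  show "integrable M (\<lambda>x. (cmod (f x))\<^sup>2 + (cmod (g x))\<^sup>2)"
    using assms[THEN Ltwo_integrable] by simp
  show "(\<lambda>x. f x * cnj (g x)) \<in> borel_measurable M"
    using measurable_compose[OF Ltwo_measurable[OF assms(2)]
        borel_measurable_continuous_onI[OF continuous_on_cnj[OF continuous_on_id]]]
    by simp
  have "cmod a * cmod b \<le> (cmod a)\<^sup>2 + (cmod b)\<^sup>2" for a b
    using zero_le_power2[of "cmod a - cmod b"] zero_le_power2[of "cmod a"] zero_le_power2[of "cmod b"]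
    unfolding power2_diff by linarith
  then show "AE x in M. norm (f x * cnj (g x)) \<le> norm ((cmod (f x))\<^sup>2 + (cmod (g x))\<^sup>2)"
    by (auto simp: norm_mult)
qed

lemma Ltwo_inner_diff_left:
  assumes "f \<in> Ltwo M" "g \<in> Ltwo M" "h \<in> Ltwo M"
  shows "Ltwo_inner M (\<lambda>x. f x - g x) h = Ltwo_inner M f h - Ltwo_inner M g h"
  using assms by (simp add: Ltwo_inner_def left_diff_distrib Ltwo_integrable_mult_cnj)

lemma Ltwo_inner_add_left:
  assumes "f \<in> Ltwo M" "g \<in> Ltwo M" "h \<in> Ltwo M"
  shows "Ltwo_inner M (\<lambda>x. f x + g x) h = Ltwo_inner M f h + Ltwo_inner M g h"
  using assms by (simp add: Ltwo_inner_def distrib_right Ltwo_integrable_mult_cnj)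

lemma Ltwo_inner_scale_left:
  "Ltwo_inner M (\<lambda>x. c * f x) h = c * Ltwo_inner M f h"
  by (simp add: Ltwo_inner_def mult.assoc)

lemma Ltwo_inner_scale_right:
  "Ltwo_inner M f (\<lambda>x. c * h x) = cnj c * Ltwo_inner M f h"
  by (simp add: Ltwo_inner_def mult.left_commute)

lemma Ltwo_inner_self: "Ltwo_inner M f f = of_real (LINT x|M. (cmod (f x))\<^sup>2)"
  unfolding Ltwo_inner_def by (simp add: complex_norm_square[symmetric] del: of_real_power)

lemma integral_cmod_diff_square:
  assumes "f \<in> Ltwo M" "g \<in> Ltwo M"
  shows "(LINT x|M. (cmod (f x - g x))\<^sup>2) =
    (LINT x|M. (cmod (f x))\<^sup>2) - 2 * Re (Ltwo_inner M f g) + (LINT x|M. (cmod (g x))\<^sup>2)"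
  using assms
  by (simp add: cmod_diff_square Ltwo_inner_def Ltwo_integrable_mult_cnj Ltwo_integrable
      del: complex_cnj_mult times_complex.simps)

lemma Ltwo_parallelogram:
  assumes "f \<in> Ltwo M" "g \<in> Ltwo M"
  shows "(LINT x|M. (cmod (f x + g x))\<^sup>2) + (LINT x|M. (cmod (f x - g x))\<^sup>2) =
    2 * (LINT x|M. (cmod (f x))\<^sup>2) + 2 * (LINT x|M. (cmod (g x))\<^sup>2)"
proof -
  have "(LINT x|M. (cmod (f x + g x))\<^sup>2) + (LINT x|M. (cmod (f x - g x))\<^sup>2) =
      (LINT x|M. (cmod (f x + g x))\<^sup>2 + (cmod (f x - g x))\<^sup>2)"
    using assms by (intro Bochner_Integration.integral_add[symmetric] Ltwo_integrable Ltwo_add Ltwo_diff)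
  also have "\<dots> = (LINT x|M. 2 * (cmod (f x))\<^sup>2 + 2 * (cmod (g x))\<^sup>2)"
    unfolding cmod_power2
    by (intro Bochner_Integration.integral_cong) (auto simp: power2_eq_square algebra_simps)
  also have "\<dots> = 2 * (LINT x|M. (cmod (f x))\<^sup>2) + 2 * (LINT x|M. (cmod (g x))\<^sup>2)"
    using assms by (simp add: Ltwo_integrable)
  finally show ?thesis .
qed

text \<open>Completeness is a hypothesis about sequences in V because V consists of functions rather
  than classes: the limit must itself be a member of V. The minimiser of the distance to f is the
  projection, by the usual variational argument.\<close>

theorem Ltwo_projection_exists:
  assumes V: "V \<subseteq> Ltwo M" "V \<noteq> {}"
    and add: "\<And>f g. f \<in> V \<Longrightarrow> g \<in> V \<Longrightarrow> (\<lambda>x. f x + g x) \<in> V"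
    and scale: "\<And>c f. f \<in> V \<Longrightarrow> (\<lambda>x. c * f x) \<in> V"
    and complete: "\<And>h. (\<And>m. h m \<in> V) \<Longrightarrow>
      (\<And>e. e > 0 \<Longrightarrow> \<exists>N. \<forall>i\<ge>N. \<forall>j\<ge>N. (LINT x|M. (cmod (h i x - h j x))\<^sup>2) < e) \<Longrightarrow>
      \<exists>g\<in>V. (\<lambda>m::nat. LINT x|M. (cmod (h m x - g x))\<^sup>2) \<longlonglongrightarrow> 0"
    and f: "f \<in> Ltwo M"
  shows "\<exists>g\<in>V. \<forall>u\<in>V. Ltwo_inner M (\<lambda>x. f x - g x) u = 0"
proof -
  define D where "D h = (LINT x|M. (cmod (f x - h x))\<^sup>2)" for h
  define d where "d = (INF h\<in>V. D h)"
  have bdd: "bdd_below (D ` V)"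
    by (rule bdd_belowI[of _ 0]) (auto simp: D_def)
  have d_le: "d \<le> D h" if "h \<in> V" for h
    unfolding d_def using bdd that by (rule cINF_lower)
  have "\<exists>h\<in>V. D h < d + e" if "e > 0" for e
    using cINF_less_iff[OF V(2) bdd, of "d + e"] that unfolding d_def by auto
  then have "\<forall>m::nat. \<exists>h. h \<in> V \<and> D h < d + 1 / real (Suc m)"
    by (simp add: Bex_def del: of_nat_Suc)
  from choice[OF this] obtain h
    where h: "\<And>m::nat. h m \<in> V" "\<And>m. D (h m) < d + 1 / real (Suc m)"
    by blast
  have hL: "h m \<in> Ltwo M" for m using h V by auto
  have close: "(LINT x|M. (cmod (h i x - h j x))\<^sup>2) < 2 / real (Suc i) + 2 / real (Suc j)" for i j
  proof -
    \<comment> \<open>The midpoint lies in V, so the sum term of the parallelogram law is 4 * D k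
      and at least 4 * d. What is left for the difference of h i and h j is the excess of both over
      the infimum.\<close>
    define k where "k = (\<lambda>x. 1/2 * (h i x + h j x))"
    have "k \<in> V" unfolding k_def by (intro scale add h)
    have "(LINT x|M. (cmod ((f x - h i x) + (f x - h j x)))\<^sup>2) +
        (LINT x|M. (cmod ((f x - h i x) - (f x - h j x)))\<^sup>2) = 2 * D (h i) + 2 * D (h j)"
      unfolding D_def by (intro Ltwo_parallelogram Ltwo_diff f hL)
    also have "(LINT x|M. (cmod ((f x - h i x) + (f x - h j x)))\<^sup>2) = 4 * D k"
    proof -
      have "(f x - h i x) + (f x - h j x) = 2 * (f x - k x)" for x
        by (simp add: k_def field_simps)
      then show ?thesis unfolding D_def by (simp only: norm_mult power_mult_distrib) simp
    qed
    also have "(LINT x|M. (cmod ((f x - h i x) - (f x - h j x)))\<^sup>2) =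
        (LINT x|M. (cmod (h i x - h j x))\<^sup>2)"
      by (simp add: norm_minus_commute)
    finally show ?thesis
      using d_le[OF \<open>k \<in> V\<close>] h(2)[of i] h(2)[of j] by simp
  qed
  have "\<exists>N. \<forall>i\<ge>N. \<forall>j\<ge>N. (LINT x|M. (cmod (h i x - h j x))\<^sup>2) < e" if "e > 0" for e
  proof -
    obtain N :: nat where N: "4 / e < real N" using reals_Archimedean2 by blast
    have small: "2 / real (Suc i) < e / 2" if "i \<ge> N" for i
    proof -
      have "4 / e < real (Suc i)" using N that by simp
      then show ?thesis using \<open>e > 0\<close> by (simp add: field_simps)
    qed
    then have "(LINT x|M. (cmod (h i x - h j x))\<^sup>2) < e" if "i \<ge> N" "j \<ge> N" for i j
      using close[of i j] small[OF that(1)] small[OF that(2)] by linarith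
    then show ?thesis by blast
  qed
  from complete[OF h(1) this]
  obtain g where g: "g \<in> V" "(\<lambda>m. LINT x|M. (cmod (h m x - g x))\<^sup>2) \<longlonglongrightarrow> 0"
    by blast
  have gL: "g \<in> Ltwo M" using g V by auto
  \<comment> \<open>For fixed e the limit in m removes the term with the possibly large factor 1 + 1
    / e; only afterwards does e tend to 0.\<close>
  have "D g \<le> (1 + e) * d" if "e > 0" for e
  proof (rule LIMSEQ_le_const)
    have "(\<lambda>m. (1 + e) * (d + 1 / real (Suc m)) + (1 + 1 / e) * (LINT x|M. (cmod (h m x - g x))\<^sup>2))
        \<longlonglongrightarrow> (1 + e) * (d + 0) + (1 + 1 / e) * 0"
      by (intro tendsto_intros g(2) LIMSEQ_Suc[OF lim_1_over_n])
    then show "(\<lambda>m. (1 + e) * (d + 1 / real (Suc m)) +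
        (1 + 1 / e) * (LINT x|M. (cmod (h m x - g x))\<^sup>2)) \<longlonglongrightarrow> (1 + e) * d"
      by simp
    have "D g \<le> (1 + e) * (d + 1 / real (Suc m)) + (1 + 1 / e) * (LINT x|M. (cmod (h m x - g x))\<^sup>2)" for m
    proof -
      have i1: "integrable M (\<lambda>x. (cmod (f x - h m x))\<^sup>2)" "integrable M (\<lambda>x. (cmod (h m x - g x))\<^sup>2)"
        by (intro Ltwo_integrable Ltwo_diff f hL gL)+
      have "D g \<le> (LINT x|M. (1 + e) * (cmod (f x - h m x))\<^sup>2 + (1 + 1 / e) * (cmod (h m x - g x))\<^sup>2)"
        unfolding D_def
      proof (rule integral_mono)
        show "integrable M (\<lambda>x. (cmod (f x - g x))\<^sup>2)"
          by (intro Ltwo_integrable Ltwo_diff f gL)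
        show "integrable M (\<lambda>x. (1 + e) * (cmod (f x - h m x))\<^sup>2 + (1 + 1 / e) * (cmod (h m x - g x))\<^sup>2)"
          using i1 by simp
        show "(cmod (f x - g x))\<^sup>2 \<le> (1 + e) * (cmod (f x - h m x))\<^sup>2 + (1 + 1 / e) * (cmod (h m x - g x))\<^sup>2" for x
          using cmod_add_square_le_weighted[OF that, of "f x - h m x" "h m x - g x"] by simp
      qed
      also have "\<dots> = (1 + e) * D (h m) + (1 + 1 / e) * (LINT x|M. (cmod (h m x - g x))\<^sup>2)"
        unfolding D_def using i1 by simp
      also have "\<dots> \<le> (1 + e) * (d + 1 / real (Suc m)) + (1 + 1 / e) * (LINT x|M. (cmod (h m x - g x))\<^sup>2)"
        using h(2)[of m] that by (intro add_right_mono mult_left_mono) auto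
      finally show ?thesis .
    qed
    then show "\<exists>N. \<forall>m\<ge>N. D g \<le> (1 + e) * (d + 1 / real (Suc m)) +
        (1 + 1 / e) * (LINT x|M. (cmod (h m x - g x))\<^sup>2)" by blast
  qed
  then have "eventually (\<lambda>e. D g \<le> (1 + e) * d) (at_right 0)"
    by (intro eventually_mono[OF eventually_at_right_less[of 0]])
  moreover have "((\<lambda>e. (1 + e) * d) \<longlongrightarrow> (1 + 0) * d) (at_right 0)"
    by (intro tendsto_intros)
  ultimately have Dg: "D g \<le> d"
    using tendsto_lowerbound[of "\<lambda>e. (1 + e) * d" "(1 + 0) * d" "at_right 0" "D g"] by simp
  have "Ltwo_inner M (\<lambda>x. f x - g x) u = 0" if u: "u \<in> V" for u
  proof -
    define I where "I = Ltwo_inner M (\<lambda>x. f x - g x) u"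
    define U where "U = (LINT x|M. (cmod (u x))\<^sup>2)"
    have uL: "u \<in> Ltwo M" and fgL: "(\<lambda>x. f x - g x) \<in> Ltwo M"
      using u V f gL by (auto intro: Ltwo_diff)
    have "U \<ge> 0" by (simp add: U_def)
    \<comment> \<open>Moving from g by s * I * u changes the squared distance by (- 2 * s + s^2 * U)
      * |I|^2. A small enough positive s makes this negative unless I = 0; the added 1 covers the
      case U = 0.\<close>
    define s where "s = 1 / (U + 1)"
    have "s > 0" "s * U < 1" using \<open>U \<ge> 0\<close> by (simp_all add: s_def)
    define v where "v = (\<lambda>x. (of_real s * I) * u x)"
    have vV: "v \<in> V" unfolding v_def by (intro scale u)
    have "d \<le> D (\<lambda>x. g x + v x)"
      using g u vV by (intro d_le add)
    also have "\<dots> = (LINT x|M. (cmod ((f x - g x) - v x))\<^sup>2)"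
      by (simp add: D_def algebra_simps)
    also have "\<dots> = D g - 2 * Re (Ltwo_inner M (\<lambda>x. f x - g x) v) + (LINT x|M. (cmod (v x))\<^sup>2)"
      unfolding D_def using fgL vV V by (intro integral_cmod_diff_square) auto
    also have "Ltwo_inner M (\<lambda>x. f x - g x) v = of_real s * cnj I * I"
      by (simp add: v_def I_def Ltwo_inner_scale_right)
    also have "\<dots> = of_real (s * (cmod I)\<^sup>2)"
      by (simp add: complex_norm_square mult.commute del: of_real_power)
    also have "(LINT x|M. (cmod (v x))\<^sup>2) = s\<^sup>2 * (cmod I)\<^sup>2 * U"
      by (simp add: v_def U_def norm_mult power_mult_distrib)
    finally have "2 * s * (cmod I)\<^sup>2 \<le> s * (s * U) * (cmod I)\<^sup>2"
      using Dg by (simp add: power2_eq_square algebra_simps)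
    also have "\<dots> \<le> s * 1 * (cmod I)\<^sup>2"
      using \<open>s > 0\<close> \<open>s * U < 1\<close> by (intro mult_right_mono mult_left_mono) auto
    finally have "(cmod I)\<^sup>2 \<le> 0"
      using \<open>s > 0\<close> by simp
    then show ?thesis by (simp add: I_def)
  qed
  with g(1) show ?thesis by blast
qed

section \<open>Coefficients of polyanalytic functions\<close>

lemma integral_rotate_unit_disk:
  fixes F :: "complex \<Rightarrow> 'b::{banach, second_countable_topology}"
  assumes "cmod \<tau> = 1" and F: "F \<in> borel_measurable (lebesgue_on unit_disk)"
  shows "(LINT z|lebesgue_on unit_disk. F (\<tau> * z)) = (LINT z|lebesgue_on unit_disk. F z)"
proof -
  define G where "G = (\<lambda>z. indicator unit_disk z *\<^sub>R F z)"
  have G: "G \<in> borel_measurable lebesgue"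
    using F unfolding G_def by (subst (asm) borel_measurable_restrict_space_iff) auto
  have eq: "indicator unit_disk z *\<^sub>R F (\<tau> * z) = G (\<tau> * z)" for z
    by (auto simp: G_def indicator_def norm_mult assms(1))
  have "(LINT z|lebesgue_on unit_disk. F (\<tau> * z)) = (LINT z|lebesgue. G (\<tau> * z))"
    by (subst integral_restrict_space) (auto simp: eq)
  also have "\<dots> = (LINT z|distr lebesgue lebesgue ((*) \<tau>). G z)"
    using G by (subst integral_distr[OF measurable_unimodular_mult[OF assms(1)]]) auto
  also have "\<dots> = (LINT z|lebesgue_on unit_disk. F z)"
    by (simp only: lebesgue_distr_unimodular_mult[OF assms(1)])
      (subst integral_restrict_space, auto simp: G_def)
  finally show ?thesis .
qed

section \<open>Moments of monomials and holomorphic functions over concentric disks\<close>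

lemma finite_measure_unit_disk: "finite_measure (lebesgue_on unit_disk)"
  by (intro finite_measureI) (auto simp: emeasure_restrict_space emeasure_ball)

lemma borel_measurable_unit_disk_continuous:
  "continuous_on unit_disk f \<Longrightarrow> f \<in> borel_measurable (lebesgue_on unit_disk)"
  by (rule continuous_imp_measurable_on_sets_lebesgue) auto

text \<open>For distinct exponents a rotation by pi / (m - l) turns the integrand into its negative
  while preserving the integral. For equal exponents the integrand is the power t^l of t = |z|^2,
  cut off at s^2.\<close>

lemma integral_moment_ball:
  assumes "0 < s" "s < 1"
  shows "(LINT z|lebesgue_on unit_disk. indicator (ball 0 s) z *\<^sub>R (cnj z ^ l * z ^ m)) =
    (if l = m then of_real (pi * s ^ (2 * l + 2) / (l + 1)) else (0::complex))"
proof (cases "l = m")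
  case True
  define \<phi> where "\<phi> = (\<lambda>t::real. indicator {..<s\<^sup>2} t *\<^sub>R t ^ l)"
  have s: "s\<^sup>2 < 1" "0 < s\<^sup>2" using assms by (auto simp: power_less_one_iff)
  have eq: "indicator (ball 0 s) z *\<^sub>R (cnj z ^ l * z ^ m) = complex_of_real (\<phi> ((cmod z)\<^sup>2))" for z
  proof -
    have "cmod z < s \<longleftrightarrow> (cmod z)\<^sup>2 < s\<^sup>2"
      using assms by (metis abs_norm_cancel abs_of_pos power2_less_imp_less power_strict_mono
          less_eq_real_def norm_ge_zero zero_less_numeral)
    moreover have "cnj z ^ m * z ^ m = complex_of_real (((cmod z)\<^sup>2) ^ m)"
      by (simp only: of_real_power[of _ m] complex_norm_square power_mult_distrib mult.commute)
    ultimately show ?thesis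
      by (simp add: \<phi>_def indicator_def True)
  qed
  have [measurable]: "\<phi> \<in> borel_measurable borel"
    unfolding \<phi>_def by measurable
  have \<phi>: "\<phi> \<in> borel_measurable (lebesgue_on {0..<1})"
    by (intro measurable_restrict_space1 measurable_completion) simp
  have "(LINT z|lebesgue_on unit_disk. indicator (ball 0 s) z *\<^sub>R (cnj z ^ l * z ^ m)) =
      complex_of_real (LINT z|lebesgue_on unit_disk. \<phi> ((cmod z)\<^sup>2))"
    by (simp only: eq integral_complex_of_real)
  also have "(LINT z|lebesgue_on unit_disk. \<phi> ((cmod z)\<^sup>2)) = pi * (LINT t|lebesgue_on {0..<1}. \<phi> t)"
    using integral_radial_unit_disk[OF \<phi>] by simp
  also have "(LINT t|lebesgue_on {0..<1}. \<phi> t) = (LINT t|lebesgue. indicator {0..<s\<^sup>2} t *\<^sub>R t ^ l)"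
    using s by (subst integral_restrict_space)
      (auto simp: \<phi>_def indicator_def intro!: Bochner_Integration.integral_cong)
  also have "\<dots> = (LINT t|lborel. indicator {0..<s\<^sup>2} t *\<^sub>R t ^ l)"
    by (subst integral_completion) auto
  also have "\<dots> = (LINT t|lborel. indicator {0..s\<^sup>2} t *\<^sub>R t ^ l)"
    using AE_lborel_singleton[of "s\<^sup>2"]
    by (intro integral_cong_AE) (auto simp: indicator_def)
  also have "\<dots> = (s\<^sup>2) ^ (l + 1) / (l + 1)"
    using integral_power[of 0 "s\<^sup>2" l] by (simp add: mult.commute)
  also have "(s\<^sup>2) ^ (l + 1) = s ^ (2 * l + 2)"
    by (simp only: power_mult[symmetric] distrib_left mult_1_right)
  finally show ?thesis
    by (simp add: True power2_eq_square)
next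
  case False
  define F where "F = (\<lambda>z. indicator (ball 0 s) z *\<^sub>R (cnj z ^ l * z ^ m))"
  define \<theta> where "\<theta> = pi / (real m - real l)"
  have ml: "real m - real l \<noteq> 0" using False by simp
  have F: "F \<in> borel_measurable (lebesgue_on unit_disk)"
    unfolding F_def using assms
    by (intro borel_measurable_scaleR borel_measurable_indicator borel_measurable_unit_disk_continuous
        continuous_intros) (auto simp: sets_restrict_space_iff)
  have "cnj (cis \<theta>) ^ l * cis \<theta> ^ m = cis (\<theta> * (real m - real l))"
    by (simp add: cis_cnj cis_inverse Complex.DeMoivre cis_mult algebra_simps)
  also have "\<dots> = -1"
    using ml by (simp add: \<theta>_def)
  finally have c: "cnj (cis \<theta>) ^ l * cis \<theta> ^ m = -1" .
  have "F (cis \<theta> * z) = - F z" for z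
  proof -
    have "F (cis \<theta> * z) = (cnj (cis \<theta>) ^ l * cis \<theta> ^ m) * F z"
      by (auto simp: F_def indicator_def norm_mult power_mult_distrib mult_ac)
    then show ?thesis by (simp add: c)
  qed
  then have "(LINT z|lebesgue_on unit_disk. F z) = - (LINT z|lebesgue_on unit_disk. F z)"
    using integral_rotate_unit_disk[OF _ F, of "cis \<theta>"] by simp
  then show ?thesis
    using False by (simp add: F_def)
qed

text \<open>The Taylor series of h may be integrated termwise, since it converges absolutely and
  uniformly on the smaller disk, and only the term of degree l - p has a nonzero moment.\<close>

lemma integral_holomorphic_moment_ball:
  assumes h: "h holomorphic_on unit_disk" and s: "0 < s" "s < 1"
  shows "(LINT z|lebesgue_on unit_disk. indicator (ball 0 s) z *\<^sub>R (cnj z ^ l * z ^ p * h z)) =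
    (if p \<le> l then (deriv ^^ (l - p)) h 0 / fact (l - p) * of_real (pi * s ^ (2 * l + 2) / (l + 1))
     else 0)"
proof -
  interpret finite_measure "lebesgue_on unit_disk" by (rule finite_measure_unit_disk)
  define a where "a m = (deriv ^^ m) h 0 / fact m" for m
  have h_sums: "(\<lambda>m. a m * z ^ m) sums h z" if "cmod z < 1" for z
    using holomorphic_power_series[OF h, of z] that by (simp add: a_def)
  have summable: "summable (\<lambda>m. cmod (a m) * s ^ m)"
  proof -
    \<comment> \<open>Convergence at the larger radius t yields absolute convergence at s.\<close>
    obtain t where t: "s < t" "t < 1"
      using dense[OF s(2)] by blast
    then have "summable (\<lambda>m. norm (a m * of_real s ^ m))"
      using s by (intro powser_insidea[of a "of_real t"] sums_summable[OF h_sums]) auto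
    then show ?thesis using s by (simp add: norm_mult norm_power)
  qed
  define F where "F m z = indicator (ball 0 s) z *\<^sub>R (cnj z ^ l * z ^ p * (a m * z ^ m))" for m z
  have F_eq: "F m z = a m * (indicator (ball 0 s) z *\<^sub>R (cnj z ^ l * z ^ (p + m)))" for m z
    by (simp add: F_def power_add mult_ac)
  have F_le: "cmod (F m z) \<le> cmod (a m) * s ^ m" for m z
  proof (cases "cmod z < s")
    case True
    have "cmod z ^ l * cmod z ^ p * (cmod (a m) * cmod z ^ m) \<le> 1 * 1 * (cmod (a m) * s ^ m)"
      using True s by (intro mult_mono power_mono power_le_one) auto
    then show ?thesis using True by (simp add: F_def norm_mult norm_power)
  qed (use s in \<open>auto simp: F_def\<close>)
  have F_meas: "F m \<in> borel_measurable (lebesgue_on unit_disk)" for m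
    unfolding F_def using assms
    by (intro borel_measurable_scaleR borel_measurable_indicator borel_measurable_unit_disk_continuous
        continuous_intros) (auto simp: sets_restrict_space_iff)
  have F_int: "integrable (lebesgue_on unit_disk) (F m)" for m
    by (rule integrable_const_bound[where B = "cmod (a m) * s ^ m"]) (auto simp: F_le F_meas)
  have "(\<lambda>m. LINT z|lebesgue_on unit_disk. F m z) sums (LINT z|lebesgue_on unit_disk. (\<Sum>m. F m z))"
  proof (rule sums_integral[OF F_int])
    show "AE z in lebesgue_on unit_disk. summable (\<lambda>m. norm (F m z))"
      using F_le by (intro AE_I2 summable_comparison_test'[OF summable]) auto
    have "(LINT z|lebesgue_on unit_disk. norm (F m z)) \<le>
        (LINT z|lebesgue_on unit_disk. cmod (a m) * s ^ m)" for m
      by (intro integral_mono integrable_norm F_int) (auto simp: F_le)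
    then have "(LINT z|lebesgue_on unit_disk. norm (F m z)) \<le>
        cmod (a m) * s ^ m * measure (lebesgue_on unit_disk) (space (lebesgue_on unit_disk))" for m
      by (simp add: mult_ac)
    then show "summable (\<lambda>m. LINT z|lebesgue_on unit_disk. norm (F m z))"
      by (intro summable_comparison_test'[OF summable_mult2[OF summable]]) auto
  qed
  also have "(LINT z|lebesgue_on unit_disk. (\<Sum>m. F m z)) =
      (LINT z|lebesgue_on unit_disk. indicator (ball 0 s) z *\<^sub>R (cnj z ^ l * z ^ p * h z))"
  proof (rule Bochner_Integration.integral_cong)
    fix z :: complex
    assume "z \<in> space (lebesgue_on unit_disk)"
    then have "cmod z < 1" by simp
    then have "(\<lambda>m. F m z) sums (indicator (ball 0 s) z *\<^sub>R (cnj z ^ l * z ^ p * h z))"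
      unfolding F_def by (intro sums_scaleR_right sums_mult h_sums)
    then show "(\<Sum>m. F m z) = indicator (ball 0 s) z *\<^sub>R (cnj z ^ l * z ^ p * h z)"
      by (rule sums_unique[symmetric])
  qed simp
  finally have sums: "(\<lambda>m. LINT z|lebesgue_on unit_disk. F m z) sums
      (LINT z|lebesgue_on unit_disk. indicator (ball 0 s) z *\<^sub>R (cnj z ^ l * z ^ p * h z))" .
  have F_val: "(LINT z|lebesgue_on unit_disk. F m z) =
      (if l = p + m then a m * of_real (pi * s ^ (2 * l + 2) / (l + 1)) else 0)" for m
    unfolding F_eq integral_mult_right_zero integral_moment_ball[OF s] by simp
  have "(\<lambda>m. LINT z|lebesgue_on unit_disk. F m z) sums
      (if p \<le> l then a (l - p) * of_real (pi * s ^ (2 * l + 2) / (l + 1)) else 0)"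
  proof (cases "p \<le> l")
    case True
    then have "(\<lambda>m. LINT z|lebesgue_on unit_disk. F m z) =
        (\<lambda>m. if m = l - p then a (l - p) * of_real (pi * s ^ (2 * l + 2) / (l + 1)) else 0)"
      by (auto simp: F_val fun_eq_iff)
    then show ?thesis
      using True sums_single[of "l - p" "\<lambda>m. a (l - p) * of_real (pi * s ^ (2 * l + 2) / (l + 1))"]
      by simp
  next
    case False
    then have "(\<lambda>m. LINT z|lebesgue_on unit_disk. F m z) = (\<lambda>m. 0)"
      by (auto simp: F_val fun_eq_iff)
    then show ?thesis using False by simp
  qed
  with sums show ?thesis
    unfolding a_def by (rule sums_unique2)
qed

text \<open>Lagrange interpolation: \<open>w k i\<close> is the k-th coefficient of the i-th
  Lagrange basis polynomial. The weights are chosen before the polynomial d, which is what later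
  gives one constant for all functions.\<close>

lemma interpolation_weights:
  fixes x :: "nat \<Rightarrow> 'a::field"
  assumes "inj_on x {..<n}"
  shows "\<exists>w. \<forall>d. \<forall>k<n. d k = (\<Sum>i<n. w k i * (\<Sum>j<n. d j * x i ^ j))"
proof -
  define L where "L i = (\<Prod>j\<in>{..<n} - {i}. Polynomial.smult (inverse (x i - x j)) [:- x j, 1:])" for i
  have L_eq: "poly (L i) y = (\<Prod>j\<in>{..<n} - {i}. inverse (x i - x j) * (y - x j))" for i y
    by (simp add: L_def poly_prod algebra_simps)
  have L: "poly (L i) (x k) = (if i = k then 1 else 0)" if "i < n" "k < n" for i k
  proof (cases "i = k")
    case True
    have "x i - x j \<noteq> 0" if "j \<in> {..<n} - {i}" for j
      using assms \<open>i < n\<close> that by (auto simp: inj_on_def)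
    then show ?thesis
      unfolding L_eq using True by (auto intro!: prod.neutral)
  next
    case False
    then have "\<exists>j\<in>{..<n} - {i}. inverse (x i - x j) * (x k - x j) = 0"
      using that by (intro bexI[of _ k]) auto
    then show ?thesis
      unfolding L_eq using False by (subst prod_zero) auto
  qed
  have deg_L: "degree (L i) < n" if "i < n" for i
  proof -
    have "degree (L i) \<le> (\<Sum>j\<in>{..<n} - {i}. degree (Polynomial.smult (inverse (x i - x j)) [:- x j, 1:]))"
      unfolding L_def by (rule order.trans[OF degree_prod_sum_le]) (simp_all add: comp_def)
    also have "\<dots> \<le> (\<Sum>j\<in>{..<n} - {i}. 1)"
      by (intro sum_mono order.trans[OF degree_smult_le]) simp
    also have "\<dots> < n" using that by simp
    finally show ?thesis .
  qed
  have "d k = (\<Sum>i<n. Polynomial.coeff (L i) k * (\<Sum>j<n. d j * x i ^ j))" if "k < n" for d k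
  proof -
    define p where "p = (\<Sum>j<n. Polynomial.monom (d j) j)"
    define q where "q = (\<Sum>i<n. Polynomial.smult (\<Sum>j<n. d j * x i ^ j) (L i))"
    have "p = q"
    proof (rule poly_eqI_degree[where A = "x ` {..<n}"])
      fix y assume "y \<in> x ` {..<n}"
      then obtain k where k: "k < n" "y = x k" by auto
      have "poly q y = (\<Sum>i<n. (\<Sum>j<n. d j * x i ^ j) * (if i = k then 1 else 0))"
        unfolding q_def poly_sum poly_smult using k by (intro sum.cong) (auto simp: L)
      also have "\<dots> = poly p y"
        using k by (simp add: p_def poly_sum poly_monom if_distrib[of "(*) _"] cong: if_cong)
      finally show "poly p y = poly q y" by simp
    next
      have n: "card (x ` {..<n}) = n" using assms by (simp add: card_image)
      show "degree p < card (x ` {..<n})"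
        unfolding n p_def using that
        by (intro degree_sum_less) (auto intro: order.strict_trans1[OF degree_monom_le])
      show "degree q < card (x ` {..<n})"
        unfolding n q_def using that
        by (intro degree_sum_less) (auto intro: order.strict_trans1[OF degree_smult_le] deg_L)
    qed
    then have "Polynomial.coeff p k = Polynomial.coeff q k" by simp
    then show ?thesis
      using that by (simp add: p_def q_def coeff_sum mult.commute)
  qed
  then show ?thesis by (intro exI[of _ "\<lambda>k i. Polynomial.coeff (L i) k"]) blast
qed

lemma integrable_ball_continuous:
  assumes "continuous_on unit_disk f" "R < 1"
  shows "integrable (lebesgue_on unit_disk) (\<lambda>z. indicator (ball 0 R) z *\<^sub>R (f z :: complex))"
proof -
  interpret finite_measure "lebesgue_on unit_disk" by (rule finite_measure_unit_disk)
  have "compact (f ` cball 0 R)"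
    using assms by (intro compact_continuous_image continuous_on_subset[OF assms(1)]) auto
  then have "bounded (f ` cball 0 R)"
    by (rule compact_imp_bounded)
  then obtain B where B: "\<And>z. z \<in> cball 0 R \<Longrightarrow> cmod (f z) \<le> B"
    unfolding bounded_iff by blast
  show ?thesis
  proof (rule integrable_const_bound[where B = "max 0 B"])
    show "AE z in lebesgue_on unit_disk. norm (indicator (ball 0 R) z *\<^sub>R f z) \<le> max 0 B"
      using B by (intro AE_I2) (auto simp: indicator_def intro: max.coboundedI2)
    show "(\<lambda>z. indicator (ball 0 R) z *\<^sub>R f z) \<in> borel_measurable (lebesgue_on unit_disk)"
      using assms
      by (intro borel_measurable_scaleR borel_measurable_indicator borel_measurable_unit_disk_continuous)
        (auto simp: sets_restrict_space_iff)
  qed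
qed

text \<open>Pairing \<^term>\<open>f\<close> with \<open>z\<^sup>l cnj z\<^sup>n\<^sup>-\<^sup>1\<close> over a ball of radius \<^term>\<open>s\<close> kills all
  frequencies but one, by rotation invariance. What remains is a polynomial of degree less than
  \<^term>\<open>n\<close> in \<^term>\<open>s\<^sup>2\<close>, up to an explicit factor, whose coefficients are Taylor coefficients of the
  functions \<^term>\<open>g k\<close>. Interpolation at \<^term>\<open>n\<close> radii recovers them. The factor
  \<open>z\<^sup>n\<^sup>-\<^sup>1\<close> shifts all frequencies that occur to nonnegative ones.\<close>

theorem polyanalytic_coefficient_bound:
  fixes n :: nat
  assumes r: "0 \<le> r" "r < R" "R < 1"
  shows "\<exists>C. \<forall>g f. (\<forall>k<n. g k holomorphic_on unit_disk) \<longrightarrow>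
      (\<forall>z\<in>unit_disk. f z = (\<Sum>k<n. cnj z ^ k * g k z)) \<longrightarrow>
      (\<forall>k<n. \<forall>w\<in>cball 0 r. cmod (g k w) \<le>
        C * (LINT z|lebesgue_on unit_disk. indicator (ball 0 R) z * cmod (f z)))"
proof -
  \<comment> \<open>All radii s i lie in [r1, R). That r1 exceeds r makes the Taylor series converge
    geometrically with ratio r / r1 on the disk of radius r; that it is below R leaves room for n
    distinct radii. It is positive even when r = 0.\<close>
  define r1 where "r1 = (r + R) / 2"
  have r1: "0 < r1" "r < r1" "r1 < R" "r1 < 1" using r by (auto simp: r1_def)
  define s where "s i = r1 + (R - r1) * (real i / real n)" for i
  have s: "r1 \<le> s i" "s i < R" "0 < s i" "s i < 1" if "i < n" for i
  proof -
    show "r1 \<le> s i" using r1 by (simp add: s_def)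
    have "(R - r1) * (real i / real n) < (R - r1) * 1"
      using that r1 by (intro mult_strict_left_mono) auto
    then show "s i < R" by (simp add: s_def)
    then show "0 < s i" "s i < 1" using \<open>r1 \<le> s i\<close> r1 r by auto
  qed
  have "inj_on (\<lambda>i. complex_of_real ((s i)\<^sup>2)) {..<n}"
  proof (rule inj_onI)
    fix i j assume ij: "i \<in> {..<n}" "j \<in> {..<n}" "complex_of_real ((s i)\<^sup>2) = complex_of_real ((s j)\<^sup>2)"
    then have "s i = s j"
      using s(3)[of i] s(3)[of j] by (simp only: of_real_eq_iff power2_eq_iff) auto
    then show "i = j" using r1 ij by (simp add: s_def)
  qed
  from interpolation_weights[OF this] obtain W where
    W: "\<And>d k. k < n \<Longrightarrow> d k = (\<Sum>i<n. W k i * (\<Sum>j<n. d j * complex_of_real ((s i)\<^sup>2) ^ j))"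
    by blast
  define \<Lambda> where "\<Lambda> = (\<Sum>k<n. \<Sum>i<n. cmod (W k i))"
  define q where "q = r / r1"
  have q: "0 \<le> q" "q < 1" using r r1 by (auto simp: q_def)
  define C where "C = \<Lambda> * (1 / r1) ^ (n + 1) * (real n / (1 - q)\<^sup>2)"
  have "cmod (g k w) \<le> C * (LINT z|lebesgue_on unit_disk. indicator (ball 0 R) z * cmod (f z))"
    if g: "\<forall>k<n. g k holomorphic_on unit_disk"
      and f: "\<forall>z\<in>unit_disk. f z = (\<Sum>k<n. cnj z ^ k * g k z)"
      and k: "k < n" and w: "w \<in> cball 0 r" for g f k w
  proof -
    define a where "a k m = (deriv ^^ m) (g k) 0 / fact m" for k m
    define J where "J = (LINT z|lebesgue_on unit_disk. indicator (ball 0 R) z * cmod (f z))"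
    have cont_g: "continuous_on unit_disk (g k)" if "k < n" for k
      using g that by (auto intro: holomorphic_on_imp_continuous_on)
    have "continuous_on unit_disk (\<lambda>z. \<Sum>k<n. cnj z ^ k * g k z)"
      by (intro continuous_intros cont_g) auto
    then have cont_f: "continuous_on unit_disk f"
      by (rule continuous_on_cong[THEN iffD1, rotated -1]) (use f in auto)
    have "J \<ge> 0" unfolding J_def by (intro integral_nonneg_AE) auto
    \<comment> \<open>The division absorbs the factor 1 / (l + k + 1) of the moment formula, so that
      the radius enters only through powers. The condition excludes vanishing moments and keeps the
      subtraction exact.\<close>
    define d where "d l k = (if n - 1 \<le> l + k then a k (l + k - (n - 1)) / of_nat (l + k + 1) else 0)"
      for l k
    define I where "I l i = (LINT z|lebesgue_on unit_disk.
        indicator (ball 0 (s i)) z *\<^sub>R (cnj z ^ l * z ^ (n - 1) * f z))" for l i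
    have I_eq: "I l i = of_real (pi * s i ^ (2 * l + 2)) *
        (\<Sum>k<n. d l k * complex_of_real ((s i)\<^sup>2) ^ k)" if i: "i < n" for l i
    proof -
      have "I l i = (LINT z|lebesgue_on unit_disk. (\<Sum>k<n.
          indicator (ball 0 (s i)) z *\<^sub>R (cnj z ^ (l + k) * z ^ (n - 1) * g k z)))"
        unfolding I_def
        by (intro Bochner_Integration.integral_cong)
          (auto simp: f sum_distrib_left power_add mult_ac scaleR_sum_right)
      also have "\<dots> = (\<Sum>k<n. LINT z|lebesgue_on unit_disk.
          indicator (ball 0 (s i)) z *\<^sub>R (cnj z ^ (l + k) * z ^ (n - 1) * g k z))"
        using s[OF i] cont_g
        by (intro Bochner_Integration.integral_sum integrable_ball_continuous continuous_intros) auto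
      also have "\<dots> = (\<Sum>k<n. d l k * of_real (pi * s i ^ (2 * (l + k) + 2)))"
        using g s[OF i]
        by (intro sum.cong refl, subst integral_holomorphic_moment_ball) (auto simp: d_def a_def)
      also have "\<dots> = (\<Sum>k<n. of_real (pi * s i ^ (2 * l + 2)) * (d l k * complex_of_real ((s i)\<^sup>2) ^ k))"
      proof (intro sum.cong refl)
        fix k
        have "s i ^ (2 * (l + k) + 2) = s i ^ (2 * l + 2) * ((s i)\<^sup>2) ^ k"
          by (simp add: power_add power_mult)
        then show "d l k * of_real (pi * s i ^ (2 * (l + k) + 2)) =
            of_real (pi * s i ^ (2 * l + 2)) * (d l k * complex_of_real ((s i)\<^sup>2) ^ k)"
          by (simp only: of_real_mult of_real_power mult_ac)
      qed
      finally show ?thesis by (simp add: sum_distrib_left)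
    qed
    have I_le: "cmod (I l i) \<le> s i ^ l * J" if i: "i < n" for l i
    proof -
      have int: "integrable (lebesgue_on unit_disk)
          (\<lambda>z. indicator (ball 0 (s i)) z *\<^sub>R (cnj z ^ l * z ^ (n - 1) * f z))"
        using s[OF i] cont_f by (intro integrable_ball_continuous continuous_intros) auto
      have intR: "integrable (lebesgue_on unit_disk) (\<lambda>z. indicator (ball 0 R) z * cmod (f z))"
        using integrable_norm[OF integrable_ball_continuous[OF cont_f r(3)]]
        by (simp add: norm_mult)
      have "cmod (I l i) \<le> (LINT z|lebesgue_on unit_disk.
          norm (indicator (ball 0 (s i)) z *\<^sub>R (cnj z ^ l * z ^ (n - 1) * f z)))"
        unfolding I_def by (rule integral_norm_bound)
      also have "\<dots> \<le> (LINT z|lebesgue_on unit_disk. s i ^ l * (indicator (ball 0 R) z * cmod (f z)))"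
      proof (rule integral_mono)
        fix z :: complex
        show "norm (indicator (ball 0 (s i)) z *\<^sub>R (cnj z ^ l * z ^ (n - 1) * f z))
            \<le> s i ^ l * (indicator (ball 0 R) z * cmod (f z))"
        proof (cases "cmod z < s i")
          case True
          have "cmod z ^ l * cmod z ^ (n - 1) * cmod (f z) \<le> s i ^ l * 1 * cmod (f z)"
            using True s[OF i] by (intro mult_mono power_mono power_le_one) auto
          then show ?thesis using True s[OF i] by (simp add: norm_mult norm_power)
        qed (use s[OF i] in auto)
      qed (use integrable_norm[OF int] intR in auto)
      also have "\<dots> = s i ^ l * J" by (simp add: J_def)
      finally show ?thesis .
    qed
    have d_le: "cmod (d l k) \<le> \<Lambda> * (1 / r1) ^ (l + 2) * J" if k: "k < n" for l k
    proof -
      have "cmod (d l k) \<le> (\<Sum>i<n. cmod (W k i * (\<Sum>j<n. d l j * complex_of_real ((s i)\<^sup>2) ^ j)))"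
        by (subst W[OF k, of "d l"]) (rule norm_sum)
      also have "\<dots> \<le> (\<Sum>i<n. cmod (W k i) * ((1 / r1) ^ (l + 2) * J))"
        unfolding norm_mult
      proof (intro sum_mono mult_left_mono)
        fix i assume "i \<in> {..<n}"
        then have i: "i < n" by simp
        have pos: "0 < pi * s i ^ (2 * l + 2)" using s[OF i] by simp
        have "cmod (\<Sum>j<n. d l j * complex_of_real ((s i)\<^sup>2) ^ j) = cmod (I l i) / (pi * s i ^ (2 * l + 2))"
          using pos s[OF i] by (simp only: I_eq[OF i] norm_mult norm_of_real) simp
        \<comment> \<open>The explicit 1 in the denominator is a lower bound for pi.\<close>
        also have "\<dots> \<le> s i ^ l * J / (1 * s i ^ (2 * l + 2))"
          using pos s[OF i] \<open>J \<ge> 0\<close> pi_ge_two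
          by (intro frac_le I_le i mult_right_mono mult_pos_pos) auto
        also have "\<dots> = (1 / s i) ^ (l + 2) * J"
          using s[OF i] by (simp add: field_simps power_add power_mult power2_eq_square power_mult_distrib)
        also have "\<dots> \<le> (1 / r1) ^ (l + 2) * J"
          using s[OF i] r1 \<open>J \<ge> 0\<close> by (intro mult_right_mono power_mono divide_left_mono) auto
        finally show "cmod (\<Sum>j<n. d l j * complex_of_real ((s i)\<^sup>2) ^ j) \<le> (1 / r1) ^ (l + 2) * J" .
      qed auto
      also have "\<dots> = (\<Sum>i<n. cmod (W k i)) * ((1 / r1) ^ (l + 2) * J)"
        by (simp only: sum_distrib_right)
      also have "\<dots> \<le> \<Lambda> * ((1 / r1) ^ (l + 2) * J)"
        unfolding \<Lambda>_def using k \<open>J \<ge> 0\<close> r1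
        by (intro mult_right_mono member_le_sum[of k _ "\<lambda>k. \<Sum>i<n. cmod (W k i)"] sum_nonneg) auto
      finally show ?thesis by (simp add: mult_ac)
    qed
    have "\<Lambda> \<ge> 0" unfolding \<Lambda>_def by (intro sum_nonneg) auto
    have a_le: "cmod (a k m) \<le> real n * real (Suc m) * (\<Lambda> * (1 / r1) ^ (n + 1) * J) * (1 / r1) ^ m" for m
    proof -
      \<comment> \<open>The pairing exponent at which the Taylor coefficient \<open>a k m\<close>
        appears in \<open>d l k\<close>. As k < n, the subtraction is exact; without the shift by n
        - 1 it could be negative.\<close>
      define l where "l = m + (n - 1) - k"
      have l: "l + k = m + (n - 1)" using k by (simp add: l_def)
      have "l + k + 1 = m + n" "l + k - (n - 1) = m" "n - 1 \<le> l + k"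
        using k by (auto simp: l)
      then have "d l k = a k m / of_nat (m + n)"
        unfolding d_def by (simp only: if_True)
      then have "a k m = of_nat (m + n) * d l k"
        using k by (simp only: nonzero_mult_div_cancel_left times_divide_eq_right of_nat_eq_0_iff)
      then have "cmod (a k m) = real (m + n) * cmod (d l k)"
        by (simp only: norm_mult norm_of_nat)
      also have "\<dots> \<le> (real n * real (Suc m)) * (\<Lambda> * (1 / r1) ^ (n + 1 + m) * J)"
      proof (rule mult_mono)
        have "m + n \<le> n * Suc m" using k by (cases n) auto
        then show "real (m + n) \<le> real n * real (Suc m)"
          by (metis of_nat_le_iff of_nat_mult)
        have "cmod (d l k) \<le> \<Lambda> * (1 / r1) ^ (l + 2) * J" by (rule d_le[OF k])
        also have "\<dots> \<le> \<Lambda> * (1 / r1) ^ (n + 1 + m) * J"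
          using r1 \<open>\<Lambda> \<ge> 0\<close> \<open>J \<ge> 0\<close> k
          by (intro mult_right_mono mult_left_mono power_increasing) (auto simp: l_def)
        finally show "cmod (d l k) \<le> \<Lambda> * (1 / r1) ^ (n + 1 + m) * J" .
      qed auto
      finally show ?thesis by (simp add: power_add mult_ac)
    qed
    have "w \<in> ball 0 1" using w r by auto
    then have sums: "(\<lambda>m. a k m * w ^ m) sums g k w"
      using holomorphic_power_series[of "g k" 0 1 w] g k by (simp add: a_def)
    \<comment> \<open>The coefficient bound grows by the linear factor \<open>Suc m\<close>, so the
      majorant is the differentiated geometric series; its sum is the origin of the factor 1 / (1 -
      q)^2 in C.\<close>
    have bound: "(\<lambda>m. (real n * (\<Lambda> * (1 / r1) ^ (n + 1) * J)) * (of_nat (Suc m) * q ^ m)) sums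
        ((real n * (\<Lambda> * (1 / r1) ^ (n + 1) * J)) * (1 / (1 - q)\<^sup>2))"
      using q by (intro sums_mult geometric_deriv_sums) simp
    have "cmod (a k m * w ^ m) \<le> (real n * (\<Lambda> * (1 / r1) ^ (n + 1) * J)) * (of_nat (Suc m) * q ^ m)" for m
    proof -
      have "cmod (a k m * w ^ m) \<le>
          (real n * real (Suc m) * (\<Lambda> * (1 / r1) ^ (n + 1) * J) * (1 / r1) ^ m) * r ^ m"
        unfolding norm_mult norm_power using w r1 \<open>\<Lambda> \<ge> 0\<close> \<open>J \<ge> 0\<close>
        by (intro mult_mono a_le power_mono mult_nonneg_nonneg) auto
      also have "\<dots> = (real n * (\<Lambda> * (1 / r1) ^ (n + 1) * J)) * (of_nat (Suc m) * q ^ m)"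
        by (simp add: q_def power_divide)
      finally show ?thesis .
    qed
    then have "cmod (g k w) \<le> (real n * (\<Lambda> * (1 / r1) ^ (n + 1) * J)) * (1 / (1 - q)\<^sup>2)"
      unfolding sums_unique[OF sums] sums_unique[OF bound]
      by (rule norm_suminf_le[OF _ sums_summable[OF bound]])
    then show ?thesis by (simp add: C_def J_def mult_ac)
  qed
  then show ?thesis by blast
qed

section \<open>Completeness of the space of polyanalytic functions\<close>

text \<open>The pointwise limit is given, so Fatou's lemma in j at fixed i turns the Cauchy estimate
  into a bound on the distance of h i from g. Membership of g follows because h N and h N - g are
  both square-integrable.\<close>

lemma Ltwo_limit:
  assumes h: "\<And>m. h m \<in> Ltwo M"
    and cauchy: "\<And>e. e > 0 \<Longrightarrow> \<exists>N. \<forall>i\<ge>N. \<forall>j\<ge>N. (LINT x|M. (cmod (h i x - h j x))\<^sup>2) < e"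
    and lim: "\<And>x. x \<in> space M \<Longrightarrow> (\<lambda>m. h m x) \<longlonglongrightarrow> g x"
  shows "g \<in> Ltwo M" and "(\<lambda>m::nat. LINT x|M. (cmod (h m x - g x))\<^sup>2) \<longlonglongrightarrow> 0"
proof -
  note [measurable] = h[THEN Ltwo_measurable]
  have g_meas [measurable]: "g \<in> borel_measurable M"
    by (rule borel_measurable_LIMSEQ_metric[where f = h]) (auto simp: lim)
  have fatou: "(\<integral>\<^sup>+x. ennreal ((cmod (h i x - g x))\<^sup>2) \<partial>M) \<le> ennreal e"
    if N: "\<forall>i\<ge>N. \<forall>j\<ge>N. (LINT x|M. (cmod (h i x - h j x))\<^sup>2) < e" and i: "i \<ge> N" for N i e
  proof -
    have "(\<integral>\<^sup>+x. ennreal ((cmod (h i x - g x))\<^sup>2) \<partial>M) =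
        (\<integral>\<^sup>+x. liminf (\<lambda>j. ennreal ((cmod (h i x - h j x))\<^sup>2)) \<partial>M)"
    proof (rule nn_integral_cong)
      fix x assume "x \<in> space M"
      then have "(\<lambda>j. ennreal ((cmod (h i x - h j x))\<^sup>2)) \<longlonglongrightarrow> ennreal ((cmod (h i x - g x))\<^sup>2)"
        by (intro tendsto_intros tendsto_ennrealI lim)
      then show "ennreal ((cmod (h i x - g x))\<^sup>2) = liminf (\<lambda>j. ennreal ((cmod (h i x - h j x))\<^sup>2))"
        by (rule lim_imp_Liminf[OF trivial_limit_sequentially, symmetric])
    qed
    also have "\<dots> \<le> liminf (\<lambda>j. \<integral>\<^sup>+x. ennreal ((cmod (h i x - h j x))\<^sup>2) \<partial>M)"
      by (rule nn_integral_liminf) measurable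
    also have "\<dots> \<le> liminf (\<lambda>j. ennreal e)"
    proof (rule Liminf_mono, unfold eventually_sequentially, intro exI allI impI)
      fix j assume "j \<ge> N"
      have "(\<integral>\<^sup>+x. ennreal ((cmod (h i x - h j x))\<^sup>2) \<partial>M) = ennreal (LINT x|M. (cmod (h i x - h j x))\<^sup>2)"
        by (intro nn_integral_eq_integral Ltwo_integrable Ltwo_diff h) auto
      then show "(\<integral>\<^sup>+x. ennreal ((cmod (h i x - h j x))\<^sup>2) \<partial>M) \<le> ennreal e"
        using N i \<open>j \<ge> N\<close> by (simp add: less_imp_le ennreal_leI)
    qed
    finally show ?thesis by (simp add: Liminf_const)
  qed
  have int: "integrable M (\<lambda>x. (cmod (h i x - g x))\<^sup>2)"
    and le: "(LINT x|M. (cmod (h i x - g x))\<^sup>2) \<le> e"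
    if "\<forall>i\<ge>N. \<forall>j\<ge>N. (LINT x|M. (cmod (h i x - h j x))\<^sup>2) < e" "i \<ge> N" "e > 0" for N i e
  proof -
    have f: "(\<integral>\<^sup>+x. ennreal ((cmod (h i x - g x))\<^sup>2) \<partial>M) \<le> ennreal e"
      by (rule fatou[OF that(1,2)])
    also have "\<dots> < \<infinity>" by simp
    finally have fin: "(\<integral>\<^sup>+x. ennreal ((cmod (h i x - g x))\<^sup>2) \<partial>M) < \<infinity>" .
    show i: "integrable M (\<lambda>x. (cmod (h i x - g x))\<^sup>2)"
      by (rule integrableI_nonneg) (use fin in auto)
    show "(LINT x|M. (cmod (h i x - g x))\<^sup>2) \<le> e"
      using f nn_integral_eq_integral[OF i] \<open>e > 0\<close> by simp
  qed
  obtain N where "\<forall>i\<ge>N. \<forall>j\<ge>N. (LINT x|M. (cmod (h i x - h j x))\<^sup>2) < 1"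
    using cauchy[of 1] by auto
  then have "(\<lambda>x. h N x - g x) \<in> Ltwo M"
    using int[of N 1 N] by (simp add: Ltwo_def)
  from Ltwo_diff[OF h[of N] this] show "g \<in> Ltwo M" by simp
  show "(\<lambda>m. LINT x|M. (cmod (h m x - g x))\<^sup>2) \<longlonglongrightarrow> 0"
  proof (rule LIMSEQ_I)
    fix e :: real assume "e > 0"
    then obtain N where N: "\<forall>i\<ge>N. \<forall>j\<ge>N. (LINT x|M. (cmod (h i x - h j x))\<^sup>2) < e / 2"
      using cauchy[of "e / 2"] by auto
    have "norm ((LINT x|M. (cmod (h i x - g x))\<^sup>2) - 0) < e" if "i \<ge> N" for i
      using le[OF N that] \<open>e > 0\<close> by simp
    then show "\<exists>N. \<forall>i\<ge>N. norm ((LINT x|M. (cmod (h i x - g x))\<^sup>2) - 0) < e" by blast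
  qed
qed

section \<open>The weighted measure on the disk\<close>

definition disk_weight :: "real \<Rightarrow> complex \<Rightarrow> real" where
  "disk_weight \<alpha> z = (\<alpha> + 1) / pi * (1 - (cmod z)\<^sup>2) powr \<alpha>"

lemma disk_measure_eq: "disk_measure \<alpha> = density (lebesgue_on unit_disk) (\<lambda>z. ennreal (disk_weight \<alpha> z))"
  by (simp add: disk_measure_def disk_weight_def)

lemma space_disk_measure [simp]: "space (disk_measure \<alpha>) = unit_disk"
  by (simp add: disk_measure_def)

lemma sets_disk_measure [measurable_cong]: "sets (disk_measure \<alpha>) = sets (lebesgue_on unit_disk)"
  by (simp add: disk_measure_def)

lemma borel_measurable_disk_measure:
  "borel_measurable (disk_measure \<alpha>) = borel_measurable (lebesgue_on unit_disk)"
  by (rule measurable_cong_sets) (auto simp: sets_disk_measure)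

lemma disk_weight_pos:
  assumes "\<alpha> > -1" "z \<in> unit_disk"
  shows "disk_weight \<alpha> z > 0"
proof -
  have "(cmod z)\<^sup>2 < 1" using assms by (simp add: power_less_one_iff)
  then show ?thesis using assms by (simp add: disk_weight_def)
qed

lemma continuous_on_disk_weight: "continuous_on unit_disk (disk_weight \<alpha>)"
proof -
  have "(cmod z)\<^sup>2 \<noteq> 1" if "z \<in> unit_disk" for z :: complex
    using that power_less_one_iff[of "cmod z" 2] by simp
  then show ?thesis
    unfolding disk_weight_def by (intro continuous_intros) auto
qed

lemma borel_measurable_disk_weight: "disk_weight \<alpha> \<in> borel_measurable (lebesgue_on unit_disk)"
  by (rule continuous_imp_measurable_on_sets_lebesgue[OF continuous_on_disk_weight]) auto

lemma AE_disk_weight_nonneg: "\<alpha> > -1 \<Longrightarrow> AE z in lebesgue_on unit_disk. 0 \<le> disk_weight \<alpha> z"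
  by (rule AE_I2) (use disk_weight_pos less_imp_le in auto)

lemma
  fixes f :: "complex \<Rightarrow> 'b::{banach, second_countable_topology}"
  assumes "\<alpha> > -1" "f \<in> borel_measurable (lebesgue_on unit_disk)"
  shows integrable_disk_measure: "integrable (disk_measure \<alpha>) f \<longleftrightarrow>
      integrable (lebesgue_on unit_disk) (\<lambda>z. disk_weight \<alpha> z *\<^sub>R f z)"
    and integral_disk_measure: "(LINT z|disk_measure \<alpha>. f z) =
      (LINT z|lebesgue_on unit_disk. disk_weight \<alpha> z *\<^sub>R f z)"
  using integrable_density[OF assms(2) borel_measurable_disk_weight AE_disk_weight_nonneg[OF assms(1)]]
    integral_density[OF assms(2) borel_measurable_disk_weight AE_disk_weight_nonneg[OF assms(1)]]
  by (simp_all add: disk_measure_eq)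

text \<open>The reflection of t^\<alpha> at 0. For negative \<alpha> this is the singularity of the
  weight at the circle, and \<alpha> > -1 makes it integrable.\<close>

lemma integrable_powr_unit_interval:
  fixes \<alpha> :: real
  assumes "\<alpha> > -1"
  shows "integrable (lebesgue_on {0..<1}) (\<lambda>t. (1 - t) powr \<alpha>)"
proof -
  have "(\<lambda>t. t powr \<alpha>) integrable_on {0..1}"
    by (rule integrable_on_powr_from_0) (use assms in auto)
  then have "(\<lambda>t. t powr \<alpha>) absolutely_integrable_on {0..1}"
    by (subst absolutely_integrable_on_iff_nonneg) auto
  then have "integrable lborel (\<lambda>t. indicator {0..1} t *\<^sub>R t powr \<alpha>)"
    unfolding set_integrable_def by (subst (asm) integrable_completion) auto
  then have "integrable lborel (\<lambda>t. indicator {0..1} (1 + (-1) * t) *\<^sub>R (1 + (-1) * t) powr \<alpha>)"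
    by (rule lborel_integrable_real_affine) simp
  then have "integrable lborel (\<lambda>t. indicator {0..<1} t *\<^sub>R (indicator {0..1} (1 + (-1) * t) *\<^sub>R (1 + (-1) * t) powr \<alpha>))"
    by (intro integrable_mult_indicator) auto
  then have "integrable lborel (\<lambda>t. indicator {0..<1} t *\<^sub>R (1 - t) powr \<alpha>)"
    by (rule Bochner_Integration.integrable_cong[THEN iffD1, rotated -1]) (auto simp: indicator_def)
  then show ?thesis
    by (subst integrable_restrict_space) (auto simp: integrable_completion)
qed

lemma finite_measure_disk_measure:
  assumes "\<alpha> > -1"
  shows "finite_measure (disk_measure \<alpha>)"
proof -
  have "(\<lambda>t::real. (1 - t) powr \<alpha>) \<in> borel_measurable (lebesgue_on {0..<1})"
    using integrable_powr_unit_interval[OF assms] by (rule borel_measurable_integrable)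
  then have "integrable (lebesgue_on unit_disk) (\<lambda>z. (1 - (cmod z)\<^sup>2) powr \<alpha>)"
    using integrable_radial_unit_disk[of "\<lambda>t. (1 - t) powr \<alpha>"] integrable_powr_unit_interval[OF assms]
    by simp
  then have "integrable (lebesgue_on unit_disk) (\<lambda>z. disk_weight \<alpha> z *\<^sub>R (1::real))"
    unfolding disk_weight_def by simp
  then have "integrable (disk_measure \<alpha>) (\<lambda>z. 1::real)"
    by (subst integrable_disk_measure[OF assms]) auto
  then have "emeasure (disk_measure \<alpha>) (space (disk_measure \<alpha>)) < \<infinity>"
    using integrable_iff_bounded[of "disk_measure \<alpha>" "\<lambda>z. 1::real"] by simp
  then show ?thesis by (intro finite_measureI) auto
qed

text \<open>On the closed disk of radius R < 1 the weight attains a positive minimum w, so the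
  weighted norm controls the unweighted one there; the Cauchy-Schwarz inequality against a constant
  then passes from L2 to L1.\<close>

lemma Ltwo_ball_integral_bound:
  assumes \<alpha>: "\<alpha> > -1" and R: "0 < R" "R < 1"
  shows "\<exists>K\<ge>0. \<forall>f\<in>Ltwo (disk_measure \<alpha>).
    (LINT z|lebesgue_on unit_disk. indicator (ball 0 R) z * cmod (f z)) \<le> K * Ltwo_norm (disk_measure \<alpha>) f"
proof -
  interpret finite_measure "lebesgue_on unit_disk" by (rule finite_measure_unit_disk)
  have "continuous_on (cball 0 R) (disk_weight \<alpha>)"
    using R by (intro continuous_on_subset[OF continuous_on_disk_weight]) auto
  then obtain z0 where z0: "z0 \<in> cball 0 R" "\<And>z. z \<in> cball 0 R \<Longrightarrow> disk_weight \<alpha> z0 \<le> disk_weight \<alpha> z"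
    using continuous_attains_inf[of "cball 0 R" "disk_weight \<alpha>"] R by auto
  define w where "w = disk_weight \<alpha> z0"
  have w: "w > 0" unfolding w_def using z0 R by (intro disk_weight_pos \<alpha>) auto
  define P where "P = measure (lebesgue_on unit_disk) (space (lebesgue_on unit_disk))"
  have P: "P > 0"
    by (simp add: P_def measure_restrict_space)
  have "(LINT z|lebesgue_on unit_disk. indicator (ball 0 R) z * cmod (f z)) \<le>
      sqrt (P / w) * Ltwo_norm (disk_measure \<alpha>) f" if f: "f \<in> Ltwo (disk_measure \<alpha>)" for f
  proof -
    define u where "u z = indicator (ball 0 R) z * cmod (f z)" for z
    have f_meas: "f \<in> borel_measurable (lebesgue_on unit_disk)"
      using Ltwo_measurable[OF f] by (simp add: borel_measurable_disk_measure)
    have ball: "ball 0 R \<in> sets (lebesgue_on (unit_disk))"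
      using R by (auto simp: sets_restrict_space_iff)
    have u_meas: "u \<in> borel_measurable (lebesgue_on unit_disk)"
      unfolding u_def using f_meas ball by (intro borel_measurable_times borel_measurable_indicator) auto
    have int_w: "integrable (lebesgue_on unit_disk) (\<lambda>z. disk_weight \<alpha> z *\<^sub>R (cmod (f z))\<^sup>2)"
      using Ltwo_integrable[OF f] f_meas by (subst (asm) integrable_disk_measure[OF \<alpha>]) auto
    have u_le: "(u z)\<^sup>2 \<le> 1 / w * (disk_weight \<alpha> z *\<^sub>R (cmod (f z))\<^sup>2)" if "z \<in> unit_disk" for z
    proof (cases "z \<in> ball 0 R")
      case True
      then have "w * (cmod (f z))\<^sup>2 \<le> disk_weight \<alpha> z * (cmod (f z))\<^sup>2"
        unfolding w_def by (intro mult_right_mono z0(2)) auto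
      then show ?thesis using True w by (simp add: u_def field_simps)
    next
      case False
      then show ?thesis using w disk_weight_pos[OF \<alpha> that] by (simp add: u_def)
    qed
    have int_u2: "integrable (lebesgue_on unit_disk) (\<lambda>z. (u z)\<^sup>2)"
    proof (rule Bochner_Integration.integrable_bound)
      show "integrable (lebesgue_on unit_disk) (\<lambda>z. 1 / w * (disk_weight \<alpha> z *\<^sub>R (cmod (f z))\<^sup>2))"
        using int_w by (rule integrable_mult_right)
      have "norm ((u z)\<^sup>2) \<le> norm (1 / w * (disk_weight \<alpha> z *\<^sub>R (cmod (f z))\<^sup>2))"
        if "z \<in> unit_disk" for z
        unfolding real_norm_def abs_power2 by (rule order.trans[OF u_le[OF that] abs_ge_self])
      then show "AE z in lebesgue_on unit_disk.
          norm ((u z)\<^sup>2) \<le> norm (1 / w * (disk_weight \<alpha> z *\<^sub>R (cmod (f z))\<^sup>2))"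
        by (intro AE_I2) simp
    qed (use u_meas in auto)
    have int_u: "integrable (lebesgue_on unit_disk) u"
    proof (rule Bochner_Integration.integrable_bound)
      show "integrable (lebesgue_on unit_disk) (\<lambda>z. 1 + (u z)\<^sup>2)"
        using int_u2 by simp
      have "\<bar>x\<bar> \<le> 1 + x\<^sup>2" for x :: real
        using zero_le_power2[of "\<bar>x\<bar> - 1"] zero_le_power2[of x] unfolding power2_diff by simp
      then show "AE z in lebesgue_on unit_disk. norm (u z) \<le> norm (1 + (u z)\<^sup>2)"
        by (simp add: abs_of_nonneg)
    qed (use u_meas in auto)
    define A where "A = (LINT z|lebesgue_on unit_disk. u z)"
    have "A \<ge> 0" unfolding A_def u_def by (intro integral_nonneg_AE) auto
    \<comment> \<open>Cauchy-Schwarz as nonnegativity of the variance: A / P is the mean of u over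
      the disk of area P.\<close>
    have "0 \<le> (LINT z|lebesgue_on unit_disk. (u z - A / P)\<^sup>2)"
      by (intro integral_nonneg_AE) auto
    also have "\<dots> = (LINT z|lebesgue_on unit_disk. (u z)\<^sup>2 - 2 * (A / P) * u z + (A / P)\<^sup>2)"
      by (intro Bochner_Integration.integral_cong) (auto simp: power2_diff mult_ac)
    also have "\<dots> = (LINT z|lebesgue_on unit_disk. (u z)\<^sup>2) - 2 * (A / P) * A + (A / P)\<^sup>2 * P"
      using int_u int_u2 by (simp add: A_def P_def)
    also have "\<dots> = (LINT z|lebesgue_on unit_disk. (u z)\<^sup>2) - A\<^sup>2 / P"
      using P by (simp add: power2_eq_square field_simps)
    finally have "A\<^sup>2 \<le> P * (LINT z|lebesgue_on unit_disk. (u z)\<^sup>2)"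
      using P by (simp add: field_simps)
    also have "(LINT z|lebesgue_on unit_disk. (u z)\<^sup>2) \<le>
        (LINT z|lebesgue_on unit_disk. 1 / w * (disk_weight \<alpha> z *\<^sub>R (cmod (f z))\<^sup>2))"
      using int_u2 int_w u_le by (intro integral_mono integrable_mult_right) auto
    also have "\<dots> = 1 / w * (LINT z|disk_measure \<alpha>. (cmod (f z))\<^sup>2)"
      using f_meas by (subst integral_disk_measure[OF \<alpha>]) auto
    finally have "A\<^sup>2 \<le> P / w * (LINT z|disk_measure \<alpha>. (cmod (f z))\<^sup>2)"
      using P by (simp add: field_simps)
    then have "sqrt (A\<^sup>2) \<le> sqrt (P / w * (LINT z|disk_measure \<alpha>. (cmod (f z))\<^sup>2))"
      by (rule real_sqrt_le_mono)
    then show ?thesis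
      unfolding real_sqrt_mult using \<open>A \<ge> 0\<close> by (simp add: A_def u_def Ltwo_norm_def)
  qed
  then show ?thesis
    using P w by (intro exI[of _ "sqrt (P / w)"]) auto
qed

lemma Ltwo_polyanalytic_coefficient_bound:
  assumes \<alpha>: "\<alpha> > -1" and r: "0 \<le> r" "r < 1"
  shows "\<exists>C. \<forall>g. \<forall>f\<in>Ltwo (disk_measure \<alpha>). (\<forall>k<n. g k holomorphic_on unit_disk) \<longrightarrow>
      (\<forall>z\<in>unit_disk. f z = (\<Sum>k<n. cnj z ^ k * g k z)) \<longrightarrow>
      (\<forall>k<n. \<forall>w\<in>cball 0 r. cmod (g k w) \<le> C * Ltwo_norm (disk_measure \<alpha>) f)"
proof -
  obtain R where R: "r < R" "R < 1" using dense[OF r(2)] by blast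
  then have "0 < R" using r by simp
  from polyanalytic_coefficient_bound[OF r(1) R, of n] obtain C where
    C: "\<And>g f k w. \<forall>k<n. g k holomorphic_on unit_disk \<Longrightarrow>
      \<forall>z\<in>unit_disk. f z = (\<Sum>k<n. cnj z ^ k * g k z) \<Longrightarrow> k < n \<Longrightarrow> w \<in> cball 0 r \<Longrightarrow>
      cmod (g k w) \<le> C * (LINT z|lebesgue_on unit_disk. indicator (ball 0 R) z * cmod (f z))"
    by blast
  from Ltwo_ball_integral_bound[OF \<alpha> \<open>0 < R\<close> R(2)] obtain K where
    K: "K \<ge> 0" "\<And>f. f \<in> Ltwo (disk_measure \<alpha>) \<Longrightarrow>
      (LINT z|lebesgue_on unit_disk. indicator (ball 0 R) z * cmod (f z)) \<le> K * Ltwo_norm (disk_measure \<alpha>) f"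
    by blast
  have "cmod (g k w) \<le> (max 0 C * K) * Ltwo_norm (disk_measure \<alpha>) f"
    if "f \<in> Ltwo (disk_measure \<alpha>)" "\<forall>k<n. g k holomorphic_on unit_disk"
      "\<forall>z\<in>unit_disk. f z = (\<Sum>k<n. cnj z ^ k * g k z)" "k < n" "w \<in> cball 0 r" for g f k w
  proof -
    let ?I = "LINT z|lebesgue_on unit_disk. indicator (ball 0 R) z * cmod (f z)"
    have "?I \<ge> 0" by (intro integral_nonneg_AE) auto
    have "cmod (g k w) \<le> C * ?I" by (rule C[OF that(2-5)])
    also have "\<dots> \<le> max 0 C * ?I" using \<open>?I \<ge> 0\<close> by (intro mult_right_mono) auto
    also have "\<dots> \<le> max 0 C * (K * Ltwo_norm (disk_measure \<alpha>) f)"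
      by (intro mult_left_mono K that) auto
    finally show ?thesis by (simp add: mult_ac)
  qed
  then show ?thesis by blast
qed

section \<open>The polyanalytic Bergman space in terms of holomorphic coefficients\<close>

lemma n_analytic_on_cong:
  assumes "open S" "\<And>z. z \<in> S \<Longrightarrow> f z = g z"
  shows "n_analytic_on n S f \<longleftrightarrow> n_analytic_on n S g"
  unfolding n_analytic_on_def
  using smooth_on_cong[of S f g] wirtinger_zbar_funpow_cong_open[of S _ f g n] assms by auto

text \<open>Naming the coefficients reduces closure under sums, rotations and limits to the same
  facts for holomorphic functions.\<close>

definition polyanalytic_decomposition :: "nat \<Rightarrow> (nat \<Rightarrow> complex \<Rightarrow> complex) \<Rightarrow> (complex \<Rightarrow> complex) \<Rightarrow> bool" where
  "polyanalytic_decomposition n g f \<longleftrightarrow> (\<forall>k<n. g k holomorphic_on unit_disk) \<and>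
     (\<forall>z\<in>unit_disk. f z = (\<Sum>k<n. cnj z ^ k * g k z))"

lemma n_analytic_on_unit_disk_iff:
  "n_analytic_on n unit_disk f \<longleftrightarrow> (\<exists>g. polyanalytic_decomposition n g f)"
proof
  assume "n_analytic_on n unit_disk f"
  from n_analytic_on_decompose[OF open_ball this]
  show "\<exists>g. polyanalytic_decomposition n g f"
    unfolding polyanalytic_decomposition_def by blast
next
  assume "\<exists>g. polyanalytic_decomposition n g f"
  then obtain g where g: "polyanalytic_decomposition n g f" by blast
  then have "n_analytic_on n unit_disk (\<lambda>z. \<Sum>k<n. cnj z ^ k * g k z)"
    unfolding polyanalytic_decomposition_def by (intro n_analytic_on_polyanalytic_sum) auto
  then show "n_analytic_on n unit_disk f"
    using g unfolding polyanalytic_decomposition_def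
    by (subst n_analytic_on_cong[where g = "\<lambda>z. \<Sum>k<n. cnj z ^ k * g k z"]) auto
qed

lemma poly_bergman_iff:
  "f \<in> poly_bergman n \<alpha> \<longleftrightarrow> f \<in> Ltwo (disk_measure \<alpha>) \<and>
    (\<exists>g. polyanalytic_decomposition n g f) \<and> (\<forall>z. z \<notin> unit_disk \<longrightarrow> f z = 0)"
  by (auto simp: poly_bergman_def n_analytic_on_unit_disk_iff)

lemma poly_bergman_Ltwo: "f \<in> poly_bergman n \<alpha> \<Longrightarrow> f \<in> Ltwo (disk_measure \<alpha>)"
  by (simp add: poly_bergman_iff)

lemma poly_bergman_zero: "(\<lambda>z. 0) \<in> poly_bergman n \<alpha>"
  unfolding poly_bergman_iff polyanalytic_decomposition_def
  by (auto simp: Ltwo_def intro!: exI[of _ "\<lambda>k z. 0"])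

lemma poly_bergman_add:
  assumes "f \<in> poly_bergman n \<alpha>" "h \<in> poly_bergman n \<alpha>"
  shows "(\<lambda>z. f z + h z) \<in> poly_bergman n \<alpha>"
proof -
  obtain g g' where "polyanalytic_decomposition n g f" "polyanalytic_decomposition n g' h"
    using assms by (auto simp: poly_bergman_iff)
  then have "polyanalytic_decomposition n (\<lambda>k z. g k z + g' k z) (\<lambda>z. f z + h z)"
    by (auto simp: polyanalytic_decomposition_def sum.distrib distrib_left intro!: holomorphic_intros)
  with assms show ?thesis by (auto simp: poly_bergman_iff intro: Ltwo_add)
qed

lemma poly_bergman_scale:
  assumes "f \<in> poly_bergman n \<alpha>"
  shows "(\<lambda>z. c * f z) \<in> poly_bergman n \<alpha>"
proof -
  obtain g where "polyanalytic_decomposition n g f"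
    using assms by (auto simp: poly_bergman_iff)
  then have "polyanalytic_decomposition n (\<lambda>k z. c * g k z) (\<lambda>z. c * f z)"
    by (auto simp: polyanalytic_decomposition_def sum_distrib_left mult_ac intro!: holomorphic_intros)
  with assms show ?thesis by (auto simp: poly_bergman_iff intro: Ltwo_scale)
qed

lemma poly_bergman_diff:
  assumes "f \<in> poly_bergman n \<alpha>" "h \<in> poly_bergman n \<alpha>"
  shows "(\<lambda>z. f z - h z) \<in> poly_bergman n \<alpha>"
  using poly_bergman_add[OF assms(1) poly_bergman_scale[OF assms(2), of "-1"]] by simp

lemma polyanalytic_decomposition_diff:
  "polyanalytic_decomposition n g f \<Longrightarrow> polyanalytic_decomposition n g' h \<Longrightarrow>
    polyanalytic_decomposition n (\<lambda>k z. g k z - g' k z) (\<lambda>z. f z - h z)"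
  by (auto simp: polyanalytic_decomposition_def sum_subtractf right_diff_distrib intro!: holomorphic_intros)

lemma poly_bergman_coefficient_bound:
  assumes "\<alpha> > -1" "0 \<le> r" "r < 1"
  obtains C where "C \<ge> 0" "\<And>g f k w. f \<in> Ltwo (disk_measure \<alpha>) \<Longrightarrow> polyanalytic_decomposition n g f \<Longrightarrow>
    k < n \<Longrightarrow> w \<in> cball 0 r \<Longrightarrow> cmod (g k w) \<le> C * Ltwo_norm (disk_measure \<alpha>) f"
proof -
  obtain C where C: "\<And>g f k w. f \<in> Ltwo (disk_measure \<alpha>) \<Longrightarrow> polyanalytic_decomposition n g f \<Longrightarrow>
      k < n \<Longrightarrow> w \<in> cball 0 r \<Longrightarrow> cmod (g k w) \<le> C * Ltwo_norm (disk_measure \<alpha>) f"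
    using Ltwo_polyanalytic_coefficient_bound[OF assms, of n]
    unfolding polyanalytic_decomposition_def by blast
  show thesis
  proof (rule that[of "max 0 C"])
    fix g :: "nat \<Rightarrow> complex \<Rightarrow> complex"
      and f :: "complex \<Rightarrow> complex" and k and w :: complex
    assume "f \<in> Ltwo (disk_measure \<alpha>)" "polyanalytic_decomposition n g f" "k < n" "w \<in> cball 0 r"
    from C[OF this] have "cmod (g k w) \<le> C * Ltwo_norm (disk_measure \<alpha>) f" .
    also have "\<dots> \<le> max 0 C * Ltwo_norm (disk_measure \<alpha>) f"
      by (intro mult_right_mono) (auto simp: Ltwo_norm_def)
    finally show "cmod (g k w) \<le> max 0 C * Ltwo_norm (disk_measure \<alpha>) f" .
  qed simp
qed

text \<open>The coefficient bound makes every \<open>g k\<close> vanish at every point of the disk,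
  and outside the disk members are 0 by convention. This pointwise conclusion is what makes the
  projection single-valued.\<close>

lemma poly_bergman_eq_zero:
  assumes "\<alpha> > -1" "f \<in> poly_bergman n \<alpha>" "Ltwo_norm (disk_measure \<alpha>) f = 0"
  shows "f = (\<lambda>z. 0)"
proof
  fix z
  show "f z = 0"
  proof (cases "z \<in> unit_disk")
    case True
    obtain g where g: "polyanalytic_decomposition n g f"
      using assms(2) by (auto simp: poly_bergman_iff)
    have "cmod z < 1" using True by simp
    obtain C where C: "C \<ge> 0" "\<And>g f k w. f \<in> Ltwo (disk_measure \<alpha>) \<Longrightarrow>
        polyanalytic_decomposition n g f \<Longrightarrow> k < n \<Longrightarrow> w \<in> cball 0 (cmod z) \<Longrightarrow>
        cmod (g k w) \<le> C * Ltwo_norm (disk_measure \<alpha>) f"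
      by (rule poly_bergman_coefficient_bound[OF assms(1) norm_ge_zero \<open>cmod z < 1\<close>, of n]) blast
    have "g k z = 0" if "k < n" for k
      using C(2)[OF poly_bergman_Ltwo[OF assms(2)] g that, of z] assms(3) by simp
    then show ?thesis
      using g True by (simp add: polyanalytic_decomposition_def)
  qed (use assms(2) in \<open>auto simp: poly_bergman_iff\<close>)
qed

text \<open>An \<open>L\<^sup>2\<close>-Cauchy sequence has locally uniformly convergent coefficient functions, so the limit
  is polyanalytic; \<open>L\<^sup>2\<close>-convergence to it comes from Fatou's lemma, without Riesz--Fischer.\<close>

lemma poly_bergman_complete:
  assumes \<alpha>: "\<alpha> > -1" and h: "\<And>m. h m \<in> poly_bergman n \<alpha>"
    and cauchy: "\<And>e. e > 0 \<Longrightarrow>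
      \<exists>N. \<forall>i\<ge>N. \<forall>j\<ge>N. (LINT z|disk_measure \<alpha>. (cmod (h i z - h j z))\<^sup>2) < e"
  shows "\<exists>f\<in>poly_bergman n \<alpha>. (\<lambda>m::nat. LINT z|disk_measure \<alpha>. (cmod (h m z - f z))\<^sup>2) \<longlonglongrightarrow> 0"
proof -
  have "\<forall>m. \<exists>g. polyanalytic_decomposition n g (h m)"
    using h by (auto simp: poly_bergman_iff)
  from choice[OF this] obtain g where g: "\<And>m. polyanalytic_decomposition n (g m) (h m)"
    by blast
  define \<gamma> where "\<gamma> k w = lim (\<lambda>m. g m k w)" for k w
  have ulim: "uniform_limit (cball 0 r) (\<lambda>m. g m k) (\<gamma> k) sequentially"
    if k: "k < n" and r: "0 \<le> r" "r < 1" for k r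
  proof -
    obtain C where C: "C \<ge> 0" "\<And>g f k w. f \<in> Ltwo (disk_measure \<alpha>) \<Longrightarrow>
        polyanalytic_decomposition n g f \<Longrightarrow> k < n \<Longrightarrow> w \<in> cball 0 r \<Longrightarrow>
        cmod (g k w) \<le> C * Ltwo_norm (disk_measure \<alpha>) f"
      by (rule poly_bergman_coefficient_bound[OF \<alpha> r, of n]) blast
    have "uniformly_Cauchy_on (cball 0 r) (\<lambda>m. g m k)"
      unfolding uniformly_Cauchy_on_def
    proof (intro allI impI)
      fix e :: real assume e: "e > 0"
      \<comment> \<open>Chosen so that C * sqrt d = C * e / (C + 1), which is below e for every C
        \<ge> 0, also for C = 0.\<close>
      define d where "d = (e / (C + 1))\<^sup>2"
      have "d > 0" using e C(1) by (simp add: d_def)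
      then obtain N where N: "\<forall>i\<ge>N. \<forall>j\<ge>N. (LINT z|disk_measure \<alpha>. (cmod (h i z - h j z))\<^sup>2) < d"
        using cauchy by blast
      have "dist (g i k w) (g j k w) < e" if "w \<in> cball 0 r" "i \<ge> N" "j \<ge> N" for w i j
      proof -
        have "cmod (g i k w - g j k w) \<le> C * Ltwo_norm (disk_measure \<alpha>) (\<lambda>z. h i z - h j z)"
          using C(2)[OF _ polyanalytic_decomposition_diff[OF g[of i] g[of j]] k that(1)]
          by (simp add: Ltwo_diff poly_bergman_Ltwo[OF h])
        also have "Ltwo_norm (disk_measure \<alpha>) (\<lambda>z. h i z - h j z) \<le> sqrt d"
          unfolding Ltwo_norm_def using N that by (intro real_sqrt_le_mono less_imp_le) blast
        also have "sqrt d = e / (C + 1)"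
          using e C(1) by (simp add: d_def)
        also have "C * (e / (C + 1)) < e"
          using e C(1) by (simp add: field_simps)
        finally show ?thesis
          using C(1) by (simp add: dist_norm mult_left_mono)
      qed
      then show "\<exists>N. \<forall>w\<in>cball 0 r. \<forall>i\<ge>N. \<forall>j\<ge>N. dist (g i k w) (g j k w) < e" by blast
    qed
    then have "uniformly_convergent_on (cball 0 r) (\<lambda>m. g m k)"
      by (rule Cauchy_uniformly_convergent)
    then show ?thesis
      by (simp add: uniformly_convergent_uniform_limit_iff \<gamma>_def[abs_def])
  qed
  have hol: "\<gamma> k holomorphic_on unit_disk" if k: "k < n" for k
  proof (rule holomorphic_uniform_sequence[OF open_ball])
    show "g m k holomorphic_on unit_disk" for m
      using g k by (auto simp: polyanalytic_decomposition_def)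
    fix z :: complex assume z: "z \<in> unit_disk"
    \<comment> \<open>Half the distance to the circle: the closed ball around z then lies in a
      closed ball around 0 of radius below 1, where uniform convergence is known.\<close>
    define d where "d = (1 - cmod z) / 2"
    have d: "d > 0" "cball z d \<subseteq> cball 0 (cmod z + d)" "cmod z + d < 1"
      using z by (auto simp: d_def field_simps dist_norm cball_subset_cball_iff)
    then have "uniform_limit (cball z d) (\<lambda>m. g m k) (\<gamma> k) sequentially"
      using uniform_limit_on_subset[OF ulim[OF k, of "cmod z + d"]] by simp
    moreover have "cball z d \<subseteq> unit_disk"
      using d(3) by (intro order.trans[OF d(2)]) auto
    ultimately show "\<exists>d>0. cball z d \<subseteq> unit_disk \<and> uniform_limit (cball z d) (\<lambda>m. g m k) (\<gamma> k) sequentially"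
      using d by blast
  qed
  define f where "f z = (if z \<in> unit_disk then \<Sum>k<n. cnj z ^ k * \<gamma> k z else 0)" for z
  have f: "polyanalytic_decomposition n \<gamma> f"
    using hol by (auto simp: polyanalytic_decomposition_def f_def)
  have lim: "(\<lambda>m. h m z) \<longlonglongrightarrow> f z" if "z \<in> space (disk_measure \<alpha>)" for z
  proof -
    have z: "z \<in> unit_disk" using that by simp
    have "(\<lambda>m. g m k z) \<longlonglongrightarrow> \<gamma> k z" if "k < n" for k
      using z by (intro tendsto_uniform_limitI[OF ulim[OF that, of "cmod z"]]) auto
    then have "(\<lambda>m. \<Sum>k<n. cnj z ^ k * g m k z) \<longlonglongrightarrow> (\<Sum>k<n. cnj z ^ k * \<gamma> k z)"
      by (intro tendsto_intros) auto
    then show ?thesis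
      using z g by (simp add: polyanalytic_decomposition_def f_def)
  qed
  note L = Ltwo_limit[OF poly_bergman_Ltwo[OF h] cauchy lim]
  have "\<forall>z. z \<notin> unit_disk \<longrightarrow> f z = 0" by (simp add: f_def)
  then have "f \<in> poly_bergman n \<alpha>"
    unfolding poly_bergman_iff using L(1) f by blast
  with L(2) show ?thesis by blast
qed

section \<open>The orthogonal projection onto the space\<close>

lemma poly_bergman_proj_unique:
  assumes \<alpha>: "\<alpha> > -1" and f: "f \<in> Ltwo (disk_measure \<alpha>)"
    and h: "h \<in> poly_bergman n \<alpha>" "\<And>u. u \<in> poly_bergman n \<alpha> \<Longrightarrow>
      Ltwo_inner (disk_measure \<alpha>) (\<lambda>z. f z - h z) u = 0"
    and h': "h' \<in> poly_bergman n \<alpha>" "\<And>u. u \<in> poly_bergman n \<alpha> \<Longrightarrow>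
      Ltwo_inner (disk_measure \<alpha>) (\<lambda>z. f z - h' z) u = 0"
  shows "h = h'"
proof -
  define d where "d = (\<lambda>z. h z - h' z)"
  have d: "d \<in> poly_bergman n \<alpha>"
    unfolding d_def by (rule poly_bergman_diff[OF h(1) h'(1)])
  note L = poly_bergman_Ltwo[OF h(1)] poly_bergman_Ltwo[OF h'(1)] poly_bergman_Ltwo[OF d]
  have "Ltwo_inner (disk_measure \<alpha>) d d =
      Ltwo_inner (disk_measure \<alpha>) h d - Ltwo_inner (disk_measure \<alpha>) h' d"
    using Ltwo_inner_diff_left[OF L] by (simp add: d_def)
  also have "\<dots> =
      Ltwo_inner (disk_measure \<alpha>) (\<lambda>z. f z - h' z) d - Ltwo_inner (disk_measure \<alpha>) (\<lambda>z. f z - h z) d"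
    using f L by (simp add: Ltwo_inner_diff_left)
  also have "\<dots> = 0" using h(2) h'(2) d by simp
  finally have "Ltwo_norm (disk_measure \<alpha>) d = 0"
    by (simp add: Ltwo_inner_self Ltwo_norm_def)
  then have "d = (\<lambda>z. 0)" by (rule poly_bergman_eq_zero[OF \<alpha> d])
  then show ?thesis by (simp add: d_def fun_eq_iff)
qed

lemma poly_bergman_proj:
  assumes \<alpha>: "\<alpha> > -1" and f: "f \<in> Ltwo (disk_measure \<alpha>)"
  shows poly_bergman_proj_mem: "poly_bergman_proj n \<alpha> f \<in> poly_bergman n \<alpha>"
    and poly_bergman_proj_orthogonal: "\<And>u. u \<in> poly_bergman n \<alpha> \<Longrightarrow>
      Ltwo_inner (disk_measure \<alpha>) (\<lambda>z. f z - poly_bergman_proj n \<alpha> f z) u = 0"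
proof -
  let ?P = "\<lambda>h. h \<in> poly_bergman n \<alpha> \<and>
    (\<forall>u\<in>poly_bergman n \<alpha>. Ltwo_inner (disk_measure \<alpha>) (\<lambda>z. f z - h z) u = 0)"
  have "\<exists>h\<in>poly_bergman n \<alpha>. \<forall>u\<in>poly_bergman n \<alpha>. Ltwo_inner (disk_measure \<alpha>) (\<lambda>z. f z - h z) u = 0"
  proof (rule Ltwo_projection_exists)
    show "poly_bergman n \<alpha> \<subseteq> Ltwo (disk_measure \<alpha>)" using poly_bergman_Ltwo by blast
    show "poly_bergman n \<alpha> \<noteq> {}" using poly_bergman_zero by blast
  qed (use poly_bergman_add poly_bergman_scale poly_bergman_complete[OF \<alpha>] f in blast)+
  then obtain h where h: "?P h" by blast
  have "?P (poly_bergman_proj n \<alpha> f)"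
    unfolding poly_bergman_proj_def
  proof (rule theI[of ?P, OF h])
    fix h' assume "?P h'"
    with h show "h' = h" using poly_bergman_proj_unique[OF \<alpha> f, of h' n h] by blast
  qed
  then show "poly_bergman_proj n \<alpha> f \<in> poly_bergman n \<alpha>"
    "\<And>u. u \<in> poly_bergman n \<alpha> \<Longrightarrow>
      Ltwo_inner (disk_measure \<alpha>) (\<lambda>z. f z - poly_bergman_proj n \<alpha> f z) u = 0"
    by blast+
qed

section \<open>Toeplitz operators with radial symbols\<close>

lemma integrable_rotate_unit_disk:
  fixes F :: "complex \<Rightarrow> 'b::{banach, second_countable_topology}"
  assumes "cmod \<tau> = 1" and F: "integrable (lebesgue_on unit_disk) F"
  shows "integrable (lebesgue_on unit_disk) (\<lambda>z. F (\<tau> * z))"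
proof -
  define G where "G = (\<lambda>z. indicator unit_disk z *\<^sub>R F z)"
  have G: "integrable lebesgue G"
    using F unfolding G_def by (subst (asm) integrable_restrict_space) auto
  have eq: "indicator unit_disk z *\<^sub>R F (\<tau> * z) = G (\<tau> * z)" for z
    by (auto simp: G_def indicator_def norm_mult assms(1))
  have "integrable (distr lebesgue lebesgue ((*) \<tau>)) G"
    using G by (simp only: lebesgue_distr_unimodular_mult[OF assms(1)])
  then have "integrable lebesgue (\<lambda>z. G (\<tau> * z))"
    by (rule integrable_distr[OF measurable_unimodular_mult[OF assms(1)]])
  then show ?thesis
    by (subst integrable_restrict_space) (auto simp: eq)
qed

lemma borel_measurable_rotate_unit_disk:
  assumes "cmod \<tau> = 1" "F \<in> borel_measurable (lebesgue_on unit_disk)"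
  shows "(\<lambda>z. F (\<tau> * z)) \<in> borel_measurable (lebesgue_on unit_disk)"
proof (rule measurable_compose[OF _ assms(2)])
  show "(*) \<tau> \<in> lebesgue_on unit_disk \<rightarrow>\<^sub>M lebesgue_on unit_disk"
    by (rule measurable_restrict_space3[OF measurable_unimodular_mult[OF assms(1)]])
      (auto simp: norm_mult assms(1))
qed

lemma disk_weight_rotate: "cmod \<tau> = 1 \<Longrightarrow> disk_weight \<alpha> (\<tau> * z) = disk_weight \<alpha> z"
  by (simp add: disk_weight_def norm_mult)

lemma
  fixes F :: "complex \<Rightarrow> 'b::{banach, second_countable_topology}"
  assumes \<alpha>: "\<alpha> > -1" and \<tau>: "cmod \<tau> = 1" and F: "F \<in> borel_measurable (disk_measure \<alpha>)"
  shows integral_rotate_disk_measure: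
      "(LINT z|disk_measure \<alpha>. F (\<tau> * z)) = (LINT z|disk_measure \<alpha>. F z)"
    and integrable_rotate_disk_measure:
      "integrable (disk_measure \<alpha>) F \<Longrightarrow> integrable (disk_measure \<alpha>) (\<lambda>z. F (\<tau> * z))"
proof -
  have F': "F \<in> borel_measurable (lebesgue_on unit_disk)"
    using F by (simp add: borel_measurable_disk_measure)
  have G: "(\<lambda>z. disk_weight \<alpha> z *\<^sub>R F z) \<in> borel_measurable (lebesgue_on unit_disk)"
    by (intro borel_measurable_scaleR borel_measurable_disk_weight F')
  show "(LINT z|disk_measure \<alpha>. F (\<tau> * z)) = (LINT z|disk_measure \<alpha>. F z)"
    using integral_rotate_unit_disk[OF \<tau> G]
    by (simp add: integral_disk_measure[OF \<alpha>] F' borel_measurable_rotate_unit_disk[OF \<tau>] disk_weight_rotate[OF \<tau>])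
  show "integrable (disk_measure \<alpha>) (\<lambda>z. F (\<tau> * z))" if "integrable (disk_measure \<alpha>) F"
    using that integrable_rotate_unit_disk[OF \<tau>, of "\<lambda>z. disk_weight \<alpha> z *\<^sub>R F z"]
    by (simp add: integrable_disk_measure[OF \<alpha>] F' borel_measurable_rotate_unit_disk[OF \<tau>] disk_weight_rotate[OF \<tau>])
qed

lemma Ltwo_rotate:
  assumes "\<alpha> > -1" "cmod \<tau> = 1" "f \<in> Ltwo (disk_measure \<alpha>)"
  shows "(\<lambda>z. f (\<tau> * z)) \<in> Ltwo (disk_measure \<alpha>)"
proof -
  have "f \<in> borel_measurable (disk_measure \<alpha>)" by (rule Ltwo_measurable[OF assms(3)])
  moreover from this have "(\<lambda>z. f (\<tau> * z)) \<in> borel_measurable (disk_measure \<alpha>)"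
    using borel_measurable_rotate_unit_disk[OF assms(2)] by (simp add: borel_measurable_disk_measure)
  ultimately show ?thesis
    using integrable_rotate_disk_measure[OF assms(1,2), of "\<lambda>z. (cmod (f z))\<^sup>2"] assms(3)
    by (simp add: Ltwo_def)
qed

lemma Ltwo_inner_rotate:
  assumes "\<alpha> > -1" "cmod \<tau> = 1" "f \<in> Ltwo (disk_measure \<alpha>)" "g \<in> Ltwo (disk_measure \<alpha>)"
  shows "Ltwo_inner (disk_measure \<alpha>) (\<lambda>z. f (\<tau> * z)) (\<lambda>z. g (\<tau> * z)) =
    Ltwo_inner (disk_measure \<alpha>) f g"
  unfolding Ltwo_inner_def
  by (rule integral_rotate_disk_measure[OF assms(1,2)
        borel_measurable_integrable[OF Ltwo_integrable_mult_cnj[OF assms(3,4)]]])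

lemma poly_bergman_rotate:
  assumes "\<alpha> > -1" "cmod \<tau> = 1" "f \<in> poly_bergman n \<alpha>"
  shows "(\<lambda>z. f (\<tau> * z)) \<in> poly_bergman n \<alpha>"
proof -
  obtain g where g: "polyanalytic_decomposition n g f"
    using assms(3) by (auto simp: poly_bergman_iff)
  have "(\<lambda>z. g k (\<tau> * z)) holomorphic_on unit_disk" if "k < n" for k
    using g that assms(2)
    by (intro holomorphic_on_compose_gen[of "(*) \<tau>" unit_disk "g k" unit_disk, unfolded comp_def]
        holomorphic_intros) (auto simp: polyanalytic_decomposition_def norm_mult)
  then have "polyanalytic_decomposition n (\<lambda>k z. cnj \<tau> ^ k * g k (\<tau> * z)) (\<lambda>z. f (\<tau> * z))"
    using g assms(2)
    by (auto simp: polyanalytic_decomposition_def norm_mult power_mult_distrib mult_ac intro!: holomorphic_intros)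
  then show ?thesis
    using assms Ltwo_rotate[of \<alpha> \<tau> f] by (auto simp: poly_bergman_iff norm_mult)
qed

section \<open>Multiplication by a bounded symbol followed by projection\<close>

lemma LinftyE:
  assumes "g \<in> Linfty M"
  obtains C where "C \<ge> 0" "AE x in M. cmod (g x) \<le> C"
proof -
  obtain C where "AE x in M. cmod (g x) \<le> C" using assms by (auto simp: Linfty_def)
  then have "AE x in M. cmod (g x) \<le> max 0 C" by eventually_elim auto
  then show thesis by (intro that[of "max 0 C"]) auto
qed

lemma
  assumes g: "g \<in> borel_measurable M" "AE x in M. cmod (g x) \<le> C" and f: "f \<in> Ltwo M"
  shows Ltwo_mult_bounded: "(\<lambda>x. g x * f x) \<in> Ltwo M"
    and integral_cmod_mult_bounded_le:
      "(LINT x|M. (cmod (g x * f x))\<^sup>2) \<le> C\<^sup>2 * (LINT x|M. (cmod (f x))\<^sup>2)"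
proof -
  note [measurable] = g(1) Ltwo_measurable[OF f]
  have le: "AE x in M. (cmod (g x * f x))\<^sup>2 \<le> C\<^sup>2 * (cmod (f x))\<^sup>2"
    using g(2) by eventually_elim (auto simp: norm_mult power_mult_distrib intro!: mult_right_mono power_mono)
  have int: "integrable M (\<lambda>x. C\<^sup>2 * (cmod (f x))\<^sup>2)"
    using Ltwo_integrable[OF f] by (rule integrable_mult_right)
  have int': "integrable M (\<lambda>x. (cmod (g x * f x))\<^sup>2)"
  proof (rule Bochner_Integration.integrable_bound[OF int])
    show "AE x in M. norm ((cmod (g x * f x))\<^sup>2) \<le> norm (C\<^sup>2 * (cmod (f x))\<^sup>2)"
      using le by eventually_elim simp
  qed measurable
  then show "(\<lambda>x. g x * f x) \<in> Ltwo M" by (simp add: Ltwo_def)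
  have "(LINT x|M. (cmod (g x * f x))\<^sup>2) \<le> (LINT x|M. C\<^sup>2 * (cmod (f x))\<^sup>2)"
    by (rule integral_mono_AE[OF int' int le])
  then show "(LINT x|M. (cmod (g x * f x))\<^sup>2) \<le> C\<^sup>2 * (LINT x|M. (cmod (f x))\<^sup>2)"
    by simp
qed

lemma Ltwo_mult_Linfty: "g \<in> Linfty M \<Longrightarrow> f \<in> Ltwo M \<Longrightarrow> (\<lambda>x. g x * f x) \<in> Ltwo M"
  by (auto simp: Linfty_def intro: Ltwo_mult_bounded)

lemma poly_bergman_proj_eqI:
  assumes "\<alpha> > -1" "f \<in> Ltwo (disk_measure \<alpha>)" "h \<in> poly_bergman n \<alpha>"
    "\<And>u. u \<in> poly_bergman n \<alpha> \<Longrightarrow> Ltwo_inner (disk_measure \<alpha>) (\<lambda>z. f z - h z) u = 0"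
  shows "poly_bergman_proj n \<alpha> f = h"
  using assms poly_bergman_proj_mem poly_bergman_proj_orthogonal
  by (intro poly_bergman_proj_unique[of \<alpha> f]) auto

text \<open>The error f - h is orthogonal to h, so <f, h> is the squared norm of h, and the squared
  norm of f - h becomes the difference of the two sides.\<close>

lemma integral_poly_bergman_proj_le:
  assumes "\<alpha> > -1" "f \<in> Ltwo (disk_measure \<alpha>)"
  shows "(LINT z|disk_measure \<alpha>. (cmod (poly_bergman_proj n \<alpha> f z))\<^sup>2) \<le>
    (LINT z|disk_measure \<alpha>. (cmod (f z))\<^sup>2)"
proof -
  define h where "h = poly_bergman_proj n \<alpha> f"
  have h: "h \<in> poly_bergman n \<alpha>" unfolding h_def by (rule poly_bergman_proj_mem[OF assms])
  note hL = poly_bergman_Ltwo[OF h]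
  have "Ltwo_inner (disk_measure \<alpha>) f h = Ltwo_inner (disk_measure \<alpha>) h h"
    using poly_bergman_proj_orthogonal[OF assms h] Ltwo_inner_diff_left[OF assms(2) hL hL]
    by (simp add: h_def)
  then have "Re (Ltwo_inner (disk_measure \<alpha>) f h) = (LINT z|disk_measure \<alpha>. (cmod (h z))\<^sup>2)"
    by (simp add: Ltwo_inner_self del: of_real_power)
  moreover have "0 \<le> (LINT z|disk_measure \<alpha>. (cmod (f z - h z))\<^sup>2)"
    by simp
  ultimately show ?thesis
    using integral_cmod_diff_square[OF assms(2) hL] unfolding h_def[symmetric] by linarith
qed

text \<open>Linearity is uniqueness of the projection: sums and multiples of projections satisfy the
  defining orthogonality relations. The bound combines contractivity of the projection with the
  essential bound of the symbol.\<close>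

lemma toeplitz_bounded_operator:
  assumes \<alpha>: "\<alpha> > -1" and g: "g \<in> Linfty (disk_measure \<alpha>)"
  shows "toeplitz n \<alpha> g \<in> bounded_operators n \<alpha>"
proof -
  have T: "toeplitz n \<alpha> g f = poly_bergman_proj n \<alpha> (\<lambda>z. g z * f z)" if "f \<in> poly_bergman n \<alpha>" for f
    using that by (simp add: toeplitz_def)
  have gf: "(\<lambda>z. g z * f z) \<in> Ltwo (disk_measure \<alpha>)" if "f \<in> poly_bergman n \<alpha>" for f
    using that by (intro Ltwo_mult_Linfty g poly_bergman_Ltwo)
  have diff: "(\<lambda>z. g z * f z - poly_bergman_proj n \<alpha> (\<lambda>z. g z * f z) z) \<in> Ltwo (disk_measure \<alpha>)"
    if "f \<in> poly_bergman n \<alpha>" for f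
    by (intro Ltwo_diff gf that poly_bergman_Ltwo[OF poly_bergman_proj_mem[OF \<alpha>]])
  have add: "toeplitz n \<alpha> g (\<lambda>z. f z + h z) = (\<lambda>z. toeplitz n \<alpha> g f z + toeplitz n \<alpha> g h z)"
    if f: "f \<in> poly_bergman n \<alpha>" and h: "h \<in> poly_bergman n \<alpha>" for f h
    unfolding T[OF f] T[OF h] T[OF poly_bergman_add[OF f h]]
  proof (rule poly_bergman_proj_eqI[OF \<alpha> gf[OF poly_bergman_add[OF f h]]])
    let ?F = "\<lambda>z. g z * f z" and ?H = "\<lambda>z. g z * h z"
    show "(\<lambda>z. poly_bergman_proj n \<alpha> ?F z + poly_bergman_proj n \<alpha> ?H z) \<in> poly_bergman n \<alpha>"
      by (intro poly_bergman_add poly_bergman_proj_mem \<alpha> gf f h)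
    fix u assume u: "u \<in> poly_bergman n \<alpha>"
    have "Ltwo_inner (disk_measure \<alpha>) (\<lambda>z. (?F z - poly_bergman_proj n \<alpha> ?F z) +
        (?H z - poly_bergman_proj n \<alpha> ?H z)) u = 0"
      unfolding Ltwo_inner_add_left[OF diff[OF f] diff[OF h] poly_bergman_Ltwo[OF u]]
      by (simp add: poly_bergman_proj_orthogonal[OF \<alpha> gf[OF f] u] poly_bergman_proj_orthogonal[OF \<alpha> gf[OF h] u])
    then show "Ltwo_inner (disk_measure \<alpha>) (\<lambda>z. g z * (f z + h z) -
        (poly_bergman_proj n \<alpha> ?F z + poly_bergman_proj n \<alpha> ?H z)) u = 0"
      by (simp add: algebra_simps)
  qed
  have scale: "toeplitz n \<alpha> g (\<lambda>z. c * f z) = (\<lambda>z. c * toeplitz n \<alpha> g f z)"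
    if f: "f \<in> poly_bergman n \<alpha>" for f c
    unfolding T[OF f] T[OF poly_bergman_scale[OF f]]
  proof (rule poly_bergman_proj_eqI[OF \<alpha> gf[OF poly_bergman_scale[OF f]]])
    let ?F = "\<lambda>z. g z * f z"
    show "(\<lambda>z. c * poly_bergman_proj n \<alpha> ?F z) \<in> poly_bergman n \<alpha>"
      by (intro poly_bergman_scale poly_bergman_proj_mem \<alpha> gf f)
    fix u assume u: "u \<in> poly_bergman n \<alpha>"
    have "Ltwo_inner (disk_measure \<alpha>) (\<lambda>z. c * (?F z - poly_bergman_proj n \<alpha> ?F z)) u = 0"
      using poly_bergman_proj_orthogonal[OF \<alpha> gf[OF f] u] by (simp add: Ltwo_inner_scale_left)
    then show "Ltwo_inner (disk_measure \<alpha>) (\<lambda>z. g z * (c * f z) - c * poly_bergman_proj n \<alpha> ?F z) u = 0"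
      by (simp add: algebra_simps)
  qed
  obtain C where C: "C \<ge> 0" "AE z in disk_measure \<alpha>. cmod (g z) \<le> C"
    using g by (rule LinftyE)
  have bound: "Ltwo_norm (disk_measure \<alpha>) (toeplitz n \<alpha> g f) \<le> C * Ltwo_norm (disk_measure \<alpha>) f"
    if f: "f \<in> poly_bergman n \<alpha>" for f
  proof -
    have "(LINT z|disk_measure \<alpha>. (cmod (toeplitz n \<alpha> g f z))\<^sup>2) \<le>
        (LINT z|disk_measure \<alpha>. (cmod (g z * f z))\<^sup>2)"
      unfolding T[OF f] by (rule integral_poly_bergman_proj_le[OF \<alpha> gf[OF f]])
    also have "\<dots> \<le> C\<^sup>2 * (LINT z|disk_measure \<alpha>. (cmod (f z))\<^sup>2)"
      using g C poly_bergman_Ltwo[OF f] by (intro integral_cmod_mult_bounded_le) (auto simp: Linfty_def)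
    finally have "sqrt (LINT z|disk_measure \<alpha>. (cmod (toeplitz n \<alpha> g f z))\<^sup>2) \<le>
        sqrt (C\<^sup>2 * (LINT z|disk_measure \<alpha>. (cmod (f z))\<^sup>2))"
      by (rule real_sqrt_le_mono)
    then show ?thesis
      unfolding Ltwo_norm_def real_sqrt_mult using C(1) by simp
  qed
  have "toeplitz n \<alpha> g \<in> poly_bergman n \<alpha> \<rightarrow>\<^sub>E poly_bergman n \<alpha>"
    unfolding toeplitz_def by (intro restrict_PiE_iff[THEN iffD2] ballI poly_bergman_proj_mem \<alpha> gf)
  with add scale bound show ?thesis
    unfolding bounded_operators_def by blast
qed

lemma toeplitz_radial_commutes_rotation:
  assumes \<alpha>: "\<alpha> > -1" and g: "g \<in> Linfty (disk_measure \<alpha>)"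
    and radial: "\<And>\<tau> z. cmod \<tau> = 1 \<Longrightarrow> g (\<tau> * z) = g z"
    and \<tau>: "cmod \<tau> = 1" and f: "f \<in> poly_bergman n \<alpha>"
  shows "toeplitz n \<alpha> g (rotation \<tau> f) = rotation \<tau> (toeplitz n \<alpha> g f)"
proof -
  define \<sigma> where "\<sigma> = inverse \<tau>"
  have \<sigma>: "cmod \<sigma> = 1" using \<tau> by (simp add: \<sigma>_def norm_inverse)
  have "\<tau> \<noteq> 0" using \<tau> by auto
  then have \<sigma>\<tau>: "\<sigma> * (\<tau> * z) = z" "\<tau> * (\<sigma> * z) = z" for z
    by (simp_all add: \<sigma>_def)
  define h where "h = poly_bergman_proj n \<alpha> (\<lambda>z. g z * f z)"
  have rf: "(\<lambda>z. f (\<sigma> * z)) \<in> poly_bergman n \<alpha>"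
    by (rule poly_bergman_rotate[OF \<alpha> \<sigma> f])
  have gf: "(\<lambda>z. g z * f z) \<in> Ltwo (disk_measure \<alpha>)"
    using f by (intro Ltwo_mult_Linfty g poly_bergman_Ltwo)
  have h: "h \<in> poly_bergman n \<alpha>"
    unfolding h_def by (rule poly_bergman_proj_mem[OF \<alpha> gf])
  have "poly_bergman_proj n \<alpha> (\<lambda>z. g z * f (\<sigma> * z)) = (\<lambda>z. h (\<sigma> * z))"
  proof (rule poly_bergman_proj_eqI[OF \<alpha>])
    show "(\<lambda>z. g z * f (\<sigma> * z)) \<in> Ltwo (disk_measure \<alpha>)"
      by (intro Ltwo_mult_Linfty g poly_bergman_Ltwo[OF rf])
    show "(\<lambda>z. h (\<sigma> * z)) \<in> poly_bergman n \<alpha>"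
      by (rule poly_bergman_rotate[OF \<alpha> \<sigma> h])
    fix u assume u: "u \<in> poly_bergman n \<alpha>"
    \<comment> \<open>The test function rotated back. Error and test function then carry the same
      rotation, and the inner product is invariant under it.\<close>
    define v where "v = (\<lambda>z. u (\<tau> * z))"
    have v: "v \<in> poly_bergman n \<alpha>"
      unfolding v_def by (rule poly_bergman_rotate[OF \<alpha> \<tau> u])
    define d where "d = (\<lambda>z. g z * f z - h z)"
    have d: "d \<in> Ltwo (disk_measure \<alpha>)"
      unfolding d_def by (rule Ltwo_diff[OF gf poly_bergman_Ltwo[OF h]])
    have "Ltwo_inner (disk_measure \<alpha>) (\<lambda>z. g z * f (\<sigma> * z) - h (\<sigma> * z)) u =
        Ltwo_inner (disk_measure \<alpha>) (\<lambda>z. d (\<sigma> * z)) (\<lambda>z. v (\<sigma> * z))"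
      by (simp add: d_def v_def \<sigma>\<tau> radial[OF \<sigma>])
    also have "\<dots> = Ltwo_inner (disk_measure \<alpha>) d v"
      by (rule Ltwo_inner_rotate[OF \<alpha> \<sigma> d poly_bergman_Ltwo[OF v]])
    also have "\<dots> = 0"
      unfolding d_def h_def by (rule poly_bergman_proj_orthogonal[OF \<alpha> gf v])
    finally show "Ltwo_inner (disk_measure \<alpha>) (\<lambda>z. g z * f (\<sigma> * z) - h (\<sigma> * z)) u = 0" .
  qed
  then show ?thesis
    using f rf by (simp add: toeplitz_def rotation_def \<sigma>_def[symmetric] h_def)
qed

section \<open>Radial symbols are essentially bounded on the disk\<close>

lemma negligible_vimage_sqrt:
  assumes "negligible N"
  shows "negligible (sqrt -` N)"
proof (rule negligible_subset)
  have "negligible ((\<lambda>x::real. x\<^sup>2) ` N)" "negligible ((\<lambda>x::real. - x\<^sup>2) ` N)"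
    using assms
    by (auto intro!: negligible_differentiable_image_negligible simp: differentiable_on_def)
  then show "negligible ((\<lambda>x::real. x\<^sup>2) ` N \<union> (\<lambda>x. - x\<^sup>2) ` N)"
    by (rule negligible_Un)
  \<comment> \<open>\<open>sqrt\<close> is an odd function on the whole line, so negative t need the
    second image, under - x^2.\<close>
  show "sqrt -` N \<subseteq> (\<lambda>x::real. x\<^sup>2) ` N \<union> (\<lambda>x. - x\<^sup>2) ` N"
  proof
    fix t assume t: "t \<in> sqrt -` N"
    show "t \<in> (\<lambda>x::real. x\<^sup>2) ` N \<union> (\<lambda>x. - x\<^sup>2) ` N"
    proof (cases "t \<ge> 0")
      case True
      then have "t = (sqrt t)\<^sup>2" by simp
      with t show ?thesis by blast
    next
      case False
      then have "t = - (sqrt t)\<^sup>2" using real_sqrt_minus[of "- t"] by simp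
      with t show ?thesis by blast
    qed
  qed
qed

lemma measurable_sqrt_lebesgue: "sqrt \<in> lebesgue \<rightarrow>\<^sub>M lebesgue"
proof (rule completion.measurable_completion2)
  show m: "sqrt \<in> lebesgue \<rightarrow>\<^sub>M lborel"
    by (intro measurable_completion) simp
  show "null_sets lborel \<subseteq> null_sets (distr lebesgue lborel sqrt)"
  proof
    fix N :: "real set" assume N: "N \<in> null_sets lborel"
    then have "negligible N"
      by (simp add: negligible_iff_null_sets null_sets_completionI)
    then have "sqrt -` N \<in> null_sets lebesgue"
      using negligible_vimage_sqrt negligible_iff_null_sets by blast
    then show "N \<in> null_sets (distr lebesgue lborel sqrt)"
      using N m by (auto simp: null_sets_def emeasure_distr)
  qed
qed

lemma Linfty_comp_sqrt:
  assumes "a \<in> Linfty (lebesgue_on {0..<1})"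
  shows "(\<lambda>t. a (sqrt t)) \<in> Linfty (lebesgue_on {0..<1})"
proof -
  have "sqrt \<in> lebesgue_on {0..<1} \<rightarrow>\<^sub>M lebesgue_on {0..<1}"
    by (rule measurable_restrict_space3[OF measurable_sqrt_lebesgue]) auto
  then have m: "(\<lambda>t. a (sqrt t)) \<in> borel_measurable (lebesgue_on {0..<1})"
    using assms by (auto simp: Linfty_def intro: measurable_compose)
  obtain C where "AE t in lebesgue_on {0..<1}. cmod (a t) \<le> C"
    using assms by (auto simp: Linfty_def)
  then have "AE t in lebesgue. t \<in> {0..<1} \<longrightarrow> cmod (a t) \<le> C"
    by (subst (asm) AE_restrict_space_iff) auto
  then have "negligible {t. \<not> (t \<in> {0..<1} \<longrightarrow> cmod (a t) \<le> C)}"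
    by (simp add: completion.AE_iff_null_sets negligible_iff_null_sets)
  then have "negligible (sqrt -` {t. \<not> (t \<in> {0..<1} \<longrightarrow> cmod (a t) \<le> C)})"
    by (rule negligible_vimage_sqrt)
  then have "AE t in lebesgue. sqrt t \<in> {0..<1} \<longrightarrow> cmod (a (sqrt t)) \<le> C"
    by (simp add: completion.AE_iff_null_sets negligible_iff_null_sets vimage_def)
  then have "AE t in lebesgue_on {0..<1}. cmod (a (sqrt t)) \<le> C"
    by (subst AE_restrict_space_iff) (auto elim!: eventually_mono)
  with m show ?thesis by (auto simp: Linfty_def)
qed

text \<open>The symbol is a function of t = |z|^2, namely the composition of a with
  \<open>sqrt\<close>. Since the pushforward of area under |z|^2 has a density, an exceptional null
  set in t pulls back to a null set in the disk.\<close>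

lemma Linfty_radial_symbol:
  assumes "\<alpha> > -1" "a \<in> Linfty (lebesgue_on {0..<1})"
  shows "radial_symbol a \<in> Linfty (disk_measure \<alpha>)"
proof -
  define b where "b t = a (sqrt t)" for t
  have b: "b \<in> Linfty (lebesgue_on {0..<1})"
    using Linfty_comp_sqrt[OF assms(2)] by (simp add: b_def[abs_def])
  have eq: "radial_symbol a = (\<lambda>z. b ((cmod z)\<^sup>2))"
    by (simp add: radial_symbol_def b_def fun_eq_iff)
  have m: "radial_symbol a \<in> borel_measurable (lebesgue_on unit_disk)"
    unfolding eq using b by (auto simp: Linfty_def intro: measurable_compose[OF measurable_cmod_square_unit_disk])
  obtain C where "AE t in lebesgue_on {0..<1}. cmod (b t) \<le> C"
    using b by (auto simp: Linfty_def)
  then have "AE t in lebesgue. t \<in> {0..<1} \<longrightarrow> cmod (b t) \<le> C"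
    by (subst (asm) AE_restrict_space_iff) auto
  moreover have "(\<lambda>t::real. ennreal pi * indicator {0..} t) \<in> borel_measurable lebesgue"
    by (intro borel_measurable_times_ennreal borel_measurable_indicator) auto
  ultimately have "AE t in distr lebesgue lebesgue (\<lambda>z::complex. (cmod z)\<^sup>2). t \<in> {0..<1} \<longrightarrow> cmod (b t) \<le> C"
    unfolding lebesgue_distr_cmod_square by (subst AE_density) auto
  then have "AE z::complex in lebesgue. (cmod z)\<^sup>2 \<in> {0..<1} \<longrightarrow> cmod (b ((cmod z)\<^sup>2)) \<le> C"
    by (rule AE_distrD[OF measurable_cmod_square_lebesgue])
  then have "AE z in lebesgue_on unit_disk. cmod (radial_symbol a z) \<le> C"
    by (subst AE_restrict_space_iff) (auto elim!: eventually_mono simp: eq power_less_one_iff)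
  then have "AE z in disk_measure \<alpha>. cmod (radial_symbol a z) \<le> C"
    unfolding disk_measure_eq using borel_measurable_disk_weight by (subst AE_density) auto
  with m show ?thesis
    by (auto simp: Linfty_def borel_measurable_disk_measure)
qed

lemma toeplitz_radial_operator:
  assumes \<alpha>: "\<alpha> > -1" and a: "a \<in> Linfty (lebesgue_on {0..<1})"
  shows "toeplitz n \<alpha> (radial_symbol a) \<in> radial_operators n \<alpha>"
proof -
  note L = Linfty_radial_symbol[OF \<alpha> a]
  have "toeplitz n \<alpha> (radial_symbol a) (rotation \<tau> f) = rotation \<tau> (toeplitz n \<alpha> (radial_symbol a) f)"
    if "\<tau> \<in> sphere 0 1" "f \<in> poly_bergman n \<alpha>" for \<tau> f
    using that by (intro toeplitz_radial_commutes_rotation[OF \<alpha> L])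
      (auto simp: radial_symbol_def norm_mult)
  with toeplitz_bounded_operator[OF \<alpha> L] show ?thesis
    by (simp add: radial_operators_def)
qed

section \<open>Disk polynomials and Jacobi functions\<close>

text \<open>One Leibniz rule serves both \<^const>\<open>deriv\<close> on the unit interval and the Wirtinger derivatives
  on the disk. The sequences \<open>A\<close> and \<open>B\<close> in it list the successive derivatives of
  the two factors.\<close>

locale derivation_on =
  fixes D :: "('a \<Rightarrow> 'b::comm_ring_1) \<Rightarrow> 'a \<Rightarrow> 'b" and S :: "'a set"
    and has_der :: "('a \<Rightarrow> 'b) \<Rightarrow> 'b \<Rightarrow> 'a \<Rightarrow> bool"
  assumes has_der_imp: "has_der f d x \<Longrightarrow> D f x = d"
    and has_der_const: "has_der (\<lambda>x. c) 0 x"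
    and has_der_add: "has_der f d x \<Longrightarrow> has_der g e x \<Longrightarrow> has_der (\<lambda>x. f x + g x) (d + e) x"
    and has_der_mult: "has_der f d x \<Longrightarrow> has_der g e x \<Longrightarrow> has_der (\<lambda>x. f x * g x) (d * g x + f x * e) x"
    and D_cong: "x \<in> S \<Longrightarrow> (\<And>y. y \<in> S \<Longrightarrow> f y = g y) \<Longrightarrow> D f x = D g x"
begin

lemma has_der_sum:
  assumes "\<And>i. i \<in> I \<Longrightarrow> has_der (f i) (d i) x"
  shows "has_der (\<lambda>x. \<Sum>i\<in>I. f i x) (\<Sum>i\<in>I. d i) x"
  using assms by (induction I rule: infinite_finite_induct) (auto intro: has_der_const has_der_add)

lemma has_der_cmult: "has_der f d x \<Longrightarrow> has_der (\<lambda>x. c * f x) (c * d) x"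
  using has_der_mult[OF has_der_const, of f d x c] by simp

lemma funpow_sequence:
  assumes "\<And>k x. x \<in> S \<Longrightarrow> has_der (A k) (A (Suc k) x) x" "x \<in> S"
  shows "(D ^^ k) (A 0) x = A k x"
  using assms(2)
proof (induction k arbitrary: x)
  case (Suc k)
  have "(D ^^ Suc k) (A 0) x = D ((D ^^ k) (A 0)) x" by simp
  also have "\<dots> = D (A k) x" by (intro D_cong Suc)
  also have "\<dots> = A (Suc k) x" by (intro has_der_imp assms(1) Suc)
  finally show ?case .
qed simp

lemma D_funpow_cong:
  "x \<in> S \<Longrightarrow> (\<And>y. y \<in> S \<Longrightarrow> f y = g y) \<Longrightarrow> (D ^^ k) f x = (D ^^ k) g x"
proof (induction k arbitrary: x)
  case (Suc k)
  then show ?case by (auto intro: D_cong)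
qed simp

text \<open>The Leibniz sums themselves form a sequence of successive derivatives, so
  \<open>funpow_sequence\<close> applies to them; the step from k to \<open>Suc k\<close> is
  Pascal's rule.\<close>

lemma leibniz:
  assumes A: "\<And>k x. x \<in> S \<Longrightarrow> has_der (A k) (A (Suc k) x) x"
    and B: "\<And>k x. x \<in> S \<Longrightarrow> has_der (B k) (B (Suc k) x) x"
    and x: "x \<in> S"
  shows "(D ^^ k) (\<lambda>x. A 0 x * B 0 x) x = (\<Sum>i\<le>k. of_nat (k choose i) * (A i x * B (k - i) x))"
proof -
  define L where "L k x = (\<Sum>i\<le>k. of_nat (k choose i) * (A i x * B (k - i) x))" for k x
  have "has_der (L k) (L (Suc k) x) x" if x: "x \<in> S" for k x
  proof -
    have "has_der (L k) (\<Sum>i\<le>k. of_nat (k choose i) *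
        (A (Suc i) x * B (k - i) x + A i x * B (Suc (k - i)) x)) x"
      unfolding L_def[abs_def] by (intro has_der_sum has_der_cmult has_der_mult A B x)
    moreover have "(\<Sum>i\<le>k. of_nat (k choose i) *
        (A (Suc i) x * B (k - i) x + A i x * B (Suc (k - i)) x)) = L (Suc k) x"
    proof -
      have "L (Suc k) x = A 0 x * B (Suc k) x +
          (\<Sum>i\<le>k. of_nat (Suc k choose Suc i) * (A (Suc i) x * B (k - i) x))"
        unfolding L_def by (subst sum.atMost_Suc_shift) simp
      also have "(\<Sum>i\<le>k. of_nat (Suc k choose Suc i) * (A (Suc i) x * B (k - i) x)) =
          (\<Sum>i\<le>k. of_nat (k choose i) * (A (Suc i) x * B (k - i) x)) +
          (\<Sum>i\<le>k. of_nat (k choose Suc i) * (A (Suc i) x * B (k - i) x))"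
        by (simp add: distrib_right sum.distrib)
      also have "(\<Sum>i\<le>k. of_nat (k choose Suc i) * (A (Suc i) x * B (k - i) x)) =
          (\<Sum>i<k. of_nat (k choose Suc i) * (A (Suc i) x * B (k - i) x))"
        by (simp add: lessThan_Suc_atMost[symmetric] binomial_eq_0)
      also have "A 0 x * B (Suc k) x + ((\<Sum>i\<le>k. of_nat (k choose i) * (A (Suc i) x * B (k - i) x)) +
          (\<Sum>i<k. of_nat (k choose Suc i) * (A (Suc i) x * B (k - i) x))) =
          (\<Sum>i\<le>k. of_nat (k choose i) * (A (Suc i) x * B (k - i) x)) +
          (A 0 x * B (Suc k) x + (\<Sum>i<k. of_nat (k choose Suc i) * (A (Suc i) x * B (Suc (k - Suc i)) x)))"
        by (simp add: Suc_diff_Suc algebra_simps)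
      also have "A 0 x * B (Suc k) x + (\<Sum>i<k. of_nat (k choose Suc i) * (A (Suc i) x * B (Suc (k - Suc i)) x)) =
          (\<Sum>i\<le>k. of_nat (k choose i) * (A i x * B (Suc (k - i)) x))"
        by (simp add: sum.lessThan_Suc_shift lessThan_Suc_atMost[symmetric] del: sum.lessThan_Suc)
      finally show ?thesis by (simp add: distrib_left sum.distrib)
    qed
    ultimately show ?thesis by simp
  qed
  from funpow_sequence[of L, OF this x, of k] show ?thesis
    by (simp add: L_def[abs_def])
qed

end

section \<open>Falling factorials and the Rodrigues formula on the interval\<close>

definition falling_factorial :: "real \<Rightarrow> nat \<Rightarrow> real" where
  "falling_factorial x k = (\<Prod>i<k. x - real i)"

lemma falling_factorial_0 [simp]: "falling_factorial x 0 = 1"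
  by (simp add: falling_factorial_def)

lemma falling_factorial_Suc: "falling_factorial x (Suc k) = falling_factorial x k * (x - real k)"
  by (simp add: falling_factorial_def)

lemma falling_factorial_add:
  "falling_factorial x (j + k) = falling_factorial x j * falling_factorial (x - real j) k"
  by (induction k) (auto simp: falling_factorial_Suc algebra_simps)

lemma falling_factorial_of_nat: "falling_factorial (real p) k = fact k * real (p choose k)"
proof (induction k)
  case (Suc k)
  have "Suc k * (p choose Suc k) = (p - k) * (p choose k)"
    by (simp only: binomial_absorption binomial_absorb_comp)
  then have "real (Suc k) * real (p choose Suc k) = (real p - real k) * real (p choose k)"
    by (cases "k \<le> p") (simp_all only: of_nat_mult[symmetric] of_nat_diff[symmetric], simp add: binomial_eq_0)
  have "falling_factorial (real p) (Suc k) = fact k * ((real p - real k) * real (p choose k))"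
    by (simp only: falling_factorial_Suc Suc.IH mult_ac)
  also have "\<dots> = fact k * (real (Suc k) * real (p choose Suc k))"
    by (simp only: \<open>real (Suc k) * real (p choose Suc k) = _\<close>)
  finally show ?case by (simp add: algebra_simps)
qed simp

text \<open>Turns the coefficients produced by differentiation into the Gamma quotients of the
  normalising constants. Positivity keeps all arguments away from the poles.\<close>

lemma falling_factorial_Gamma:
  assumes "x - real k + 1 > 0"
  shows "falling_factorial x k * Gamma (x - real k + 1) = Gamma (x + 1)"
  using assms
proof (induction k)
  case (Suc k)
  have "x - real k > 0" using Suc.prems by simp
  then have "Gamma (x - real k + 1) = (x - real k) * Gamma (x - real k)"
    by (intro Gamma_plus1) (auto elim!: nonpos_Ints_cases)
  with Suc show ?case by (simp add: falling_factorial_Suc mult_ac)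
qed simp

interpretation real_derivation: derivation_on deriv "{0<..<1::real}"
  "\<lambda>f d x. (f has_field_derivative d) (at x)"
proof
  show "deriv f x = d" if "(f has_field_derivative d) (at x)" for f :: "real \<Rightarrow> real" and d x
    using that by (rule DERIV_imp_deriv)
  show "deriv f x = deriv g x" if "x \<in> {0<..<1}" "\<And>y. y \<in> {0<..<1} \<Longrightarrow> f y = g y"
    for f g :: "real \<Rightarrow> real" and x
    using that by (intro deriv_cong_ev eventually_nhds[THEN iffD2] exI[of _ "{0<..<1}"]) auto
qed (auto intro!: derivative_eq_intros)

lemma deriv_funpow_powr_mult_powr:
  assumes "t \<in> {0<..<1}"
  shows "(deriv ^^ m) (\<lambda>s. (1 - s) powr c * s powr d) t =
    (\<Sum>i\<le>m. real (m choose i) * (falling_factorial d i * t powr (d - real i) *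
      ((-1) ^ (m - i) * falling_factorial c (m - i) * (1 - t) powr (c - real (m - i)))))"
proof -
  define A where "A i t = falling_factorial d i * t powr (d - real i)" for i and t :: real
  define B where "B i t = (-1) ^ i * falling_factorial c i * (1 - t) powr (c - real i)" for i and t :: real
  have A: "(A i has_field_derivative A (Suc i) t) (at t)" if "t \<in> {0<..<1}" for i t
    unfolding A_def[abs_def] using that
    by (auto intro!: derivative_eq_intros simp: falling_factorial_Suc algebra_simps)
  have B: "(B i has_field_derivative B (Suc i) t) (at t)" if "t \<in> {0<..<1}" for i t
    unfolding B_def[abs_def] using that
    by (auto intro!: derivative_eq_intros simp: falling_factorial_Suc algebra_simps)
  have "(\<lambda>s. (1 - s) powr c * s powr d) = (\<lambda>s. A 0 s * B 0 s)"
    by (simp add: A_def B_def mult.commute fun_eq_iff)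
  then show ?thesis
    using real_derivation.leibniz[of A B, OF A B assms, of m] by (simp add: A_def B_def)
qed

text \<open>The prefactors cancel the real exponents exactly, and for a natural second parameter b,
  which is the absolute value of the frequency, a polynomial in t and 1 - t remains. The terms are
  arranged to match those of the disk polynomials.\<close>

lemma shifted_jacobi_eq:
  assumes t: "t \<in> {0<..<1}"
  shows "shifted_jacobi m \<alpha> (real b) t =
    1 / fact m * (\<Sum>i\<le>m. (-1) ^ i * real (m choose i) * real ((m + b) choose i) * fact i *
      falling_factorial (real m + \<alpha>) (m - i) * t ^ (m - i) * (1 - t) ^ i)"
proof -
  have pos: "t > 0" "1 - t > 0" using t by auto
  define u where "u i = ((1 - t) powr (- \<alpha>) * t powr (- real b)) *
      (real (m choose i) * (falling_factorial (real m + real b) i * t powr (real m + real b - real i) *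
      ((-1) ^ (m - i) * falling_factorial (real m + \<alpha>) (m - i) *
        (1 - t) powr (real m + \<alpha> - real (m - i)))))" for i
  define v where "v i = (-1) ^ i * real (m choose i) * real ((m + b) choose i) * fact i *
      falling_factorial (real m + \<alpha>) (m - i) * t ^ (m - i) * (1 - t) ^ i" for i
  have u_eq: "u i = (-1) ^ m * v i" if i: "i \<le> m" for i
  proof -
    have e1: "t powr (- real b) * t powr (real m + real b - real i) = t ^ (m - i)"
      using pos i by (simp add: powr_add[symmetric] powr_realpow[symmetric] of_nat_diff)
    have e2: "(1 - t) powr (- \<alpha>) * (1 - t) powr (real m + \<alpha> - real (m - i)) = (1 - t) ^ i"
      using pos i by (simp add: powr_add[symmetric] powr_realpow[symmetric] of_nat_diff)
    have e3: "(-1) ^ (m - i) = (-1) ^ m * (-1::real) ^ i"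
      using i by (auto simp: power_add[symmetric] minus_one_power_iff)
    have e4: "falling_factorial (real m + real b) i = fact i * real ((m + b) choose i)"
      using falling_factorial_of_nat[of "m + b" i] by simp
    have "u i = (-1) ^ (m - i) * real (m choose i) * falling_factorial (real m + real b) i *
        falling_factorial (real m + \<alpha>) (m - i) *
        (t powr (- real b) * t powr (real m + real b - real i)) *
        ((1 - t) powr (- \<alpha>) * (1 - t) powr (real m + \<alpha> - real (m - i)))"
      unfolding u_def by (simp only: mult_ac)
    then show ?thesis
      unfolding v_def e1 e2 e3 e4 by (simp only: mult_ac)
  qed
  have "shifted_jacobi m \<alpha> (real b) t = (-1) ^ m / fact m * (\<Sum>i\<le>m. u i)"
    unfolding shifted_jacobi_def deriv_funpow_powr_mult_powr[OF t] u_def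
    by (simp add: sum_distrib_left mult_ac)
  also have "\<dots> = ((-1) ^ m * (-1) ^ m) / fact m * (\<Sum>i\<le>m. v i)"
    by (simp add: u_eq sum_distrib_left[symmetric])
  finally show ?thesis by (simp add: v_def power_mult_distrib[symmetric])
qed

text \<open>The total operator has a value even where f is not differentiable, and there the sum and
  product rules may fail. The relation records differentiability along with the value.\<close>

definition has_wirtinger_z :: "(complex \<Rightarrow> complex) \<Rightarrow> complex \<Rightarrow> complex \<Rightarrow> bool" where
  "has_wirtinger_z f d z \<longleftrightarrow> (\<exists>D. (f has_derivative D) (at z) \<and> d = (D 1 - \<i> * D \<i>) / 2)"

definition has_wirtinger_zbar :: "(complex \<Rightarrow> complex) \<Rightarrow> complex \<Rightarrow> complex \<Rightarrow> bool" where
  "has_wirtinger_zbar f d z \<longleftrightarrow> (\<exists>D. (f has_derivative D) (at z) \<and> d = (D 1 + \<i> * D \<i>) / 2)"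

interpretation wirtinger_z: derivation_on wirtinger_z unit_disk has_wirtinger_z
proof
  show "wirtinger_z f z = d" if "has_wirtinger_z f d z" for f d z
    using that by (auto simp: has_wirtinger_z_def wirtinger_z_has_derivative)
  show "has_wirtinger_z (\<lambda>z. c) 0 z" for c z
    unfolding has_wirtinger_z_def by (rule exI[of _ "\<lambda>v. 0"]) auto
  show "has_wirtinger_z (\<lambda>z. f z + g z) (d + e) z"
    if f: "has_wirtinger_z f d z" and g: "has_wirtinger_z g e z" for f g d e z
  proof -
    obtain D E where "(f has_derivative D) (at z)" "d = (D 1 - \<i> * D \<i>) / 2"
        "(g has_derivative E) (at z)" "e = (E 1 - \<i> * E \<i>) / 2"
      using f g unfolding has_wirtinger_z_def by blast
    then show ?thesis
      unfolding has_wirtinger_z_def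
      by (intro exI[of _ "\<lambda>v. D v + E v"] conjI has_derivative_add) (simp_all add: field_simps)
  qed
  show "has_wirtinger_z (\<lambda>z. f z * g z) (d * g z + f z * e) z"
    if f: "has_wirtinger_z f d z" and g: "has_wirtinger_z g e z" for f g d e z
  proof -
    obtain D E where "(f has_derivative D) (at z)" and d: "d = (D 1 - \<i> * D \<i>) / 2"
        and "(g has_derivative E) (at z)" and e: "e = (E 1 - \<i> * E \<i>) / 2"
      using f g unfolding has_wirtinger_z_def by blast
    then show ?thesis
      unfolding has_wirtinger_z_def d e
      by (intro exI[of _ "\<lambda>v. f z * E v + D v * g z"] conjI has_derivative_mult) (simp_all add: field_simps)
  qed
  show "wirtinger_z f z = wirtinger_z g z"
    if "z \<in> unit_disk" "\<And>y. y \<in> unit_disk \<Longrightarrow> f y = g y" for f g z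
    using that by (rule wirtinger_z_cong_open[OF open_ball])
qed

interpretation wirtinger_zbar: derivation_on wirtinger_zbar unit_disk has_wirtinger_zbar
proof
  show "wirtinger_zbar f z = d" if "has_wirtinger_zbar f d z" for f d z
    using that by (auto simp: has_wirtinger_zbar_def wirtinger_zbar_has_derivative)
  show "has_wirtinger_zbar (\<lambda>z. c) 0 z" for c z
    unfolding has_wirtinger_zbar_def by (rule exI[of _ "\<lambda>v. 0"]) auto
  show "has_wirtinger_zbar (\<lambda>z. f z + g z) (d + e) z"
    if f: "has_wirtinger_zbar f d z" and g: "has_wirtinger_zbar g e z" for f g d e z
  proof -
    obtain D E where "(f has_derivative D) (at z)" "d = (D 1 + \<i> * D \<i>) / 2"
        "(g has_derivative E) (at z)" "e = (E 1 + \<i> * E \<i>) / 2"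
      using f g unfolding has_wirtinger_zbar_def by blast
    then show ?thesis
      unfolding has_wirtinger_zbar_def
      by (intro exI[of _ "\<lambda>v. D v + E v"] conjI has_derivative_add) (simp_all add: field_simps)
  qed
  show "has_wirtinger_zbar (\<lambda>z. f z * g z) (d * g z + f z * e) z"
    if f: "has_wirtinger_zbar f d z" and g: "has_wirtinger_zbar g e z" for f g d e z
  proof -
    obtain D E where "(f has_derivative D) (at z)" and d: "d = (D 1 + \<i> * D \<i>) / 2"
        and "(g has_derivative E) (at z)" and e: "e = (E 1 + \<i> * E \<i>) / 2"
      using f g unfolding has_wirtinger_zbar_def by blast
    then show ?thesis
      unfolding has_wirtinger_zbar_def d e
      by (intro exI[of _ "\<lambda>v. f z * E v + D v * g z"] conjI has_derivative_mult) (simp_all add: field_simps)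
  qed
  show "wirtinger_zbar f z = wirtinger_zbar g z"
    if "z \<in> unit_disk" "\<And>y. y \<in> unit_disk \<Longrightarrow> f y = g y" for f g z
    using that by (rule wirtinger_zbar_cong_open[OF open_ball])
qed

section \<open>Wirtinger derivatives of powers of the weight\<close>

lemma
  shows has_wirtinger_z_power: "has_wirtinger_z (\<lambda>w. w ^ k) (of_nat k * z ^ (k - 1)) z"
    and has_wirtinger_zbar_power: "has_wirtinger_zbar (\<lambda>w. w ^ k) 0 z"
proof -
  have "((\<lambda>w. w ^ k) has_derivative (\<lambda>v. of_nat k * v * z ^ (k - 1))) (at z)"
    by (rule has_derivative_power[OF has_derivative_ident])
  then show "has_wirtinger_z (\<lambda>w. w ^ k) (of_nat k * z ^ (k - 1)) z"
    "has_wirtinger_zbar (\<lambda>w. w ^ k) 0 z"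
    unfolding has_wirtinger_z_def has_wirtinger_zbar_def
    by (intro exI[of _ "\<lambda>v. of_nat k * v * z ^ (k - 1)"]; simp add: algebra_simps)+
qed

lemma has_wirtinger_z_cnj_power: "has_wirtinger_z (\<lambda>w. cnj w ^ k) 0 z"
proof -
  have "((\<lambda>w. cnj w ^ k) has_derivative (\<lambda>v. of_nat k * cnj v * cnj z ^ (k - 1))) (at z)"
    by (intro has_derivative_power bounded_linear.has_derivative[OF bounded_linear_cnj has_derivative_ident])
  then show ?thesis
    unfolding has_wirtinger_z_def
    by (intro exI[of _ "\<lambda>v. of_nat k * cnj v * cnj z ^ (k - 1)"]) (simp add: algebra_simps)
qed

lemma
  assumes z: "z \<in> unit_disk"
  shows has_wirtinger_z_weight: "has_wirtinger_z (\<lambda>w. of_real ((1 - (cmod w)\<^sup>2) powr c))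
      (of_real (c * (1 - (cmod z)\<^sup>2) powr (c - 1)) * - cnj z) z"
    and has_wirtinger_zbar_weight: "has_wirtinger_zbar (\<lambda>w. of_real ((1 - (cmod w)\<^sup>2) powr c))
      (of_real (c * (1 - (cmod z)\<^sup>2) powr (c - 1)) * - z) z"
proof -
  define X where "X = c * (1 - (cmod z)\<^sup>2) powr (c - 1)"
  have eq: "(cmod w)\<^sup>2 = w \<bullet> w" for w
    by (simp add: power2_norm_eq_inner)
  have pos: "1 - z \<bullet> z > 0"
    using z unfolding eq[symmetric] by (simp add: power_less_one_iff)
  have "((\<lambda>w. 1 - w \<bullet> w) has_derivative (\<lambda>v. - (2 * (z \<bullet> v)))) (at z)"
    by (auto intro!: derivative_eq_intros simp: inner_commute)
  from DERIV_compose_FDERIV[OF has_real_derivative_powr[OF pos, of c] this]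
  have "((\<lambda>w. (1 - w \<bullet> w) powr c) has_derivative (\<lambda>v. - (2 * (z \<bullet> v)) * X)) (at z)"
    by (simp add: X_def eq)
  then have d: "((\<lambda>w. complex_of_real ((1 - (cmod w)\<^sup>2) powr c)) has_derivative
      (\<lambda>v. of_real (- (2 * (z \<bullet> v)) * X))) (at z)"
    unfolding eq by (rule has_derivative_of_real)
  show "has_wirtinger_z (\<lambda>w. of_real ((1 - (cmod w)\<^sup>2) powr c))
      (of_real (c * (1 - (cmod z)\<^sup>2) powr (c - 1)) * - cnj z) z"
    unfolding has_wirtinger_z_def X_def[symmetric]
    by (intro exI[of _ "\<lambda>v. of_real (- (2 * (z \<bullet> v)) * X)"] conjI d)
      (simp add: complex_eq_iff inner_complex_def)
  show "has_wirtinger_zbar (\<lambda>w. of_real ((1 - (cmod w)\<^sup>2) powr c))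
      (of_real (c * (1 - (cmod z)\<^sup>2) powr (c - 1)) * - z) z"
    unfolding has_wirtinger_zbar_def X_def[symmetric]
    by (intro exI[of _ "\<lambda>v. of_real (- (2 * (z \<bullet> v)) * X)"] conjI d)
      (simp add: complex_eq_iff inner_complex_def)
qed

text \<open>Each derivative lowers the exponent and contributes - z, which is constant for the
  conjugate variable. A single term results, and Leibniz' rule is left for the derivatives in
  z.\<close>

lemma wirtinger_zbar_funpow_weight:
  assumes z: "z \<in> unit_disk"
  shows "(wirtinger_zbar ^^ p) (\<lambda>w. of_real ((1 - (cmod w)\<^sup>2) powr c)) z =
    of_real ((-1) ^ p * falling_factorial c p) * z ^ p * of_real ((1 - (cmod z)\<^sup>2) powr (c - real p))"
proof -
  define A where "A p z = of_real ((-1) ^ p * falling_factorial c p) * z ^ p *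
    of_real ((1 - (cmod z)\<^sup>2) powr (c - real p))" for p z
  have "has_wirtinger_zbar (A p) (A (Suc p) z) z" if "z \<in> unit_disk" for p z
  proof -
    have "has_wirtinger_zbar (A p) (of_real ((-1) ^ p * falling_factorial c p) *
       (0 * of_real ((1 - (cmod z)\<^sup>2) powr (c - real p)) +
        z ^ p * (of_real ((c - real p) * (1 - (cmod z)\<^sup>2) powr (c - real p - 1)) * - z))) z"
      unfolding A_def[abs_def] mult.assoc
      using wirtinger_zbar.has_der_cmult[OF wirtinger_zbar.has_der_mult[OF has_wirtinger_zbar_power
            has_wirtinger_zbar_weight[OF that]]] by (simp only: mult.assoc)
    then show ?thesis
      by (simp add: A_def falling_factorial_Suc algebra_simps)
  qed
  from wirtinger_zbar.funpow_sequence[of A, OF this z, of p] show ?thesis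
    by (simp add: A_def[abs_def])
qed

text \<open>In the sum, i of the derivatives in z fall on the factor z^p left by the conjugate
  derivatives and q - i on the power of the weight. For i > p the binomial coefficient vanishes, so
  the truncated exponent p - i does no harm.\<close>

lemma disk_poly_derivative:
  assumes z: "z \<in> unit_disk"
  shows "(wirtinger_z ^^ q) ((wirtinger_zbar ^^ p) (\<lambda>w. of_real ((1 - (cmod w)\<^sup>2) powr c))) z =
    (\<Sum>i\<le>q. of_real ((-1) ^ p * (-1) ^ (q - i) * real (q choose i) * real (p choose i) * fact i *
      falling_factorial c (p + q - i) * (1 - (cmod z)\<^sup>2) powr (c - real p - real (q - i))) *
      (z ^ (p - i) * cnj z ^ (q - i)))"
proof -
  define A where "A i z = of_real ((-1) ^ p * falling_factorial c p * falling_factorial (real p) i) * z ^ (p - i)"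
    for i and z :: complex
  define B where "B i z = of_real ((-1) ^ i * falling_factorial (c - real p) i) *
    (cnj z ^ i * of_real ((1 - (cmod z)\<^sup>2) powr (c - real p - real i)))" for i z
  have A: "has_wirtinger_z (A i) (A (Suc i) z) z" for i z
  proof -
    have "of_real (falling_factorial (real p) i) * (of_nat (p - i) * z ^ (p - i - 1)) =
        of_real (falling_factorial (real p) (Suc i)) * z ^ (p - Suc i)"
    proof (cases "i \<le> p")
      case True
      then show ?thesis by (simp add: falling_factorial_Suc of_nat_diff)
    next
      case False
      then show ?thesis by (simp add: falling_factorial_of_nat binomial_eq_0)
    qed
    then have eq: "A (Suc i) z = of_real ((-1) ^ p * falling_factorial c p * falling_factorial (real p) i) *
        (of_nat (p - i) * z ^ (p - i - 1))"
      unfolding A_def of_real_mult by (simp only: mult.assoc)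
    have "has_wirtinger_z (A i) (of_real ((-1) ^ p * falling_factorial c p * falling_factorial (real p) i) *
        (of_nat (p - i) * z ^ (p - i - 1))) z"
      unfolding A_def[abs_def] by (rule wirtinger_z.has_der_cmult[OF has_wirtinger_z_power])
    then show ?thesis by (simp only: eq)
  qed
  have B: "has_wirtinger_z (B i) (B (Suc i) z) z" if "z \<in> unit_disk" for i z
  proof -
    have "has_wirtinger_z (B i) (of_real ((-1) ^ i * falling_factorial (c - real p) i) *
       (0 * of_real ((1 - (cmod z)\<^sup>2) powr (c - real p - real i)) +
        cnj z ^ i * (of_real ((c - real p - real i) * (1 - (cmod z)\<^sup>2) powr (c - real p - real i - 1)) * - cnj z))) z"
      unfolding B_def[abs_def]
      by (intro wirtinger_z.has_der_cmult wirtinger_z.has_der_mult has_wirtinger_z_cnj_power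
          has_wirtinger_z_weight that)
    then show ?thesis
      by (simp add: B_def falling_factorial_Suc algebra_simps)
  qed
  have "(wirtinger_z ^^ q) ((wirtinger_zbar ^^ p) (\<lambda>w. of_real ((1 - (cmod w)\<^sup>2) powr c))) z =
      (wirtinger_z ^^ q) (\<lambda>z. A 0 z * B 0 z) z"
    by (rule wirtinger_z.D_funpow_cong[OF z]) (simp add: wirtinger_zbar_funpow_weight A_def B_def)
  also have "\<dots> = (\<Sum>i\<le>q. of_nat (q choose i) * (A i z * B (q - i) z))"
    by (rule wirtinger_z.leibniz[of A B, OF A B z])
  also have "\<dots> = (\<Sum>i\<le>q. of_real ((-1) ^ p * (-1) ^ (q - i) * real (q choose i) * real (p choose i) * fact i *
      falling_factorial c (p + q - i) * (1 - (cmod z)\<^sup>2) powr (c - real p - real (q - i))) *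
      (z ^ (p - i) * cnj z ^ (q - i)))"
  proof (rule sum.cong[OF refl])
    fix i assume "i \<in> {..q}"
    then have "p + q - i = p + (q - i)" by simp
    then have e: "falling_factorial c (p + q - i) = falling_factorial c p * falling_factorial (c - real p) (q - i)"
      by (simp only: falling_factorial_add)
    show "of_nat (q choose i) * (A i z * B (q - i) z) =
      of_real ((-1) ^ p * (-1) ^ (q - i) * real (q choose i) * real (p choose i) * fact i *
      falling_factorial c (p + q - i) * (1 - (cmod z)\<^sup>2) powr (c - real p - real (q - i))) *
      (z ^ (p - i) * cnj z ^ (q - i))"
      unfolding A_def B_def e falling_factorial_of_nat of_real_mult of_real_of_nat_eq of_real_fact
      by (simp only: mult_ac)
  qed
  finally show ?thesis .
qed

definition disk_poly_coeff :: "real \<Rightarrow> nat \<Rightarrow> nat \<Rightarrow> nat \<Rightarrow> real" where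
  "disk_poly_coeff \<alpha> p q i = (-1) ^ i * real (p choose i) * real (q choose i) * fact i *
     falling_factorial (real p + real q + \<alpha>) (p + q - i)"

text \<open>The coefficients are symmetric in \<^term>\<open>p\<close> and \<^term>\<open>q\<close>, although the two Wirtinger derivatives
  in the definition are taken in a fixed order; this exchanges the frequencies
  \<^term>\<open>\<xi>\<close> and \<^term>\<open>- \<xi>\<close>.\<close>

lemma disk_poly_eq:
  assumes z: "z \<in> unit_disk"
  shows "disk_poly \<alpha> p q z = of_real (disk_poly_const \<alpha> p q) *
    (\<Sum>i\<le>min p q. of_real (disk_poly_coeff \<alpha> p q i * (1 - (cmod z)\<^sup>2) ^ i) * (z ^ (p - i) * cnj z ^ (q - i)))"
proof -
  have pos: "1 - (cmod z)\<^sup>2 > 0" using z by (simp add: power_less_one_iff)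
  define u where "u i = (-1) ^ p * (-1) ^ (q - i) * real (q choose i) * real (p choose i) * fact i *
      falling_factorial (real p + real q + \<alpha>) (p + q - i) *
      (1 - (cmod z)\<^sup>2) powr (real p + real q + \<alpha> - real p - real (q - i))" for i
  have u_eq: "(-1) ^ (p + q) * (1 - (cmod z)\<^sup>2) powr (- \<alpha>) * u i =
      disk_poly_coeff \<alpha> p q i * (1 - (cmod z)\<^sup>2) ^ i" if i: "i \<le> q" for i
  proof -
    have e1: "(-1) ^ (p + q) * (-1) ^ p * (-1) ^ (q - i) = (-1::real) ^ i"
      using i by (auto simp: minus_one_power_iff)
    have e2: "(1 - (cmod z)\<^sup>2) powr (- \<alpha>) *
        (1 - (cmod z)\<^sup>2) powr (real p + real q + \<alpha> - real p - real (q - i)) = (1 - (cmod z)\<^sup>2) ^ i"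
      using pos i by (simp add: powr_add[symmetric] powr_realpow[symmetric] of_nat_diff)
    have "(-1) ^ (p + q) * (1 - (cmod z)\<^sup>2) powr (- \<alpha>) * u i =
        ((-1) ^ (p + q) * (-1) ^ p * (-1) ^ (q - i)) * real (p choose i) * real (q choose i) * fact i *
        falling_factorial (real p + real q + \<alpha>) (p + q - i) *
        ((1 - (cmod z)\<^sup>2) powr (- \<alpha>) *
          (1 - (cmod z)\<^sup>2) powr (real p + real q + \<alpha> - real p - real (q - i)))"
      unfolding u_def by (simp only: mult_ac)
    then show ?thesis
      unfolding e1 e2 disk_poly_coeff_def .
  qed
  have "disk_poly \<alpha> p q z = of_real (disk_poly_const \<alpha> p q) *
      (\<Sum>i\<le>q. of_real ((-1) ^ (p + q) * (1 - (cmod z)\<^sup>2) powr (- \<alpha>) * u i) *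
        (z ^ (p - i) * cnj z ^ (q - i)))"
    using z by (simp add: disk_poly_def disk_poly_derivative[OF z] u_def sum_distrib_left mult_ac)
  also have "\<dots> = of_real (disk_poly_const \<alpha> p q) *
      (\<Sum>i\<le>q. of_real (disk_poly_coeff \<alpha> p q i * (1 - (cmod z)\<^sup>2) ^ i) *
        (z ^ (p - i) * cnj z ^ (q - i)))"
    by (rule arg_cong2[of _ _ _ _ "(*)", OF refl sum.cong[OF refl]]) (simp only: u_eq atMost_iff)
  \<comment> \<open>The terms with i > p vanish with \<open>p choose i\<close>; the new range is
    symmetric in p and q and makes both exponents exact.\<close>
  also have "(\<Sum>i\<le>q. of_real (disk_poly_coeff \<alpha> p q i * (1 - (cmod z)\<^sup>2) ^ i) *
        (z ^ (p - i) * cnj z ^ (q - i))) =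
      (\<Sum>i\<le>min p q. of_real (disk_poly_coeff \<alpha> p q i * (1 - (cmod z)\<^sup>2) ^ i) *
        (z ^ (p - i) * cnj z ^ (q - i)))"
    by (rule sum.mono_neutral_right) (auto simp: disk_poly_coeff_def binomial_eq_0)
  finally show ?thesis .
qed

section \<open>Disk polynomials belong to the space and have a radial factor\<close>

lemma polyanalytic_decomposition_term:
  assumes "k < n" "h holomorphic_on unit_disk"
  shows "\<exists>g. polyanalytic_decomposition n g (\<lambda>z. cnj z ^ k * h z)"
  using assms
  by (intro exI[of _ "\<lambda>j. if j = k then h else (\<lambda>z. 0)"])
    (auto simp: polyanalytic_decomposition_def if_distrib[of "\<lambda>f. f _"] if_distrib[of "(*) _"] cong: if_cong)

lemma polyanalytic_decomposition_sum:
  assumes "\<And>i. i \<in> I \<Longrightarrow> \<exists>g. polyanalytic_decomposition n g (f i)"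
  shows "\<exists>g. polyanalytic_decomposition n g (\<lambda>z. \<Sum>i\<in>I. f i z)"
proof -
  obtain G where G: "\<And>i. i \<in> I \<Longrightarrow> polyanalytic_decomposition n (G i) (f i)"
    using assms by metis
  have "(\<Sum>i\<in>I. f i z) = (\<Sum>k<n. cnj z ^ k * (\<Sum>i\<in>I. G i k z))" if "z \<in> unit_disk" for z
  proof -
    have "(\<Sum>i\<in>I. f i z) = (\<Sum>i\<in>I. \<Sum>k<n. cnj z ^ k * G i k z)"
      using G that by (intro sum.cong) (auto simp: polyanalytic_decomposition_def)
    then show ?thesis by (simp add: sum.swap[of _ "{..<n}"] sum_distrib_left)
  qed
  moreover have "(\<lambda>z. \<Sum>i\<in>I. G i k z) holomorphic_on unit_disk" if "k < n" for k
    using G that by (intro holomorphic_intros) (auto simp: polyanalytic_decomposition_def)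
  ultimately show ?thesis
    by (intro exI[of _ "\<lambda>k z. \<Sum>i\<in>I. G i k z"]) (auto simp: polyanalytic_decomposition_def)
qed

lemma Ltwo_bounded:
  assumes "\<alpha> > -1" "f \<in> borel_measurable (lebesgue_on unit_disk)"
    and B: "\<And>z. z \<in> unit_disk \<Longrightarrow> cmod (f z) \<le> B"
  shows "f \<in> Ltwo (disk_measure \<alpha>)"
proof -
  interpret finite_measure "disk_measure \<alpha>" by (rule finite_measure_disk_measure[OF assms(1)])
  have m: "f \<in> borel_measurable (disk_measure \<alpha>)"
    using assms(2) by (simp add: borel_measurable_disk_measure)
  then have "integrable (disk_measure \<alpha>) (\<lambda>z. (cmod (f z))\<^sup>2)"
    by (intro integrable_const_bound[where B = "B\<^sup>2"]) (auto intro!: power_mono B)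
  with m show ?thesis by (simp add: Ltwo_def)
qed

text \<open>Expanding the powers of 1 - |z|^2 binomially gives exponents q - i + j of
  \<open>cnj z\<close> with j \<le> i, hence at most q and below n.\<close>

lemma disk_poly_polyanalytic:
  assumes "q < n"
  shows "\<exists>g. polyanalytic_decomposition n g (disk_poly \<alpha> p q)"
proof -
  define F where "F = (\<lambda>z. \<Sum>i\<le>min p q. \<Sum>j\<le>i. cnj z ^ (q - i + j) *
    (of_real (disk_poly_const \<alpha> p q * disk_poly_coeff \<alpha> p q i * real (i choose j) * (-1) ^ j) * z ^ (p - i + j)))"
  have "\<exists>g. polyanalytic_decomposition n g F"
    unfolding F_def using assms
    by (intro polyanalytic_decomposition_sum polyanalytic_decomposition_term holomorphic_intros) auto
  moreover have "disk_poly \<alpha> p q z = F z" if z: "z \<in> unit_disk" for z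
  proof -
    have e: "complex_of_real ((1 - (cmod z)\<^sup>2) ^ i) =
        (\<Sum>j\<le>i. of_real (real (i choose j) * (-1) ^ j) * (z ^ j * cnj z ^ j))" for i
    proof -
      have "complex_of_real (1 - (cmod z)\<^sup>2) = - (z * cnj z) + 1"
        by (simp only: of_real_diff of_real_1 complex_norm_square) simp
      then have "complex_of_real ((1 - (cmod z)\<^sup>2) ^ i) = (- (z * cnj z) + 1) ^ i"
        by (simp only: of_real_power[of _ i])
      also have "\<dots> = (\<Sum>j\<le>i. of_nat (i choose j) * (- (z * cnj z)) ^ j * 1 ^ (i - j))"
        by (rule binomial_ring)
      also have "\<dots> = (\<Sum>j\<le>i. of_real (real (i choose j) * (-1) ^ j) * (z ^ j * cnj z ^ j))"
        by (intro sum.cong refl) (simp add: power_minus[of "z * cnj z"] power_mult_distrib)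
      finally show ?thesis .
    qed
    show ?thesis
      unfolding disk_poly_eq[OF z] F_def sum_distrib_left
      by (rule sum.cong[OF refl])
        (simp only: of_real_mult[of "disk_poly_coeff \<alpha> p q _" "(1 - (cmod z)\<^sup>2) ^ _"] e
          of_real_mult sum_distrib_left sum_distrib_right power_add mult_ac)
  qed
  ultimately show ?thesis by (auto simp: polyanalytic_decomposition_def)
qed

lemma disk_poly_in_poly_bergman:
  assumes \<alpha>: "\<alpha> > -1" and "q < n"
  shows "disk_poly \<alpha> p q \<in> poly_bergman n \<alpha>"
proof -
  obtain g where g: "polyanalytic_decomposition n g (disk_poly \<alpha> p q)"
    using disk_poly_polyanalytic[OF assms(2)] by blast
  have "continuous_on unit_disk (\<lambda>z. \<Sum>k<n. cnj z ^ k * g k z)"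
    using g by (intro continuous_intros) (auto simp: polyanalytic_decomposition_def holomorphic_on_imp_continuous_on)
  then have cont: "continuous_on unit_disk (disk_poly \<alpha> p q)"
    by (rule continuous_on_cong[THEN iffD1, rotated -1]) (use g in \<open>auto simp: polyanalytic_decomposition_def\<close>)
  have "cmod (disk_poly \<alpha> p q z) \<le>
      \<bar>disk_poly_const \<alpha> p q\<bar> * (\<Sum>i\<le>min p q. \<bar>disk_poly_coeff \<alpha> p q i\<bar>)"
    if z: "z \<in> unit_disk" for z
  proof -
    have z1: "cmod z \<le> 1" "0 \<le> 1 - (cmod z)\<^sup>2" "1 - (cmod z)\<^sup>2 \<le> 1"
      using z by (auto simp: power_le_one)
    have "cmod (\<Sum>i\<le>min p q. of_real (disk_poly_coeff \<alpha> p q i * (1 - (cmod z)\<^sup>2) ^ i) * (z ^ (p - i) * cnj z ^ (q - i)))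
        \<le> (\<Sum>i\<le>min p q. \<bar>disk_poly_coeff \<alpha> p q i\<bar>)"
    proof (rule sum_norm_le)
      fix i
      have "\<bar>1 - (cmod z)\<^sup>2\<bar> ^ i \<le> 1" "cmod z ^ (p - i) \<le> 1" "cmod z ^ (q - i) \<le> 1"
        using z1 by (auto intro!: power_le_one)
      then have "\<bar>1 - (cmod z)\<^sup>2\<bar> ^ i * (cmod z ^ (p - i) * cmod z ^ (q - i)) \<le> 1 * (1 * 1)"
        by (intro mult_mono) auto
      then have "\<bar>disk_poly_coeff \<alpha> p q i\<bar> * (\<bar>1 - (cmod z)\<^sup>2\<bar> ^ i * (cmod z ^ (p - i) * cmod z ^ (q - i))) \<le>
          \<bar>disk_poly_coeff \<alpha> p q i\<bar> * 1"
        by (intro mult_left_mono) auto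
      then show "cmod (of_real (disk_poly_coeff \<alpha> p q i * (1 - (cmod z)\<^sup>2) ^ i) * (z ^ (p - i) * cnj z ^ (q - i)))
          \<le> \<bar>disk_poly_coeff \<alpha> p q i\<bar>"
        by (simp only: norm_mult norm_of_real norm_power abs_mult power_abs complex_mod_cnj mult.assoc mult_1_right)
    qed
    then show ?thesis
      unfolding disk_poly_eq[OF z] norm_mult norm_of_real by (rule mult_left_mono) simp
  qed
  then have "disk_poly \<alpha> p q \<in> Ltwo (disk_measure \<alpha>)"
    by (intro Ltwo_bounded[OF \<alpha>] borel_measurable_unit_disk_continuous cont)
  then show ?thesis
    using g by (auto simp: poly_bergman_iff disk_poly_def)
qed

text \<open>The radial factor of \<^term>\<open>disk_poly \<alpha> p q\<close> as a function of \<open>t = (cmod z)\<^sup>2\<close>, where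
  \<open>m = min p q\<close> and \<open>b = \<bar>p - q\<bar>\<close>.\<close>

definition disk_poly_radial :: "real \<Rightarrow> nat \<Rightarrow> nat \<Rightarrow> real \<Rightarrow> real" where
  "disk_poly_radial \<alpha> m b t = disk_poly_const \<alpha> (m + b) m *
     (\<Sum>i\<le>m. disk_poly_coeff \<alpha> (m + b) m i * (1 - t) ^ i * t ^ (m - i))"

lemma disk_poly_const_commute: "disk_poly_const \<alpha> p q = disk_poly_const \<alpha> q p"
  unfolding disk_poly_const_def by (simp add: add_ac mult_ac)

lemma disk_poly_coeff_commute: "disk_poly_coeff \<alpha> p q i = disk_poly_coeff \<alpha> q p i"
  unfolding disk_poly_coeff_def by (simp add: add_ac mult_ac)

lemma power_mult_cnj_power: "z ^ k * cnj z ^ k = of_real (((cmod z)\<^sup>2) ^ k)"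
  by (simp only: of_real_power[of _ k] complex_norm_square power_mult_distrib)

lemma
  assumes z: "z \<in> unit_disk"
  shows disk_poly_eq_power: "disk_poly \<alpha> (m + b) m z = of_real (disk_poly_radial \<alpha> m b ((cmod z)\<^sup>2)) * z ^ b"
    and disk_poly_eq_cnj_power:
      "disk_poly \<alpha> m (m + b) z = of_real (disk_poly_radial \<alpha> m b ((cmod z)\<^sup>2)) * cnj z ^ b"
proof -
  show "disk_poly \<alpha> (m + b) m z = of_real (disk_poly_radial \<alpha> m b ((cmod z)\<^sup>2)) * z ^ b"
  proof -
    have "(\<Sum>i\<le>m. of_real (disk_poly_coeff \<alpha> (m + b) m i * (1 - (cmod z)\<^sup>2) ^ i) * (z ^ (m + b - i) * cnj z ^ (m - i))) =
        of_real (\<Sum>i\<le>m. disk_poly_coeff \<alpha> (m + b) m i * (1 - (cmod z)\<^sup>2) ^ i * ((cmod z)\<^sup>2) ^ (m - i)) * z ^ b"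
      unfolding of_real_sum sum_distrib_right
    proof (rule sum.cong[OF refl])
      fix i assume "i \<in> {..m}"
      then have "m + b - i = (m - i) + b" by simp
      then show "of_real (disk_poly_coeff \<alpha> (m + b) m i * (1 - (cmod z)\<^sup>2) ^ i) * (z ^ (m + b - i) * cnj z ^ (m - i)) =
          of_real (disk_poly_coeff \<alpha> (m + b) m i * (1 - (cmod z)\<^sup>2) ^ i * ((cmod z)\<^sup>2) ^ (m - i)) * z ^ b"
        using power_mult_cnj_power[of z "m - i"] by (simp only: power_add of_real_mult[of _ "((cmod z)\<^sup>2) ^ (m - i)"])
            (simp only: mult_ac)
    qed
    then show ?thesis
      unfolding disk_poly_eq[OF z] disk_poly_radial_def by (simp only: of_real_mult min_absorb2 le_add1 mult.assoc)
  qed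
  show "disk_poly \<alpha> m (m + b) z = of_real (disk_poly_radial \<alpha> m b ((cmod z)\<^sup>2)) * cnj z ^ b"
  proof -
    have "(\<Sum>i\<le>m. of_real (disk_poly_coeff \<alpha> m (m + b) i * (1 - (cmod z)\<^sup>2) ^ i) * (z ^ (m - i) * cnj z ^ (m + b - i))) =
        of_real (\<Sum>i\<le>m. disk_poly_coeff \<alpha> (m + b) m i * (1 - (cmod z)\<^sup>2) ^ i * ((cmod z)\<^sup>2) ^ (m - i)) * cnj z ^ b"
      unfolding of_real_sum sum_distrib_right disk_poly_coeff_commute[of \<alpha> m]
    proof (rule sum.cong[OF refl])
      fix i assume "i \<in> {..m}"
      then have "m + b - i = (m - i) + b" by simp
      then show "of_real (disk_poly_coeff \<alpha> (m + b) m i * (1 - (cmod z)\<^sup>2) ^ i) * (z ^ (m - i) * cnj z ^ (m + b - i)) =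
          of_real (disk_poly_coeff \<alpha> (m + b) m i * (1 - (cmod z)\<^sup>2) ^ i * ((cmod z)\<^sup>2) ^ (m - i)) * cnj z ^ b"
        using power_mult_cnj_power[of z "m - i"] by (simp only: power_add of_real_mult[of _ "((cmod z)\<^sup>2) ^ (m - i)"])
            (simp only: mult_ac)
    qed
    then show ?thesis
      unfolding disk_poly_eq[OF z] disk_poly_radial_def disk_poly_const_commute[of \<alpha> m]
      by (simp only: of_real_mult min_absorb1 le_add1 mult.assoc)
  qed
qed

text \<open>The last factor is the ratio of the Rodrigues sum of the disk polynomial to the shifted
  Jacobi polynomial, and \<open>sqrt (\<alpha> + 1)\<close> is one half of the mass constant of the
  weight. The Gamma function of largest argument, G3, cancels because the falling factorial equals
  G3 / G1.\<close>

lemma jacobi_const_eq: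
  assumes "\<alpha> > -1"
  shows "sqrt ((2 * real m + \<alpha> + real b + 1) * Gamma (real m + \<alpha> + real b + 1) * fact m /
      (Gamma (real m + \<alpha> + 1) * Gamma (real m + real b + 1))) =
    sqrt (\<alpha> + 1) * disk_poly_const \<alpha> (m + b) m *
      (falling_factorial (real (m + b) + real m + \<alpha>) (m + b) * fact m)"
proof -
  define f where "f = falling_factorial (real (m + b) + real m + \<alpha>) (m + b)"
  define G1 where "G1 = Gamma (real m + \<alpha> + 1)"
  define G2 where "G2 = Gamma (real m + \<alpha> + real b + 1)"
  define G3 where "G3 = Gamma (real (m + b) + real m + \<alpha> + 1)"
  have G: "G1 > 0" "G2 > 0" "G3 > 0"
    using assms by (auto simp: G1_def G2_def G3_def intro!: Gamma_real_pos)
  have f: "f * G1 = G3"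
    using falling_factorial_Gamma[of "real (m + b) + real m + \<alpha>" "m + b"] assms
    by (simp add: f_def G1_def G3_def algebra_simps)
  then have "f > 0" using G by (metis zero_less_mult_pos2)
  have f_eq: "f = G3 / G1" using f G by (simp add: field_simps)
  have fact: "Gamma (real m + real b + 1) = fact (m + b)"
    by (metis Gamma_fact add.commute of_nat_add)
  have "disk_poly_const \<alpha> (m + b) m = sqrt ((\<alpha> + real (m + b) + real m + 1) * G2 * G1 /
      ((\<alpha> + 1) * fact (m + b) * fact m * G3\<^sup>2))"
    unfolding disk_poly_const_def G1_def G2_def G3_def by (simp add: add_ac)
  then have "sqrt (\<alpha> + 1) * disk_poly_const \<alpha> (m + b) m * (f * fact m) =
      sqrt (\<alpha> + 1) * sqrt ((\<alpha> + real (m + b) + real m + 1) * G2 * G1 /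
      ((\<alpha> + 1) * fact (m + b) * fact m * G3\<^sup>2)) * sqrt ((f * fact m)\<^sup>2)"
    using \<open>f > 0\<close> by simp
  also have "\<dots> = sqrt ((\<alpha> + 1) * ((\<alpha> + real (m + b) + real m + 1) * G2 * G1 /
      ((\<alpha> + 1) * fact (m + b) * fact m * G3\<^sup>2)) * (f * fact m)\<^sup>2)"
    by (simp only: real_sqrt_mult)
  also have "(\<alpha> + 1) * ((\<alpha> + real (m + b) + real m + 1) * G2 * G1 /
      ((\<alpha> + 1) * fact (m + b) * fact m * G3\<^sup>2)) * (f * fact m)\<^sup>2 =
      (2 * real m + \<alpha> + real b + 1) * G2 * fact m / (G1 * fact (m + b))"
  proof -
    have "c * (x * G2 * G1 / (c * y * h * G3\<^sup>2)) * (G3 / G1 * h)\<^sup>2 = x * G2 * h / (G1 * y)"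
      if "c \<noteq> 0" "y \<noteq> 0" "h \<noteq> 0" for c x y h :: real
      using that G by (simp add: field_simps power2_eq_square)
    from this[of "\<alpha> + 1" "fact (m + b)" "fact m" "\<alpha> + real (m + b) + real m + 1"]
    show ?thesis unfolding f_eq using assms by (simp add: algebra_simps)
  qed
  finally show ?thesis
    unfolding f_def[symmetric] G1_def[symmetric] G2_def[symmetric] fact by simp
qed

lemma jacobi_function_eq:
  assumes "\<alpha> > -1" and t: "t \<in> {0<..<1}"
  shows "jacobi_function m \<alpha> (real b) t =
    sqrt (\<alpha> + 1) * (1 - t) powr (\<alpha> / 2) * t powr (real b / 2) * disk_poly_radial \<alpha> m b t"
proof -
  define f where "f = falling_factorial (real (m + b) + real m + \<alpha>) (m + b)"
  have "f * fact m * shifted_jacobi m \<alpha> (real b) t =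
      (\<Sum>i\<le>m. disk_poly_coeff \<alpha> (m + b) m i * (1 - t) ^ i * t ^ (m - i))"
    unfolding shifted_jacobi_eq[OF t] sum_distrib_left
  proof (rule sum.cong[OF refl])
    fix i assume "i \<in> {..m}"
    \<comment> \<open>The first m + b factors of the falling factorial do not depend on i and form
      f; the other m - i are those of the Jacobi sum.\<close>
    then have "m + b + m - i = (m + b) + (m - i)" by simp
    then have "falling_factorial (real (m + b) + real m + \<alpha>) (m + b + m - i) =
        f * falling_factorial (real m + \<alpha>) (m - i)"
      unfolding f_def by (simp only: falling_factorial_add) simp
    then show "f * fact m * (1 / fact m * ((-1) ^ i * real (m choose i) * real ((m + b) choose i) * fact i *
      falling_factorial (real m + \<alpha>) (m - i) * t ^ (m - i) * (1 - t) ^ i)) =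
      disk_poly_coeff \<alpha> (m + b) m i * (1 - t) ^ i * t ^ (m - i)"
      unfolding disk_poly_coeff_def by simp
  qed
  then show ?thesis
    unfolding jacobi_function_def jacobi_const_eq[OF assms(1)] disk_poly_radial_def f_def[symmetric]
    by (simp add: mult_ac)
qed

section \<open>Matrix entries of radial symbols as integrals over the unit interval\<close>

lemma integral_radial_symbol_disk_measure:
  assumes \<alpha>: "\<alpha> > -1" and a: "a \<in> Linfty (lebesgue_on {0..<1})"
    and P: "P \<in> borel_measurable borel"
  shows "(LINT z|disk_measure \<alpha>. radial_symbol a z * of_real (P ((cmod z)\<^sup>2))) =
    (LINT t:{0<..<1}|lebesgue. a (sqrt t) * of_real ((\<alpha> + 1) * (1 - t) powr \<alpha> * P t))"
proof -
  define \<phi> where "\<phi> t = a (sqrt t) * of_real ((\<alpha> + 1) / pi * (1 - t) powr \<alpha> * P t)" for t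
  have am: "(\<lambda>t. a (sqrt t)) \<in> borel_measurable (lebesgue_on {0..<1})"
    using Linfty_comp_sqrt[OF a] by (simp add: Linfty_def)
  have "(\<lambda>t. complex_of_real ((\<alpha> + 1) / pi * (1 - t) powr \<alpha> * P t)) \<in> borel_measurable borel"
    using P by measurable
  then have "(\<lambda>t. complex_of_real ((\<alpha> + 1) / pi * (1 - t) powr \<alpha> * P t)) \<in> borel_measurable (lebesgue_on {0..<1})"
    by (intro measurable_restrict_space1 measurable_completion) simp
  with am have \<phi>: "\<phi> \<in> borel_measurable (lebesgue_on {0..<1})"
    unfolding \<phi>_def[abs_def] by (rule borel_measurable_times)
  have P': "(\<lambda>z. complex_of_real (P ((cmod z)\<^sup>2))) \<in> borel_measurable (lebesgue_on unit_disk)"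
    using P by (intro measurable_restrict_space1 measurable_completion) simp
  have rad: "radial_symbol a \<in> borel_measurable (lebesgue_on unit_disk)"
    using Linfty_radial_symbol[OF \<alpha> a] by (simp add: Linfty_def borel_measurable_disk_measure)
  have "(LINT z|disk_measure \<alpha>. radial_symbol a z * of_real (P ((cmod z)\<^sup>2))) =
      (LINT z|lebesgue_on unit_disk. disk_weight \<alpha> z *\<^sub>R (radial_symbol a z * of_real (P ((cmod z)\<^sup>2))))"
    by (rule integral_disk_measure[OF \<alpha> borel_measurable_times[OF rad P']])
  also have "\<dots> = (LINT z|lebesgue_on unit_disk. \<phi> ((cmod z)\<^sup>2))"
    by (simp add: \<phi>_def radial_symbol_def disk_weight_def scaleR_conv_of_real mult_ac)
  also have "\<dots> = pi *\<^sub>R (LINT t|lebesgue_on {0..<1}. \<phi> t)"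
    by (rule integral_radial_unit_disk[OF \<phi>])
  also have "\<dots> = (LINT t|lebesgue_on {0..<1}. pi *\<^sub>R \<phi> t)"
    by simp
  also have "\<dots> = (LINT t|lebesgue. indicator {0..<1} t *\<^sub>R (pi *\<^sub>R \<phi> t))"
    by (subst integral_restrict_space) auto
  \<comment> \<open>The centre of the disk, t = 0, is dropped as a null set: the Jacobi functions
    are identified with the radial factors only on the open interval.\<close>
  also have "\<dots> = (LINT t|lebesgue. indicator {0<..<1} t *\<^sub>R (pi *\<^sub>R \<phi> t))"
  proof (rule integral_cong_AE)
    have m: "(\<lambda>t. indicator {0..<1} t *\<^sub>R (pi *\<^sub>R \<phi> t)) \<in> borel_measurable lebesgue"
      using borel_measurable_scaleR[OF borel_measurable_const \<phi>, of pi]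
      by (subst (asm) borel_measurable_restrict_space_iff) auto
    then show "(\<lambda>t. indicator {0..<1} t *\<^sub>R (pi *\<^sub>R \<phi> t)) \<in> borel_measurable lebesgue" .
    have "(\<lambda>t. indicator {0<..<1} t *\<^sub>R (indicator {0..<1} t *\<^sub>R (pi *\<^sub>R \<phi> t))) \<in> borel_measurable lebesgue"
      by (intro borel_measurable_scaleR[OF _ m] borel_measurable_indicator) auto
    then show "(\<lambda>t. indicator {0<..<1} t *\<^sub>R (pi *\<^sub>R \<phi> t)) \<in> borel_measurable lebesgue"
      by (rule measurable_cong[THEN iffD1, rotated]) (auto simp: indicator_def)
    show "AE t in lebesgue. indicator {0..<1} t *\<^sub>R (pi *\<^sub>R \<phi> t) = indicator {0<..<1} t *\<^sub>R (pi *\<^sub>R \<phi> t)"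
      using AE_completion[OF AE_lborel_singleton[of "0::real"]]
      by eventually_elim (auto simp: indicator_def)
  qed
  also have "\<dots> = (LINT t:{0<..<1}|lebesgue. a (sqrt t) * of_real ((\<alpha> + 1) * (1 - t) powr \<alpha> * P t))"
    unfolding set_lebesgue_integral_def
    by (intro Bochner_Integration.integral_cong) (auto simp: \<phi>_def scaleR_conv_of_real)
  finally show ?thesis .
qed

lemma integral_disk_poly_radial:
  assumes \<alpha>: "\<alpha> > -1" and a: "a \<in> Linfty (lebesgue_on {0..<1})"
  shows "(LINT z|disk_measure \<alpha>. radial_symbol a z *
      of_real (disk_poly_radial \<alpha> k b ((cmod z)\<^sup>2) * disk_poly_radial \<alpha> j b ((cmod z)\<^sup>2) * ((cmod z)\<^sup>2) ^ b)) =
    (LINT t:{0<..<1}|lebesgue. a (sqrt t) * of_real (jacobi_function j \<alpha> (real b) t) *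
      of_real (jacobi_function k \<alpha> (real b) t))"
proof -
  have "(\<lambda>t. disk_poly_radial \<alpha> k b t * disk_poly_radial \<alpha> j b t * t ^ b) \<in> borel_measurable borel"
    unfolding disk_poly_radial_def by measurable
  from integral_radial_symbol_disk_measure[OF \<alpha> a this]
  have "(LINT z|disk_measure \<alpha>. radial_symbol a z *
      of_real (disk_poly_radial \<alpha> k b ((cmod z)\<^sup>2) * disk_poly_radial \<alpha> j b ((cmod z)\<^sup>2) * ((cmod z)\<^sup>2) ^ b)) =
    (LINT t:{0<..<1}|lebesgue. a (sqrt t) * of_real ((\<alpha> + 1) * (1 - t) powr \<alpha> *
      (disk_poly_radial \<alpha> k b t * disk_poly_radial \<alpha> j b t * t ^ b)))" .
  also have "\<dots> = (LINT t:{0<..<1}|lebesgue. a (sqrt t) * of_real (jacobi_function j \<alpha> (real b) t) *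
      of_real (jacobi_function k \<alpha> (real b) t))"
  proof (rule set_lebesgue_integral_cong)
    show "{0<..<1::real} \<in> sets lebesgue" by simp
    show "\<forall>t. t \<in> {0<..<1} \<longrightarrow> a (sqrt t) * of_real ((\<alpha> + 1) * (1 - t) powr \<alpha> *
        (disk_poly_radial \<alpha> k b t * disk_poly_radial \<alpha> j b t * t ^ b)) =
      a (sqrt t) * of_real (jacobi_function j \<alpha> (real b) t) * of_real (jacobi_function k \<alpha> (real b) t)"
    proof (intro allI impI)
      fix t :: real assume t: "t \<in> {0<..<1}"
      have e1: "(1 - t) powr (\<alpha> / 2) * (1 - t) powr (\<alpha> / 2) = (1 - t) powr \<alpha>"
        by (simp add: powr_add[symmetric])
      have e2: "t powr (real b / 2) * t powr (real b / 2) = t ^ b"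
        using t by (simp add: powr_add[symmetric] powr_realpow)
      have e3: "sqrt (\<alpha> + 1) * sqrt (\<alpha> + 1) = \<alpha> + 1"
        using \<alpha> by simp
      have "jacobi_function j \<alpha> (real b) t * jacobi_function k \<alpha> (real b) t =
          (sqrt (\<alpha> + 1) * sqrt (\<alpha> + 1)) * ((1 - t) powr (\<alpha> / 2) * (1 - t) powr (\<alpha> / 2)) *
          (disk_poly_radial \<alpha> k b t * disk_poly_radial \<alpha> j b t * (t powr (real b / 2) * t powr (real b / 2)))"
        unfolding jacobi_function_eq[OF \<alpha> t] by (simp only: mult_ac)
      then have "(\<alpha> + 1) * (1 - t) powr \<alpha> * (disk_poly_radial \<alpha> k b t * disk_poly_radial \<alpha> j b t * t ^ b) =
          jacobi_function j \<alpha> (real b) t * jacobi_function k \<alpha> (real b) t"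
        by (simp only: e1 e2 e3)
      then show "a (sqrt t) * of_real ((\<alpha> + 1) * (1 - t) powr \<alpha> *
        (disk_poly_radial \<alpha> k b t * disk_poly_radial \<alpha> j b t * t ^ b)) =
        a (sqrt t) * of_real (jacobi_function j \<alpha> (real b) t) * of_real (jacobi_function k \<alpha> (real b) t)"
        by (simp only: of_real_mult mult.assoc)
    qed
  qed
  finally show ?thesis .
qed

lemma Ltwo_inner_radial_symbol_disk_poly:
  assumes \<alpha>: "\<alpha> > -1" and a: "a \<in> Linfty (lebesgue_on {0..<1})"
    and j: "\<xi> + int j \<ge> 0" and k: "\<xi> + int k \<ge> 0"
  shows "Ltwo_inner (disk_measure \<alpha>) (\<lambda>z. radial_symbol a z * disk_poly \<alpha> (nat (\<xi> + int k)) k z)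
      (disk_poly \<alpha> (nat (\<xi> + int j)) j) = beta_coeff a \<alpha> \<xi> j k"
proof -
  \<comment> \<open>Both disk polynomials have index difference p - q = \<xi>. J and K are their
    smaller indices, and the hypotheses on j and k keep every \<open>nat\<close> exact for negative
    \<xi>.\<close>
  define b where "b = nat \<bar>\<xi>\<bar>"
  define J where "J = nat (min (int j) (int j + \<xi>))"
  define K where "K = nat (min (int k) (int k + \<xi>))"
  have b: "real_of_int \<bar>\<xi>\<bar> = real b" by (simp add: b_def)
  have eq: "disk_poly \<alpha> (nat (\<xi> + int k)) k z * cnj (disk_poly \<alpha> (nat (\<xi> + int j)) j z) =
      of_real (disk_poly_radial \<alpha> K b ((cmod z)\<^sup>2) * disk_poly_radial \<alpha> J b ((cmod z)\<^sup>2) * ((cmod z)\<^sup>2) ^ b)"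
    if z: "z \<in> unit_disk" for z
  proof (cases "\<xi> \<ge> 0")
    case True
    then have "nat (\<xi> + int k) = K + b" "k = K" "nat (\<xi> + int j) = J + b" "j = J"
      by (auto simp: b_def J_def K_def)
    then have "disk_poly \<alpha> (nat (\<xi> + int k)) k z * cnj (disk_poly \<alpha> (nat (\<xi> + int j)) j z) =
        of_real (disk_poly_radial \<alpha> K b ((cmod z)\<^sup>2)) * of_real (disk_poly_radial \<alpha> J b ((cmod z)\<^sup>2)) *
        (z ^ b * cnj z ^ b)"
      by (simp add: disk_poly_eq_power[OF z])
    then show ?thesis by (simp only: power_mult_cnj_power of_real_mult)
  next
    case False
    then have "nat (\<xi> + int k) = K" "k = K + b" "nat (\<xi> + int j) = J" "j = J + b"
      using j k by (auto simp: b_def J_def K_def)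
    then have "disk_poly \<alpha> (nat (\<xi> + int k)) k z * cnj (disk_poly \<alpha> (nat (\<xi> + int j)) j z) =
        of_real (disk_poly_radial \<alpha> K b ((cmod z)\<^sup>2)) * of_real (disk_poly_radial \<alpha> J b ((cmod z)\<^sup>2)) *
        (z ^ b * cnj z ^ b)"
      by (simp add: disk_poly_eq_cnj_power[OF z])
    then show ?thesis by (simp only: power_mult_cnj_power of_real_mult)
  qed
  have "Ltwo_inner (disk_measure \<alpha>) (\<lambda>z. radial_symbol a z * disk_poly \<alpha> (nat (\<xi> + int k)) k z)
      (disk_poly \<alpha> (nat (\<xi> + int j)) j) = (LINT z|disk_measure \<alpha>. radial_symbol a z *
      of_real (disk_poly_radial \<alpha> K b ((cmod z)\<^sup>2) * disk_poly_radial \<alpha> J b ((cmod z)\<^sup>2) * ((cmod z)\<^sup>2) ^ b))"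
    unfolding Ltwo_inner_def mult.assoc[of "radial_symbol a _"]
    by (intro Bochner_Integration.integral_cong refl arg_cong2[of _ _ _ _ "(*)"] eq) simp
  also have "\<dots> = beta_coeff a \<alpha> \<xi> j k"
    unfolding integral_disk_poly_radial[OF \<alpha> a] beta_coeff_def b J_def K_def by (rule refl)
  finally show ?thesis .
qed

lemma Ltwo_inner_toeplitz:
  assumes "\<alpha> > -1" "g \<in> Linfty (disk_measure \<alpha>)" "f \<in> poly_bergman n \<alpha>" "u \<in> poly_bergman n \<alpha>"
  shows "Ltwo_inner (disk_measure \<alpha>) (toeplitz n \<alpha> g f) u =
    Ltwo_inner (disk_measure \<alpha>) (\<lambda>z. g z * f z) u"
proof -
  have gf: "(\<lambda>z. g z * f z) \<in> Ltwo (disk_measure \<alpha>)"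
    using assms by (intro Ltwo_mult_Linfty poly_bergman_Ltwo)
  have "Ltwo_inner (disk_measure \<alpha>) (\<lambda>z. g z * f z) u -
      Ltwo_inner (disk_measure \<alpha>) (poly_bergman_proj n \<alpha> (\<lambda>z. g z * f z)) u = 0"
    using poly_bergman_proj_orthogonal[OF assms(1) gf assms(4)]
      Ltwo_inner_diff_left[OF gf poly_bergman_Ltwo[OF poly_bergman_proj_mem[OF assms(1) gf]]
        poly_bergman_Ltwo[OF assms(4)]] by simp
  then show ?thesis
    using assms(3) by (simp add: toeplitz_def)
qed

text \<open>The shift by max 0 (- \<xi>) in the block is what makes \<xi> + j nonnegative for each
  index that occurs, so entries need to agree only where \<open>nat (\<xi> + int j)\<close> does not
  truncate.\<close>

lemma frequency_block_cong:
  assumes "\<And>j k. j < n \<Longrightarrow> k < n \<Longrightarrow> \<xi> + int j \<ge> 0 \<Longrightarrow> \<xi> + int k \<ge> 0 \<Longrightarrow> A j k = B j k"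
  shows "frequency_block n \<xi> A = frequency_block n \<xi> B"
  unfolding frequency_block_def Let_def by (intro cong_mat refl) (auto intro!: assms)

theorem proposition8p5:
  fixes n :: nat and \<alpha> :: real and a :: "real \<Rightarrow> complex"
  assumes "n \<ge> 1" and "\<alpha> > -1" and "a \<in> Linfty (lebesgue_on {0..<1})"
  shows "toeplitz n \<alpha> (radial_symbol a) \<in> radial_operators n \<alpha> \<and>
         Phi n \<alpha> (toeplitz n \<alpha> (radial_symbol a)) = gamma_seq n \<alpha> a"
proof
  show T: "toeplitz n \<alpha> (radial_symbol a) \<in> radial_operators n \<alpha>"
    using assms by (intro toeplitz_radial_operator)
  show "Phi n \<alpha> (toeplitz n \<alpha> (radial_symbol a)) = gamma_seq n \<alpha> a"
  proof
    fix \<xi> :: int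
    have "Ltwo_inner (disk_measure \<alpha>)
        (toeplitz n \<alpha> (radial_symbol a) (disk_poly \<alpha> (nat (\<xi> + int k)) k))
        (disk_poly \<alpha> (nat (\<xi> + int j)) j) = beta_coeff a \<alpha> \<xi> j k"
      if "j < n" "k < n" "\<xi> + int j \<ge> 0" "\<xi> + int k \<ge> 0" for j k
      using that assms
      by (simp add: Ltwo_inner_toeplitz Linfty_radial_symbol disk_poly_in_poly_bergman
          Ltwo_inner_radial_symbol_disk_poly)
    \<comment> \<open>T resolves the restriction of \<open>Phi\<close> to radial operators. For
      \<xi> < 1 - n both sequences take the value \<open>undefined\<close>.\<close>
    then show "Phi n \<alpha> (toeplitz n \<alpha> (radial_symbol a)) \<xi> = gamma_seq n \<alpha> a \<xi>"
      using T by (auto simp: Phi_def gamma_seq_def restrict_def intro!: frequency_block_cong)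
  qed
qed

end
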